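(* Let $M\ge 1$, $p>1$ and $N>0$. There exists a constant $C=C(M,N,p)>0$ such that for every centered probability measure $f\,d\gamma$ on $\mathbb{R}$ with $\sqrt f\in W^{1,2}(\mathbb{R},d\gamma)$, $\int_{\mathbb{R}}|x|^2 f\,d\gamma\le M$ and $\int_{\mathbb{R}} |f|^{2p-1}\,d\gamma\le N$, $$\|f-1\|_{L^p(d\gamma)}\le C\,\delta(f)^{\frac{1}{8p}}.$$
   Context: On $\mathbb{R}^n$ (here $n=1$), $d\gamma=(2\pi)^{-n/2}e^{-|x|^2/2}dx$ is the standard Gaussian measure. For a probability measure $f\,d\gamma$ with $\sqrt f\in W^{1,2}(\mathbb{R}^n,d\gamma)$, the Fisher information is $\mathrm{I}(f)=\int \frac{|\nabla f|^2}{f}\,d\gamma$, the relative entropy is $\mathrm{H}(f)=\int f\log f\,d\gamma$, and the log-Sobolev deficit is $\delta(f)=\frac12 \mathrm{I}(f)-\mathrm{H}(f)\ge 0$. A probability measure $\mu$ is centered if $\int x\,d\mu=0$. *)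

theory Defs
  imports "HOL-Probability.Probability"
begin

definition gauss :: "real measure" where
  "gauss = density lborel (\<lambda>x. ennreal (std_normal_density x))"

definition in_Lp :: "'a measure \<Rightarrow> real \<Rightarrow> ('a \<Rightarrow> real) \<Rightarrow> bool" where
  "in_Lp M p u \<longleftrightarrow> u \<in> borel_measurable M \<and> integrable M (\<lambda>x. \<bar>u x\<bar> powr p)"

text \<open>Meaningful only together with \<open>in_Lp M p u\<close>, since the Bochner integral of a
  non-integrable function is 0.\<close>

definition Lp_norm :: "'a measure \<Rightarrow> real \<Rightarrow> ('a \<Rightarrow> real) \<Rightarrow> real" where
  "Lp_norm M p u = (LINT x|M. \<bar>u x\<bar> powr p) powr (1 / p)"

definition test_function :: "(real \<Rightarrow> real) \<Rightarrow> bool" where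
  "test_function \<phi> \<longleftrightarrow>
     (\<forall>k x. (deriv ^^ k) \<phi> differentiable (at x)) \<and> compact (closure {x. \<phi> x \<noteq> 0})"

definition locally_integrable :: "(real \<Rightarrow> real) \<Rightarrow> bool" where
  "locally_integrable u \<longleftrightarrow> (\<forall>K. compact K \<longrightarrow> set_integrable lborel K u)"

definition has_weak_deriv :: "(real \<Rightarrow> real) \<Rightarrow> (real \<Rightarrow> real) \<Rightarrow> bool" where
  "has_weak_deriv u g \<longleftrightarrow> locally_integrable u \<and> locally_integrable g \<and>
     (\<forall>\<phi>. test_function \<phi> \<longrightarrow>
        (LINT x|lborel. u x * deriv \<phi> x) = - (LINT x|lborel. g x * \<phi> x))"

text \<open>Weak derivatives are unique almost everywhere, so the integral in \<open>fisher_information\<close>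
  does not depend on the choice made here.\<close>

definition weak_deriv :: "(real \<Rightarrow> real) \<Rightarrow> real \<Rightarrow> real" where
  "weak_deriv u = (SOME g. has_weak_deriv u g)"

definition in_W12_gauss :: "(real \<Rightarrow> real) \<Rightarrow> bool" where
  "in_W12_gauss u \<longleftrightarrow> in_Lp gauss 2 u \<and> (\<exists>g. has_weak_deriv u g \<and> in_Lp gauss 2 g)"

text \<open>For a probability density \<open>f\<close> with \<open>sqrt f\<close> in \<open>W\<^sup>1\<^sup>,\<^sup>2\<close>, the weak derivative of \<open>f\<close> exists,
  vanishes almost everywhere on \<open>{f = 0}\<close> and equals \<open>2 * sqrt f * (sqrt f)'\<close>; hence the
  integrand below, with \<open>0 / 0 = 0\<close>, is integrable. The entropy integrand, with
  \<open>0 * ln 0 = 0\<close>, is then integrable as well, so neither Bochner integral takes its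
  default value.\<close>

definition fisher_information :: "(real \<Rightarrow> real) \<Rightarrow> real" where
  "fisher_information f = (LINT x|gauss. (weak_deriv f x)\<^sup>2 / f x)"

definition relative_entropy :: "(real \<Rightarrow> real) \<Rightarrow> real" where
  "relative_entropy f = (LINT x|gauss. f x * ln (f x))"

definition deficit :: "(real \<Rightarrow> real) \<Rightarrow> real" where
  "deficit f = fisher_information f / 2 - relative_entropy f"

text \<open>Almost-everywhere nonnegativity is required separately because \<open>ennreal\<close> truncates
  negative values to 0.\<close>

definition gauss_prob_density :: "(real \<Rightarrow> real) \<Rightarrow> bool" where
  "gauss_prob_density f \<longleftrightarrow> f \<in> borel_measurable borel \<and> (AE x in gauss. 0 \<le> f x) \<and>
     prob_space (density gauss (\<lambda>x. ennreal (f x)))"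

definition centered :: "real measure \<Rightarrow> bool" where
  "centered \<mu> \<longleftrightarrow> integrable \<mu> (\<lambda>x. x) \<and> (LINT x|\<mu>. x) = 0"

end

theory Submission
  imports Defs
begin

text \<open>Write \<open>\<phi>\<close> for the Gaussian density and \<open>\<rho> = f * \<phi>\<close>, and let \<open>T\<close> be the increasing map that transports
\<open>\<rho> dx\<close> to \<open>\<phi> dx\<close>, so that \<open>T' = \<rho> / \<phi>(T)\<close>. Then \<open>ln f = ln T' - T\<^sup>2 / 2 + x\<^sup>2 / 2\<close>. Estimating
\<open>ln T' \<le> T' - 1\<close> in the entropy and integrating \<open>T' - 1\<close> by parts completes a square in the Fisher
information, and what is left is the log-Sobolev inequality with a remainder
(\<open>defect_square_integral_le\<close>): the integral of \<open>(f' / f + T - x)\<^sup>2 * \<rho> / 2\<close> is at most the deficit.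

Stability rests on the observation that \<open>(f' / f + T - x) * \<rho>\<close> is exactly the derivative of
\<open>\<rho> - \<phi>(T)\<close>. Hence \<open>\<bar>\<rho> - \<phi>(T)\<bar> \<le> \<epsilon>\<close> everywhere, where \<open>\<epsilon>\<^sup>2\<close> is twice the deficit
(\<open>profile_diff_le\<close>); in terms of the distribution function this is an approximate autonomous
equation whose exact solutions are the translates of the Gaussian. Where \<open>\<phi>(T)\<close> is large compared
with \<open>\<epsilon>\<close> it says that \<open>T'\<close> is close to \<open>1\<close>, so \<open>x - T x\<close> stays close to the median \<open>m\<close> of \<open>\<rho> dx\<close>
(\<open>displacement\<close>). The assumptions that \<open>\<rho> dx\<close> is centered and has second moment at most \<open>M\<close> bound
the median by a multiple of \<open>sqrt \<epsilon>\<close> (\<open>median_le\<close>); it is here that the rate \<open>sqrt \<epsilon>\<close> arises, as the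
tail outside \<open>\<phi>(T) \<ge> 2 * \<epsilon>\<close> has mass of order \<open>\<epsilon>\<close> and the second moment turns this into a first moment of order
\<open>sqrt \<epsilon>\<close>. Comparing \<open>\<phi>(T x)\<close> with \<open>\<phi> x\<close> then gives an L1 distance of order \<open>sqrt \<epsilon>\<close> (\<open>L1_le\<close>), that
is, of the fourth root of the deficit. Interpolating between L1 and the bounded norm of exponent
\<open>2 * p - 1\<close> halves the exponent for the integral of \<open>\<bar>f - 1\<bar> powr p\<close>, and the root of order \<open>p\<close> gives
\<open>1 / (8 * p)\<close>.

The transport argument is carried out for positive densities; a density that may vanish is first
mixed with the Gaussian, which raises the deficit by an arbitrarily small amount only
(\<open>L1_stability_square\<close>). A weak derivative enters through the absolutely continuous representative of
\<open>sqrt f\<close>, given by the du Bois-Reymond lemma, for which the Leibniz rule holds by Fubini.\<close>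

section \<open>Test functions on the real line\<close>

text \<open>The innermost derivative is peeled off first. In this form closure under sums and products follows by
induction on the order, since the derivative of a product is again a sum of products.\<close>

primrec differentiable_upto :: "nat \<Rightarrow> (real \<Rightarrow> real) \<Rightarrow> bool" where
  "differentiable_upto 0 f \<longleftrightarrow> (\<forall>x. f differentiable (at x))"
| "differentiable_upto (Suc k) f \<longleftrightarrow> (\<forall>x. f differentiable (at x)) \<and> differentiable_upto k (deriv f)"

definition smooth :: "(real \<Rightarrow> real) \<Rightarrow> bool" where
  "smooth f \<longleftrightarrow> (\<forall>k. differentiable_upto k f)"

lemma differentiable_upto_iff:
  "differentiable_upto k f \<longleftrightarrow> (\<forall>j\<le>k. \<forall>x. (deriv ^^ j) f differentiable (at x))"
proof (induction k arbitrary: f)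
  case (Suc k)
  have "(\<forall>j\<le>Suc k. \<forall>x. (deriv ^^ j) f differentiable (at x)) \<longleftrightarrow>
      (\<forall>x. f differentiable (at x)) \<and> (\<forall>j\<le>k. \<forall>x. (deriv ^^ j) (deriv f) differentiable (at x))"
    unfolding less_Suc_eq_le[symmetric] All_less_Suc2 by (simp add: funpow_swap1)
  with Suc show ?case by simp
qed simp

lemma smooth_iff: "smooth f \<longleftrightarrow> (\<forall>k x. (deriv ^^ k) f differentiable (at x))"
  unfolding smooth_def differentiable_upto_iff by blast

lemma differentiable_upto_SucD: "differentiable_upto (Suc k) f \<Longrightarrow> differentiable_upto k f"
  by (induction k arbitrary: f) auto

lemma differentiable_upto_differentiable: "differentiable_upto k f \<Longrightarrow> f differentiable (at x)"
  by (cases k) auto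

lemma DERIV_deriv_differentiable: "f differentiable (at x) \<Longrightarrow> DERIV f x :> deriv f (x::real)"
  by (simp add: DERIV_deriv_iff_real_differentiable)

lemma differentiable_upto_add:
  "differentiable_upto k f \<Longrightarrow> differentiable_upto k g \<Longrightarrow> differentiable_upto k (\<lambda>x. f x + g x)"
proof (induction k arbitrary: f g)
  case (Suc k)
  then have "deriv (\<lambda>x. f x + g x) = (\<lambda>x. deriv f x + deriv g x)"
    by (intro ext DERIV_imp_deriv DERIV_add DERIV_deriv_differentiable) auto
  with Suc show ?case by auto
qed auto

lemma differentiable_upto_mult:
  "differentiable_upto k f \<Longrightarrow> differentiable_upto k g \<Longrightarrow> differentiable_upto k (\<lambda>x. f x * g x)"
proof (induction k arbitrary: f g)
  case (Suc k)
  then have d: "deriv (\<lambda>x. f x * g x) = (\<lambda>x. deriv f x * g x + deriv g x * f x)"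
    by (intro ext DERIV_imp_deriv DERIV_mult DERIV_deriv_differentiable) auto
  have "differentiable_upto k (\<lambda>x. deriv f x * g x + deriv g x * f x)"
    using Suc by (intro differentiable_upto_add Suc.IH) (auto dest: differentiable_upto_SucD simp del: differentiable_upto.simps(2), auto)
  with Suc.prems d show ?case by auto
qed auto

lemma differentiable_upto_const: "differentiable_upto k (\<lambda>x. c)"
proof (induction k arbitrary: c)
  case (Suc k)
  then show ?case by simp
qed simp

lemma differentiable_upto_affine:
  "differentiable_upto k f \<Longrightarrow> differentiable_upto k (\<lambda>x. f (c * x + d))"
proof (induction k arbitrary: f)
  case 0
  have "DERIV (\<lambda>x. f (c * x + d)) x :> deriv f (c * x + d) * c" for x
    by (rule DERIV_chain'[where g=f and f="\<lambda>x. c * x + d"])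
       (auto intro!: derivative_eq_intros DERIV_deriv_differentiable 0[simplified, rule_format])
  then show ?case by (auto simp: real_differentiable_def)
next
  case (Suc k)
  have D: "DERIV (\<lambda>x. f (c * x + d)) x :> deriv f (c * x + d) * c" for x
    by (rule DERIV_chain'[where g=f and f="\<lambda>x. c * x + d"])
       (use Suc.prems in \<open>auto intro!: derivative_eq_intros DERIV_deriv_differentiable\<close>)
  have "differentiable_upto k (\<lambda>x. deriv f (c * x + d) * c)"
    using Suc by (intro differentiable_upto_mult differentiable_upto_const Suc.IH) auto
  moreover have "deriv (\<lambda>x. f (c * x + d)) = (\<lambda>x. deriv f (c * x + d) * c)"
    using D by (intro ext DERIV_imp_deriv)
  ultimately show ?case using D by (auto simp: real_differentiable_def)
qed

text \<open>For \<open>P = 1\<close> this is the classical flat function \<open>exp (- 1 / x)\<close>. Admitting an arbitrary polynomial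
in \<open>1 / x\<close> makes the family closed under differentiation, which is what gives smoothness.\<close>

definition flat_exp :: "real poly \<Rightarrow> real \<Rightarrow> real" where
  "flat_exp P x = (if x > 0 then poly P (1 / x) * exp (- (1 / x)) else 0)"

lemma poly_times_exp_tendsto_0: "((\<lambda>t. poly P t * exp (- t)) \<longlongrightarrow> (0::real)) at_top"
proof -
  have "((\<lambda>t. \<Sum>i\<le>degree P. coeff P i * (t ^ i / exp t)) \<longlongrightarrow> (\<Sum>i\<le>degree P. coeff P i * 0)) at_top"
    by (intro tendsto_intros tendsto_power_div_exp_0)
  moreover have "(\<lambda>t. \<Sum>i\<le>degree P. coeff P i * (t ^ i / exp t)) = (\<lambda>t. poly P t * exp (- t))"
    by (auto simp: poly_altdef sum_distrib_right exp_minus field_simps sum_divide_distrib)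
  ultimately show ?thesis by simp
qed

lemma DERIV_flat_exp: "DERIV (flat_exp P) x :> flat_exp ([:0, 0, 1:] * (P - pderiv P)) x"
proof -
  consider "x > 0" | "x < 0" | "x = 0" by linarith
  then show ?thesis
  proof cases
    case 1
    have "DERIV (\<lambda>x. poly P (1 / x) * exp (- (1 / x))) x :> flat_exp ([:0, 0, 1:] * (P - pderiv P)) x"
      using 1 by (auto intro!: derivative_eq_intros simp: flat_exp_def field_simps power2_eq_square)
    then show ?thesis
      by (rule has_field_derivative_transform_within_open[where S="{0<..}"]) (use 1 in \<open>auto simp: flat_exp_def\<close>)
  next
    case 2
    have "DERIV (\<lambda>x. 0) x :> flat_exp ([:0, 0, 1:] * (P - pderiv P)) x"
      using 2 by (auto simp: flat_exp_def)
    then show ?thesis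
      by (rule has_field_derivative_transform_within_open[where S="{..<0}"]) (use 2 in \<open>auto simp: flat_exp_def\<close>)
  next
    case 3
    have "((\<lambda>h. poly (pCons 0 P) (inverse h) * exp (- inverse h)) \<longlongrightarrow> 0) (at_right 0)"
      by (rule filterlim_compose[OF poly_times_exp_tendsto_0 filterlim_inverse_at_top_right])
    then have "((\<lambda>h. flat_exp P h / h) \<longlongrightarrow> 0) (at_right 0)"
      by (rule Lim_transform_eventually)
         (auto simp: eventually_at_filter flat_exp_def field_simps)
    moreover have "((\<lambda>h. flat_exp P h / h) \<longlongrightarrow> 0) (at_left 0)"
      by (rule Lim_transform_eventually[OF tendsto_const])
         (auto simp: eventually_at_filter flat_exp_def)
    ultimately have "((\<lambda>h. flat_exp P h / h) \<longlongrightarrow> 0) (at 0)"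
      by (simp add: filterlim_split_at)
    then show ?thesis using 3 by (simp add: DERIV_def flat_exp_def)
  qed
qed

lemma differentiable_upto_flat_exp: "differentiable_upto k (flat_exp P)"
proof (induction k arbitrary: P)
  case 0
  show ?case using DERIV_flat_exp by (auto simp: real_differentiable_def)
next
  case (Suc k)
  have "deriv (flat_exp P) = flat_exp ([:0, 0, 1:] * (P - pderiv P))"
    using DERIV_flat_exp by (intro ext DERIV_imp_deriv)
  with Suc show ?case using DERIV_flat_exp by (auto simp: real_differentiable_def)
qed

lemma test_functionI:
  assumes "smooth \<phi>" and "\<And>x. \<phi> x \<noteq> 0 \<Longrightarrow> a \<le> x \<and> x \<le> b"
  shows "test_function \<phi>"
proof -
  have "closure {x. \<phi> x \<noteq> 0} \<subseteq> {a..b}"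
    using assms(2) by (intro closure_minimal) auto
  then have "compact (closure {x. \<phi> x \<noteq> 0})"
    by (meson bounded_closed_interval bounded_subset closed_closure compact_eq_bounded_closed)
  with assms(1) show ?thesis by (auto simp: test_function_def smooth_iff)
qed

lemma test_function_smooth: "test_function \<phi> \<Longrightarrow> smooth \<phi>"
  by (simp add: test_function_def smooth_iff)

lemma test_function_support:
  assumes "test_function \<phi>"
  shows "\<exists>R>0. \<forall>x. \<bar>x\<bar> \<ge> R \<longrightarrow> \<phi> x = 0"
proof -
  have "bounded (closure {x. \<phi> x \<noteq> 0})"
    using assms by (auto simp: test_function_def compact_imp_bounded)
  then obtain B where "B > 0" "\<And>x. x \<in> closure {x. \<phi> x \<noteq> 0} \<Longrightarrow> norm x < B"
    using bounded_pos_less by blast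
  then show ?thesis
    using closure_subset[of "{x. \<phi> x \<noteq> 0}"] by (intro exI[of _ B]) force
qed

lemma test_function_DERIV: "test_function \<phi> \<Longrightarrow> DERIV \<phi> x :> deriv \<phi> x"
  by (metis DERIV_deriv_differentiable differentiable_upto_differentiable smooth_def test_function_smooth)

lemma smooth_isCont: "smooth \<phi> \<Longrightarrow> isCont \<phi> x"
  by (metis DERIV_deriv_differentiable DERIV_isCont differentiable_upto_differentiable smooth_def)

lemma smooth_deriv: "smooth \<phi> \<Longrightarrow> smooth (deriv \<phi>)"
  using differentiable_upto.simps(2) smooth_def by blast

text \<open>A smooth function that is positive exactly on the interval \<open>(a, b)\<close>; as the sharpness \<open>n\<close> grows it
increases to the indicator of that interval.\<close>

definition bump :: "real \<Rightarrow> real \<Rightarrow> real \<Rightarrow> real \<Rightarrow> real" where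
  "bump n a b x = flat_exp 1 (n * x + (- n * a)) * flat_exp 1 ((- n) * x + n * b)"

lemma bump_eq: "n > 0 \<Longrightarrow> bump n a b x =
    (if a < x \<and> x < b then exp (- (1 / (n * (x - a)))) * exp (- (1 / (n * (b - x)))) else 0)"
  by (simp add: bump_def flat_exp_def flip: right_diff_distrib')
     (auto simp: zero_less_mult_iff algebra_simps)

lemma test_function_bump: "n > 0 \<Longrightarrow> test_function (bump n a b)"
proof (rule test_functionI[of _ a b])
  assume n: "n > 0"
  show "smooth (bump n a b)"
    unfolding smooth_def bump_def[abs_def]
    by (intro allI differentiable_upto_mult differentiable_upto_affine differentiable_upto_flat_exp)
  show "a \<le> x \<and> x \<le> b" if "bump n a b x \<noteq> 0" for x
    using that n by (simp add: bump_eq split: if_splits)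
qed

lemma bump_nonneg: "n > 0 \<Longrightarrow> 0 \<le> bump n a b x"
  by (simp add: bump_eq)

lemma bump_le: "n > 0 \<Longrightarrow> bump n a b x \<le> indicator {a..b} x"
  by (auto simp: bump_eq indicator_def mult_le_one)

lemma bump_tendsto: "(\<lambda>n. bump (real (Suc n)) a b x) \<longlonglongrightarrow> indicator {a<..<b} x"
proof (cases "a < x \<and> x < b")
  case True
  have *: "(\<lambda>n. 1 / (real (Suc n) * c)) \<longlonglongrightarrow> 0" if "c > 0" for c
    using tendsto_mult_left[OF LIMSEQ_Suc[OF lim_1_over_n], of "1 / c"] that
    by (simp add: field_simps)
  have "(\<lambda>n. exp (- (1 / (real (Suc n) * (x - a)))) * exp (- (1 / (real (Suc n) * (b - x))))) \<longlonglongrightarrow> exp (-0) * exp (-0)"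
    using True by (intro tendsto_intros *) auto
  then show ?thesis using True by (simp add: bump_eq)
qed (auto simp: bump_eq)

lemma locally_integrable_Icc: "locally_integrable w \<Longrightarrow> set_integrable lborel {a..b::real} w"
  by (simp add: locally_integrable_def)

section \<open>Weak derivatives and indefinite integrals\<close>

lemma borel_measurable_if_integrable_Icc:
  assumes "\<And>a b. set_integrable lborel {a..b::real} w"
  shows "(w :: real \<Rightarrow> real) \<in> borel_measurable borel"
proof (rule borel_measurable_LIMSEQ_real)
  show "(\<lambda>x. indicator {- real n..real n} x *\<^sub>R w x) \<in> borel_measurable borel" for n
    using borel_measurable_integrable[OF assms[of "- real n" "real n", unfolded set_integrable_def]]
    by simp
  show "(\<lambda>n. indicator {- real n..real n} x *\<^sub>R w x) \<longlonglongrightarrow> w x" for x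
  proof (rule tendsto_eventually)
    obtain N :: nat where "\<bar>x\<bar> \<le> real N" using real_arch_simple by blast
    then show "\<forall>\<^sub>F n in sequentially. indicator {- real n..real n} x *\<^sub>R w x = w x"
      unfolding eventually_sequentially by (intro exI[of _ N]) (auto simp: indicator_def)
  qed
qed

text \<open>On a bounded window the positive and the negative part of the function are densities of two finite
measures that agree on all half-lines, hence coincide.\<close>

lemma AE_eq_0_if_interval_integrals_0:
  fixes w :: "real \<Rightarrow> real"
  assumes w: "\<And>a b. set_integrable lborel {a..b} w"
    and 0: "\<And>a b. a < b \<Longrightarrow> (LBINT x:{a<..<b}. w x) = 0"
  shows "AE x in lborel. w x = 0"
proof -
  have [measurable]: "w \<in> borel_measurable borel" by (rule borel_measurable_if_integrable_Icc[OF w])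
  have "AE x in lborel. x \<in> {- real n<..<real n} \<longrightarrow> w x = 0" for n
  proof -
    let ?I = "{- real n<..<real n}"
    define v where "v = (\<lambda>x. indicator ?I x *\<^sub>R w x)"
    have v: "integrable lborel v"
      using set_integrable_subset[OF w[of "- real n" "real n"], of ?I] unfolding v_def set_integrable_def
      by (simp add: greaterThanLessThan_subseteq_atLeastAtMost_iff)
    have vI: "(LBINT x:{a<..}. v x) = 0" for a
    proof -
      have "(LBINT x:{a<..}. v x) = (LBINT x:{max a (- real n)<..<real n}. w x)"
        unfolding set_lebesgue_integral_def v_def by (intro Bochner_Integration.integral_cong) (auto simp: indicator_def)
      also have "\<dots> = 0"
        by (cases "max a (- real n) < real n") (use 0 in \<open>auto simp: set_lebesgue_integral_def\<close>)
      finally show ?thesis .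
    qed
    have fin: "(\<integral>\<^sup>+x. ennreal (u x) \<partial>lborel) < \<infinity>" if "integrable lborel u" for u :: "real \<Rightarrow> real"
    proof -
      have "(\<integral>\<^sup>+x. ennreal (u x) \<partial>lborel) \<le> (\<integral>\<^sup>+x. ennreal (norm (u x)) \<partial>lborel)"
        by (intro nn_integral_mono ennreal_leI) auto
      then show ?thesis using that by (auto simp: integrable_iff_bounded)
    qed
    have vm: "integrable lborel (\<lambda>x. - v x)" using v by simp
    have "density lborel v = density lborel (\<lambda>x. - v x)"
    proof (rule measure_eqI_lessThan)
      fix a
      have part: "integrable lborel (\<lambda>x. indicator {a<..} x * u x)" if "integrable lborel u" for u :: "real \<Rightarrow> real"
        using integrable_mult_indicator[OF _ that, of "{a<..}"] by simp
      have em: "emeasure (density lborel u) {a<..} = (\<integral>\<^sup>+x. ennreal (indicator {a<..} x * u x) \<partial>lborel)"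
        if "integrable lborel u" for u :: "real \<Rightarrow> real"
        using that by (subst emeasure_density) (auto intro!: nn_integral_cong simp: indicator_def)
      show "emeasure (density lborel v) {a<..} < \<infinity>"
        unfolding em[OF v] by (rule fin[OF part[OF v]])
      let ?P = "\<integral>\<^sup>+x. ennreal (indicator {a<..} x * v x) \<partial>lborel"
      let ?Q = "\<integral>\<^sup>+x. ennreal (indicator {a<..} x * - v x) \<partial>lborel"
      have "enn2real ?P - enn2real ?Q = 0"
        using real_lebesgue_integral_def[OF part[OF v]] vI[of a] by (simp add: set_lebesgue_integral_def)
      then have "?P = ?Q"
        using fin[OF part[OF v]] fin[OF part[OF vm]] by (metis eq_iff_diff_eq_0 ennreal_enn2real infinity_ennreal_def)
      then show "emeasure (density lborel v) {a<..} = emeasure (density lborel (\<lambda>x. - v x)) {a<..}"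
        unfolding em[OF v] em[OF vm] .
    qed simp_all
    then have "AE x in lborel. ennreal (v x) = ennreal (- v x)"
      using v fin[OF v] by (subst (asm) finite_density_unique) auto
    then show ?thesis
    proof (rule AE_mp, intro AE_I2 impI)
      fix x assume "ennreal (v x) = ennreal (- v x)" "x \<in> ?I"
      then have "ennreal (w x) = ennreal (- w x)" by (simp add: v_def)
      then show "w x = 0"
        by (cases "w x \<ge> 0") (auto simp: ennreal_neg ennreal_eq_0_iff dest!: sym[of 0])
    qed
  qed
  then have "AE x in lborel. \<forall>n. x \<in> {- real n<..<real n} \<longrightarrow> w x = 0"
    unfolding AE_all_countable by blast
  then show ?thesis
  proof (rule AE_mp, intro AE_I2 impI)
    fix x assume *: "\<forall>n. x \<in> {- real n<..<real n} \<longrightarrow> w x = 0"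
    obtain n where "\<bar>x\<bar> < real n" using reals_Archimedean2 by blast
    then show "w x = 0" using *[rule_format, of n] by (auto simp: abs_less_iff)
  qed
qed

lemma integrable_mult_test_function:
  assumes w: "locally_integrable w" and "smooth \<psi>" and R: "\<And>x. \<bar>x\<bar> \<ge> R \<Longrightarrow> \<psi> x = 0"
  shows "integrable lborel (\<lambda>x. w x * \<psi> x)"
proof -
  have cont: "continuous_on UNIV \<psi>"
    using smooth_isCont[OF assms(2)] by (simp add: continuous_on_eq_continuous_at)
  have [measurable]: "\<psi> \<in> borel_measurable borel"
    by (rule borel_measurable_continuous_onI[OF cont])
  have [measurable]: "w \<in> borel_measurable borel"
    by (rule borel_measurable_if_integrable_Icc[OF locally_integrable_Icc[OF w]])
  have "bounded (\<psi> ` {-R..R})"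
    by (intro compact_imp_bounded compact_continuous_image continuous_on_subset[OF cont]) auto
  then obtain B where B: "\<And>x. x \<in> {-R..R} \<Longrightarrow> norm (\<psi> x) \<le> B"
    unfolding bounded_iff by blast
  show ?thesis
  proof (rule Bochner_Integration.integrable_bound)
    show "integrable lborel (\<lambda>x. B * (indicator {-R..R} x *\<^sub>R w x))"
      using locally_integrable_Icc[OF w, of "-R" R] unfolding set_integrable_def by simp
    show "AE x in lborel. norm (w x * \<psi> x) \<le> norm (B * (indicator {-R..R} x *\<^sub>R w x))"
    proof (rule AE_I2)
      fix x
      show "norm (w x * \<psi> x) \<le> norm (B * (indicator {-R..R} x *\<^sub>R w x))"
      proof (cases "x \<in> {-R..R}")
        case True
        with B[OF True] have "\<bar>w x\<bar> * \<bar>\<psi> x\<bar> \<le> \<bar>w x\<bar> * \<bar>B\<bar>" by (intro mult_left_mono) auto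
        with True show ?thesis by (simp add: abs_mult mult.commute)
      next
        case False
        then have "\<psi> x = 0" by (intro R) auto
        then show ?thesis by simp
      qed
    qed
  qed simp
qed

text \<open>Bumps converge boundedly to indicators of intervals, so dominated convergence carries the
hypothesis over to those indicators.\<close>

lemma AE_eq_0_if_test_integrals_0:
  assumes w: "locally_integrable w"
    and 0: "\<And>\<theta>. test_function \<theta> \<Longrightarrow> (LINT x|lborel. w x * \<theta> x) = 0"
  shows "AE x in lborel. w x = 0"
proof (rule AE_eq_0_if_interval_integrals_0)
  show wI: "set_integrable lborel {a..b} w" for a b by (rule locally_integrable_Icc[OF w])
  have [measurable]: "w \<in> borel_measurable borel"
    by (rule borel_measurable_if_integrable_Icc[OF wI])
  fix a b :: real assume "a < b"
  have bm [measurable]: "bump (real (Suc n)) a b \<in> borel_measurable borel" for n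
    by (intro borel_measurable_continuous_onI continuous_at_imp_continuous_on ballI smooth_isCont
        test_function_smooth test_function_bump) simp
  have "(\<lambda>n. LINT x|lborel. w x * bump (real (Suc n)) a b x) \<longlonglongrightarrow> (LINT x|lborel. w x * indicator {a<..<b} x)"
  proof (rule integral_dominated_convergence)
    show "integrable lborel (\<lambda>x. indicator {a..b} x *\<^sub>R \<bar>w x\<bar>)"
      using set_integrable_abs[OF wI] by (simp add: set_integrable_def)
    show "AE x in lborel. (\<lambda>n. w x * bump (real (Suc n)) a b x) \<longlonglongrightarrow> w x * indicator {a<..<b} x"
      by (intro AE_I2 tendsto_intros bump_tendsto)
    show "AE x in lborel. norm (w x * bump (real (Suc n)) a b x) \<le> indicator {a..b} x *\<^sub>R \<bar>w x\<bar>" for n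
      using bump_nonneg[of "real (Suc n)" a b] bump_le[of "real (Suc n)" a b]
      by (intro AE_I2) (auto simp: abs_mult mult.commute intro!: mult_left_mono)
  qed (use bm in \<open>auto intro!: borel_measurable_times\<close>)
  then have "(LINT x|lborel. w x * indicator {a<..<b} x) = 0"
    using 0[OF test_function_bump] by (auto simp: LIMSEQ_const_iff)
  then show "(LBINT x:{a<..<b}. w x) = 0"
    by (simp add: set_lebesgue_integral_def mult.commute)
qed

text \<open>Absolute continuity in integral form: \<open>U\<close> is an indefinite Lebesgue integral of \<open>g\<close>. This is what a
weak derivative provides, and it makes no claim about pointwise differentiability.\<close>

definition antideriv :: "(real \<Rightarrow> real) \<Rightarrow> (real \<Rightarrow> real) \<Rightarrow> bool" where
  "antideriv U g \<longleftrightarrow> (\<forall>a b. a \<le> b \<longrightarrow> set_integrable lborel {a..b} g \<and> (LBINT x:{a..b}. g x) = U b - U a)"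

lemma antideriv_integrable: "antideriv U g \<Longrightarrow> set_integrable lborel {a..b} g"
  by (cases "a \<le> b") (auto simp: antideriv_def set_integrable_def)

lemma antideriv_integral: "antideriv U g \<Longrightarrow> a \<le> b \<Longrightarrow> (LBINT x:{a..b}. g x) = U b - U a"
  by (auto simp: antideriv_def)

lemma antideriv_measurable: "antideriv U g \<Longrightarrow> g \<in> borel_measurable borel"
  by (rule borel_measurable_if_integrable_Icc[OF antideriv_integrable])

lemma antideriv_DERIV:
  assumes D: "\<And>x. DERIV U x :> g x" and c: "\<And>x. isCont g x"
  shows "antideriv U g"
  unfolding antideriv_def
proof (intro allI impI conjI)
  fix a b :: real assume ab: "a \<le> b"
  have cont: "continuous_on {a..b} g" using c by (simp add: continuous_at_imp_continuous_on)
  show "set_integrable lborel {a..b} g"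
    by (rule borel_integrable_atLeastAtMost'[OF cont])
  show "(LBINT x:{a..b}. g x) = U b - U a"
    unfolding set_lebesgue_integral_def using D
    by (intro integral_FTC_atLeastAtMost[OF ab _ cont])
       (simp add: has_real_derivative_iff_has_vector_derivative has_vector_derivative_at_within)
qed

lemma integral_Icc_eq:
  fixes F :: "real \<Rightarrow> real"
  assumes "\<And>x. \<bar>x\<bar> \<ge> R \<Longrightarrow> F x = 0"
  shows "(LBINT x:{-R..R}. F x) = (LINT x|lborel. F x)"
  unfolding set_lebesgue_integral_def
proof (rule Bochner_Integration.integral_cong[OF refl])
  fix x show "indicator {-R..R} x *\<^sub>R F x = F x"
  proof (cases "x \<in> {-R..R}")
    case False
    then have "F x = 0" by (intro assms) auto
    then show ?thesis by simp
  qed simp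
qed

text \<open>The du Bois-Reymond lemma. A test function has a test function as antiderivative exactly when its
integral vanishes, and every test function \<open>\<theta>\<close> becomes of this kind after subtracting a multiple of
one fixed bump \<open>\<eta>\<close>. That multiple accounts for the constant \<open>c\<close>.\<close>

lemma AE_const_if_test_deriv_integrals_0:
  assumes w: "locally_integrable w"
    and 0: "\<And>\<psi>. test_function \<psi> \<Longrightarrow> (LINT x|lborel. w x * deriv \<psi> x) = 0"
  shows "\<exists>c. AE x in lborel. w x = c"
proof -
  define \<eta> where "\<eta> = bump 1 0 1"
  have \<eta>: "test_function \<eta>" by (simp add: \<eta>_def test_function_bump)
  have const: "locally_integrable (\<lambda>x. c)" for c
    unfolding locally_integrable_def set_integrable_def
    by (intro allI impI borel_integrable_compact) auto
  have int: "integrable lborel (\<lambda>x. v x * \<theta> x)" if \<theta>: "test_function \<theta>" and v: "locally_integrable v" for v \<theta>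
  proof -
    obtain R where "\<And>x. \<bar>x\<bar> \<ge> R \<Longrightarrow> \<theta> x = 0" using test_function_support[OF \<theta>] by blast
    then show ?thesis by (rule integrable_mult_test_function[OF v test_function_smooth[OF \<theta>]])
  qed
  have int1: "integrable lborel \<theta>" if "test_function \<theta>" for \<theta>
    using int[OF that const[of 1]] by simp
  define J where "J = (LINT x|lborel. \<eta> x)"
  have "J > 0"
  proof -
    have "J \<noteq> 0"
    proof
      assume "J = 0"
      then have "AE x in lborel. \<eta> x = 0"
        unfolding J_def using integral_nonneg_eq_0_iff_AE[OF int1[OF \<eta>]] bump_nonneg[of 1 0 1] by (auto simp: \<eta>_def)
      then have "AE x in lborel. x \<notin> {0<..<1::real}"
        by (rule AE_mp) (auto intro!: AE_I2 simp: \<eta>_def bump_eq)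
      then have "emeasure lborel {0<..<1::real} = 0"
        by (subst (asm) AE_iff_null_sets[symmetric]) auto
      then show False by simp
    qed
    moreover have "J \<ge> 0" unfolding J_def \<eta>_def by (rule Bochner_Integration.integral_nonneg) (simp add: bump_nonneg)
    ultimately show ?thesis by simp
  qed
  define c where "c = (LINT x|lborel. w x * \<eta> x) / J"
  have wc: "locally_integrable (\<lambda>x. w x - c)"
    using w const[of c] by (auto simp: locally_integrable_def intro!: set_integral_diff)
  have "(LINT x|lborel. (w x - c) * \<theta> x) = 0" if \<theta>: "test_function \<theta>" for \<theta>
  proof -
    define K where "K = (LINT x|lborel. \<theta> x)"
    \<comment> \<open>the coefficient makes the integral of \<open>\<kappa>\<close> vanish, so that its antiderivative has compact support\<close>
    define \<kappa> where "\<kappa> = (\<lambda>x. \<theta> x + (- K / J) * \<eta> x)"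
    have sm: "smooth \<kappa>"
      using test_function_smooth[OF \<theta>] test_function_smooth[OF \<eta>] unfolding \<kappa>_def smooth_def
      by (intro allI differentiable_upto_add differentiable_upto_mult differentiable_upto_const) auto
    have cont: "isCont \<kappa> x" for x using smooth_isCont[OF sm] .
    obtain R where R: "R > 0" "\<And>x. \<bar>x\<bar> \<ge> R \<Longrightarrow> \<kappa> x = 0"
    proof -
      obtain R1 where "R1 > 0" "\<And>x. \<bar>x\<bar> \<ge> R1 \<Longrightarrow> \<theta> x = 0" using test_function_support[OF \<theta>] by blast
      moreover obtain R2 where "R2 > 0" "\<And>x. \<bar>x\<bar> \<ge> R2 \<Longrightarrow> \<eta> x = 0" using test_function_support[OF \<eta>] by blast
      ultimately show thesis by (intro that[of "max R1 R2"]) (auto simp: \<kappa>_def)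
    qed
    have tot: "(LINT x|lborel. \<kappa> x) = 0"
      unfolding \<kappa>_def using int1[OF \<theta>] int1[OF \<eta>] \<open>J > 0\<close> by (simp add: K_def J_def)
    obtain G where G: "\<And>x. DERIV G x :> \<kappa> x"
      using einterval_antiderivative[of "-\<infinity>" "\<infinity>" \<kappa>] cont
      by (auto simp: has_real_derivative_iff_has_vector_derivative)
    define \<psi> where "\<psi> = (\<lambda>x. G x - G (- R))"
    have D: "DERIV \<psi> x :> \<kappa> x" for x unfolding \<psi>_def by (auto intro!: derivative_eq_intros G)
    have d\<psi>: "deriv \<psi> = \<kappa>" using D by (intro ext DERIV_imp_deriv)
    have smp: "smooth \<psi>"
      unfolding smooth_def
    proof
      fix k show "differentiable_upto k \<psi>"
        by (cases k) (use D d\<psi> sm in \<open>auto simp: smooth_def real_differentiable_def\<close>)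
    qed
    have flat: "\<psi> x = \<psi> y" if "x \<le> y" and zero: "\<And>z. x \<le> z \<Longrightarrow> z \<le> y \<Longrightarrow> \<kappa> z = 0" for x y
    proof (cases "x = y")
      case False
      have "\<psi> y = \<psi> x"
      proof (rule DERIV_isconst_end[where f=\<psi> and a=x and b=y])
        show "x < y" using False that(1) by simp
        show "continuous_on {x..y} \<psi>"
          using D by (intro continuous_at_imp_continuous_on ballI DERIV_isCont)
        show "DERIV \<psi> z :> 0" if "x < z" "z < y" for z
          using D[of z] zero[of z] that by simp
      qed
      then show ?thesis by simp
    qed simp
    have "\<psi> R - \<psi> (- R) = (LBINT x:{-R..R}. \<kappa> x)"
      by (rule antideriv_integral[symmetric, OF antideriv_DERIV[OF D cont]]) (use R(1) in simp)
    also have "\<dots> = (LINT x|lborel. \<kappa> x)"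
      by (rule integral_Icc_eq[OF R(2)])
    finally have R0: "\<psi> R = 0" "\<psi> (- R) = 0" by (simp_all add: tot \<psi>_def)
    have "test_function \<psi>"
    proof (rule test_functionI[of _ "-R" R, OF smp], rule ccontr)
      fix x assume "\<psi> x \<noteq> 0" "\<not> (- R \<le> x \<and> x \<le> R)"
      then consider "x < - R" | "x > R" by linarith
      then show False
      proof cases
        case 1
        then have "\<psi> x = \<psi> (- R)" by (intro flat R(2)) auto
        then show ?thesis using R0 \<open>\<psi> x \<noteq> 0\<close> by simp
      next
        case 2
        then have "\<psi> R = \<psi> x" using R(1) by (intro flat R(2)) auto
        then show ?thesis using R0 \<open>\<psi> x \<noteq> 0\<close> by simp
      qed
    qed
    from 0[OF this] have "0 = (LINT x|lborel. w x * \<theta> x + (- K / J) * (w x * \<eta> x))"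
      by (simp add: d\<psi> \<kappa>_def algebra_simps)
    also have "\<dots> = (LINT x|lborel. w x * \<theta> x) + (- K / J) * (LINT x|lborel. w x * \<eta> x)"
      using int[OF \<theta> w] int[OF \<eta> w] by simp
    also have "\<dots> = (LINT x|lborel. w x * \<theta> x) - c * (LINT x|lborel. \<theta> x)"
      by (simp add: K_def c_def)
    also have "\<dots> = (LINT x|lborel. w x * \<theta> x - c * \<theta> x)"
      using int[OF \<theta> w] int1[OF \<theta>] by simp
    finally show ?thesis by (simp add: left_diff_distrib)
  qed
  from AE_eq_0_if_test_integrals_0[OF wc this] show ?thesis by (intro exI[of _ c]) simp
qed

lemma antideriv_exists:
  assumes "\<And>a b. set_integrable lborel {a..b} g"
  shows "\<exists>U. antideriv U g"
proof -
  define U where "U x = (if x \<ge> 0 then LBINT t:{0..x}. g t else - (LBINT t:{x..0}. g t))" for x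
  have split: "(LBINT t:{a..c}. g t) = (LBINT t:{a..b}. g t) + (LBINT t:{b..c}. g t)" if "a \<le> b" "b \<le> c" for a b c
  proof -
    have "(LBINT t:{a..b} \<union> {b..c}. g t) = (LBINT t:{a..b}. g t) + (LBINT t:{b..c}. g t)"
    proof (rule set_integral_Un_AE)
      have "AE t in lborel. t \<noteq> b" by (rule AE_lborel_singleton)
      then show "AE t in lborel. \<not> (t \<in> {a..b} \<and> t \<in> {b..c})" by eventually_elim auto
    qed (use assms in auto)
    moreover have "{a..b} \<union> {b..c} = {a..c}" using that by auto
    ultimately show ?thesis by simp
  qed
  have "antideriv U g"
    unfolding antideriv_def
  proof (intro allI impI conjI assms)
    fix a b :: real assume ab: "a \<le> b"
    consider "0 \<le> a" | "a < 0" "0 \<le> b" | "b < 0" by linarith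
    then show "(LBINT x:{a..b}. g x) = U b - U a"
    proof cases
      case 1 with split[of 0 a b] ab show ?thesis by (simp add: U_def)
    next
      case 2 with split[of a 0 b] show ?thesis by (simp add: U_def)
    next
      case 3 with split[of a b 0] ab show ?thesis by (simp add: U_def)
    qed
  qed
  then show ?thesis by blast
qed

lemma antideriv_const: "antideriv (\<lambda>x. c) (\<lambda>x. 0)"
  by (auto simp: antideriv_def set_integrable_def)

lemma antideriv_add:
  assumes "antideriv U g" "antideriv V h"
  shows "antideriv (\<lambda>x. U x + V x) (\<lambda>x. g x + h x)"
  unfolding antideriv_def
proof (intro allI impI conjI)
  fix a b :: real assume "a \<le> b"
  note I = assms[THEN antideriv_integrable, of a b] and E = assms[THEN antideriv_integral, OF \<open>a \<le> b\<close>]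
  show "set_integrable lborel {a..b} (\<lambda>x. g x + h x)" by (rule set_integral_add(1)[OF I])
  show "(LBINT x:{a..b}. g x + h x) = U b + V b - (U a + V a)"
    by (simp add: set_integral_add(2)[OF I] E)
qed

lemma antideriv_cmult:
  assumes "antideriv U g"
  shows "antideriv (\<lambda>x. c * U x) (\<lambda>x. c * g x)"
  using assms by (simp add: antideriv_def right_diff_distrib)

lemma antideriv_diff:
  "antideriv U g \<Longrightarrow> antideriv V h \<Longrightarrow> antideriv (\<lambda>x. U x - V x) (\<lambda>x. g x - h x)"
  using antideriv_add[OF _ antideriv_cmult, of U g V h "-1"] by simp

lemma antideriv_isCont:
  assumes "antideriv U g"
  shows "isCont U x"
proof -
  have "continuous_on {x-1..x+1} (\<lambda>y. U y - U (x - 1))"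
  proof -
    have I: "set_integrable lebesgue {x-1..x+1} g"
      using antideriv_integrable[OF assms, of "x-1" "x+1"]
      unfolding set_integrable_def by (subst integrable_completion) (auto dest: borel_measurable_integrable)
    then have "g integrable_on {x-1..x+1}" by (rule set_lebesgue_integral_eq_integral)
    then have "continuous_on {x-1..x+1} (\<lambda>y. integral {x-1..y} g)"
      by (rule indefinite_integral_continuous_1)
    moreover have "integral {x-1..y} g = U y - U (x-1)" if "y \<in> {x-1..x+1}" for y
      using set_borel_integral_eq_integral(2)[OF antideriv_integrable[OF assms, of "x-1" y]]
        antideriv_integral[OF assms, of "x-1" y] that by simp
    ultimately show ?thesis by (rule continuous_on_eq)
  qed
  then have "continuous_on {x-1..x+1} (\<lambda>y. (U y - U (x - 1)) + U (x - 1))"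
    by (rule continuous_on_add) simp
  then have "continuous_on {x-1..x+1} U" by simp
  then have "continuous_on {x-1<..<x+1} U"
    by (rule continuous_on_subset) auto
  then show ?thesis by (simp add: continuous_on_eq_continuous_at)
qed

text \<open>The Leibniz rule for absolutely continuous functions, by Fubini: the product of the increments of
\<open>U\<close> and \<open>V\<close> over \<open>[a, b]\<close> is the integral of \<open>g s * h t\<close> over the square, and the two triangles
\<open>s \<le> t\<close> and \<open>t < s\<close> contribute the two terms of the rule.\<close>

lemma antideriv_mult:
  assumes U: "antideriv U g" and V: "antideriv V h"
  shows "antideriv (\<lambda>x. U x * V x) (\<lambda>x. g x * V x + U x * h x)"
  unfolding antideriv_def
proof (intro allI impI)
  fix a b :: real assume ab: "a \<le> b"
  have [measurable]: "g \<in> borel_measurable borel" "h \<in> borel_measurable borel"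
    using antideriv_measurable U V by auto
  have contI: "continuous_on S U" "continuous_on S V" for S
    using antideriv_isCont[OF U] antideriv_isCont[OF V] by (auto intro: continuous_at_imp_continuous_on)
  have prodI: "set_integrable lborel {a..b} (\<lambda>x. k x * W x)"
    if k: "set_integrable lborel {a..b} k" and W: "continuous_on UNIV W" for k W :: "real \<Rightarrow> real"
  proof -
    have "bounded (W ` {a..b})"
      by (intro compact_imp_bounded compact_continuous_image continuous_on_subset[OF W]) auto
    then obtain B where B: "\<And>x. x \<in> {a..b} \<Longrightarrow> norm (W x) \<le> B" unfolding bounded_iff by blast
    have [measurable]: "W \<in> borel_measurable borel" by (rule borel_measurable_continuous_onI[OF W])
    have [measurable]: "(\<lambda>x. indicator {a..b} x *\<^sub>R k x) \<in> borel_measurable lborel"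
      using k unfolding set_integrable_def by (rule borel_measurable_integrable)
    have m: "(\<lambda>x. W x * (indicator {a..b} x *\<^sub>R k x)) \<in> borel_measurable lborel" by measurable
    show ?thesis unfolding set_integrable_def
    proof (rule Bochner_Integration.integrable_bound)
      show "integrable lborel (\<lambda>x. B * (indicator {a..b} x *\<^sub>R k x))"
        using k unfolding set_integrable_def by simp
      show "(\<lambda>x. indicator {a..b} x *\<^sub>R (k x * W x)) \<in> borel_measurable lborel"
        using m by (simp add: mult_ac)
      show "AE x in lborel. norm (indicator {a..b} x *\<^sub>R (k x * W x)) \<le> norm (B * (indicator {a..b} x *\<^sub>R k x))"
      proof (rule AE_I2)
        fix x
        show "norm (indicator {a..b} x *\<^sub>R (k x * W x)) \<le> norm (B * (indicator {a..b} x *\<^sub>R k x))"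
        proof (cases "x \<in> {a..b}")
          case True
          with B[OF True] have "\<bar>k x\<bar> * \<bar>W x\<bar> \<le> \<bar>k x\<bar> * \<bar>B\<bar>" by (intro mult_left_mono) auto
          with True show ?thesis by (simp add: abs_mult mult.commute)
        qed simp
      qed
    qed
  qed
  have gV: "set_integrable lborel {a..b} (\<lambda>x. g x * V x)"
    by (rule prodI[OF antideriv_integrable[OF U] contI(2)])
  have Uh: "set_integrable lborel {a..b} (\<lambda>x. U x * h x)"
    using prodI[OF antideriv_integrable[OF V] contI(1)] by (simp add: mult.commute)
  define G where "G = (\<lambda>x. indicator {a..b} x * g x)"
  define H where "H = (\<lambda>x. indicator {a..b} x * h x)"
  have iG: "integrable lborel G" and iH: "integrable lborel H"
    using antideriv_integrable[OF U, of a b] antideriv_integrable[OF V, of a b]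
    by (auto simp: G_def H_def set_integrable_def)
  have [measurable]: "G \<in> borel_measurable borel" "H \<in> borel_measurable borel"
    using iG iH by auto
  have GH: "integrable (lborel \<Otimes>\<^sub>M lborel) (\<lambda>(s, t). G s * H t)"
  proof (rule lborel_pair.Fubini_integrable)
    show "integrable lborel (\<lambda>x. LINT y|lborel. norm (case (x, y) of (s, t) \<Rightarrow> G s * H t))"
      using iG by (simp add: abs_mult)
    show "AE x in lborel. integrable lborel (\<lambda>y. case (x, y) of (s, t) \<Rightarrow> G s * H t)"
      using iH by simp
  qed simp
  have IG: "(LINT s|lborel. G s) = U b - U a" and IH: "(LINT s|lborel. H s) = V b - V a"
    using antideriv_integral[OF U ab] antideriv_integral[OF V ab]
    by (auto simp: G_def H_def set_lebesgue_integral_def)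
  \<comment> \<open>the inner integrals of the triangles are increments of \<open>U\<close> and \<open>V\<close>\<close>
  have half: "(LINT s|lborel. G s * indicator {s. s \<le> t} s) = U t - U a" if "t \<in> {a..b}" for t
  proof -
    have "(LINT s|lborel. G s * indicator {s. s \<le> t} s) = (LBINT s:{a..t}. g s)"
      unfolding set_lebesgue_integral_def using that
      by (intro Bochner_Integration.integral_cong) (auto simp: G_def indicator_def)
    then show ?thesis using antideriv_integral[OF U, of a t] that by simp
  qed
  have half2: "(LINT t|lborel. H t * indicator {t. t < s} t) = V s - V a" if "s \<in> {a..b}" for s
  proof -
    have "(LINT t|lborel. H t * indicator {t. t < s} t) = (LBINT t:{a..s}. h t)"
      unfolding set_lebesgue_integral_def
    proof (rule integral_cong_AE)
      have "AE t in lborel. t \<noteq> s" by (rule AE_lborel_singleton)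
      then show "AE t in lborel. H t * indicator {t. t < s} t = indicator {a..s} t *\<^sub>R h t"
        by eventually_elim (use that in \<open>auto simp: H_def indicator_def\<close>)
    qed measurable
    then show ?thesis using antideriv_integral[OF V, of a s] that by simp
  qed
  let ?D = "\<lambda>(s, t). G s * H t * indicator {(s, t). s \<le> t} (s, t)"
  let ?E = "\<lambda>(s, t). G s * H t * indicator {(s, t). t < s} (s, t)"
  have "{p \<in> space (lborel \<Otimes>\<^sub>M lborel). fst p \<le> (snd p :: real)} \<in> sets (lborel \<Otimes>\<^sub>M lborel)"
       "{p \<in> space (lborel \<Otimes>\<^sub>M lborel). snd p < (fst p :: real)} \<in> sets (lborel \<Otimes>\<^sub>M lborel)"
    by measurable
  then have mD: "{(s::real, t). s \<le> t} \<in> sets (lborel \<Otimes>\<^sub>M lborel)"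
      "{(s::real, t). t < s} \<in> sets (lborel \<Otimes>\<^sub>M lborel)"
    by (simp_all add: space_pair_measure case_prod_beta')
  have iD: "integrable (lborel \<Otimes>\<^sub>M lborel) ?D" "integrable (lborel \<Otimes>\<^sub>M lborel) ?E"
    using integrable_mult_indicator[OF mD(1) GH] integrable_mult_indicator[OF mD(2) GH]
    by (simp_all add: case_prod_beta' mult.commute)
  have "(U b - U a) * (V b - V a) = (LINT s|lborel. LINT t|lborel. G s * H t)"
    using IG IH by simp
  also have "\<dots> = integral\<^sup>L (lborel \<Otimes>\<^sub>M lborel) (\<lambda>(s, t). G s * H t)"
    using lborel_pair.integral_fst'[OF GH] by simp
  also have "\<dots> = integral\<^sup>L (lborel \<Otimes>\<^sub>M lborel) (\<lambda>p. ?D p + ?E p)"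
    by (intro Bochner_Integration.integral_cong) (auto simp: indicator_def)
  also have "\<dots> = integral\<^sup>L (lborel \<Otimes>\<^sub>M lborel) ?D + integral\<^sup>L (lborel \<Otimes>\<^sub>M lborel) ?E"
    using iD by simp
  also have "integral\<^sup>L (lborel \<Otimes>\<^sub>M lborel) ?D = (LINT t|lborel. LINT s|lborel. ?D (s, t))"
    using lborel_pair.integral_snd[of "\<lambda>s t. ?D (s, t)"] iD(1) by simp
  also have "\<dots> = (LINT t|lborel. H t * (U t - U a))"
  proof (rule Bochner_Integration.integral_cong)
    fix t
    have "(LINT s|lborel. ?D (s, t)) = (LINT s|lborel. H t * (G s * indicator {s. s \<le> t} s))"
      by (intro Bochner_Integration.integral_cong) (auto simp: indicator_def)
    also have "\<dots> = H t * (LINT s|lborel. G s * indicator {s. s \<le> t} s)"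
      by (rule integral_mult_right_zero)
    finally have "(LINT s|lborel. ?D (s, t)) = H t * (LINT s|lborel. G s * indicator {s. s \<le> t} s)" .
    then show "(LINT s|lborel. ?D (s, t)) = H t * (U t - U a)"
      using half[of t] by (cases "t \<in> {a..b}") (auto simp: H_def)
  qed simp
  also have "integral\<^sup>L (lborel \<Otimes>\<^sub>M lborel) ?E = (LINT s|lborel. LINT t|lborel. ?E (s, t))"
    using lborel_pair.integral_fst'[OF iD(2)] by simp
  also have "\<dots> = (LINT s|lborel. G s * (V s - V a))"
  proof (rule Bochner_Integration.integral_cong)
    fix s
    have "(LINT t|lborel. ?E (s, t)) = (LINT t|lborel. G s * (H t * indicator {t. t < s} t))"
      by (intro Bochner_Integration.integral_cong) (auto simp: indicator_def)
    also have "\<dots> = G s * (LINT t|lborel. H t * indicator {t. t < s} t)"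
      by (rule integral_mult_right_zero)
    finally have "(LINT t|lborel. ?E (s, t)) = G s * (LINT t|lborel. H t * indicator {t. t < s} t)" .
    then show "(LINT t|lborel. ?E (s, t)) = G s * (V s - V a)"
      using half2[of s] by (cases "s \<in> {a..b}") (auto simp: G_def)
  qed simp
  also have "(LINT t|lborel. H t * (U t - U a)) = (LBINT t:{a..b}. U t * h t) - U a * (V b - V a)"
  proof -
    have "(LINT t|lborel. H t * (U t - U a)) = (LINT t|lborel. indicator {a..b} t *\<^sub>R (U t * h t) - U a * H t)"
      by (intro Bochner_Integration.integral_cong) (auto simp: H_def algebra_simps)
    also have "\<dots> = (LINT t|lborel. indicator {a..b} t *\<^sub>R (U t * h t)) - (LINT t|lborel. U a * H t)"
      using Uh iH unfolding set_integrable_def by (intro Bochner_Integration.integral_diff) auto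
    finally show ?thesis using IH by (simp add: set_lebesgue_integral_def)
  qed
  also have "(LINT t|lborel. G t * (V t - V a)) = (LBINT t:{a..b}. g t * V t) - V a * (U b - U a)"
  proof -
    have "(LINT t|lborel. G t * (V t - V a)) = (LINT t|lborel. indicator {a..b} t *\<^sub>R (g t * V t) - V a * G t)"
      by (intro Bochner_Integration.integral_cong) (auto simp: G_def algebra_simps)
    also have "\<dots> = (LINT t|lborel. indicator {a..b} t *\<^sub>R (g t * V t)) - (LINT t|lborel. V a * G t)"
      using gV iG unfolding set_integrable_def by (intro Bochner_Integration.integral_diff) auto
    finally show ?thesis using IG by (simp add: set_lebesgue_integral_def)
  qed
  finally have "(LBINT t:{a..b}. g t * V t) + (LBINT t:{a..b}. U t * h t) = U b * V b - U a * V a"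
    by (simp add: algebra_simps)
  then show "set_integrable lborel {a..b} (\<lambda>x. g x * V x + U x * h x) \<and>
      (LBINT x:{a..b}. g x * V x + U x * h x) = U b * V b - U a * V a"
    using gV Uh by auto
qed

lemma locally_integrableI: 
  assumes "\<And>a b. set_integrable lborel {a..b::real} w"
  shows "locally_integrable w"
  unfolding locally_integrable_def
proof (intro allI impI)
  fix K :: "real set" assume K: "compact K"
  then obtain a b where "K \<subseteq> {a..b}"
    using bounded_subset_cbox_symmetric[of K] compact_imp_bounded[OF K] by (metis box_real(2))
  then show "set_integrable lborel K w"
    by (rule set_integrable_subset[OF assms, rotated]) (use K in \<open>auto intro: borel_compact\<close>)
qed

lemma antideriv_locally_integrable: "antideriv U g \<Longrightarrow> locally_integrable g"
  by (intro locally_integrableI antideriv_integrable)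

lemma continuous_locally_integrable: "(\<And>x. isCont U x) \<Longrightarrow> locally_integrable U"
  by (intro locally_integrableI borel_integrable_atLeastAtMost' continuous_at_imp_continuous_on) auto

lemma deriv_eq_0_outside_support:
  fixes \<phi> :: "real \<Rightarrow> real"
  assumes R: "\<And>x. \<bar>x\<bar> \<ge> R \<Longrightarrow> \<phi> x = 0" and x: "\<bar>x\<bar> \<ge> R + 1"
  shows "deriv \<phi> x = 0"
proof -
  have "DERIV \<phi> x :> 0"
    by (rule has_field_derivative_transform_within_open[where f="\<lambda>x. 0" and S="- {-R..R}"])
       (use x R in auto)
  then show ?thesis by (rule DERIV_imp_deriv)
qed

lemma integrable_mult_deriv_test_function:
  assumes "locally_integrable w" "test_function \<phi>"
  shows "integrable lborel (\<lambda>x. w x * \<phi> x)" "integrable lborel (\<lambda>x. w x * deriv \<phi> x)"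
proof -
  obtain R where R: "R > 0" "\<And>x. \<bar>x\<bar> \<ge> R \<Longrightarrow> \<phi> x = 0" using test_function_support[OF assms(2)] by blast
  show "integrable lborel (\<lambda>x. w x * \<phi> x)"
    by (rule integrable_mult_test_function[OF assms(1) test_function_smooth[OF assms(2)] R(2)])
  show "integrable lborel (\<lambda>x. w x * deriv \<phi> x)"
    by (rule integrable_mult_test_function[OF assms(1) smooth_deriv[OF test_function_smooth[OF assms(2)]]
          deriv_eq_0_outside_support[OF R(2)]])
qed

lemma antideriv_imp_weak_deriv:
  assumes U: "antideriv U g"
  shows "has_weak_deriv U g"
  unfolding has_weak_deriv_def
proof (intro conjI allI impI)
  show lU: "locally_integrable U" by (intro continuous_locally_integrable antideriv_isCont[OF U])
  show lg: "locally_integrable g" by (rule antideriv_locally_integrable[OF U])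
  fix \<phi> assume t: "test_function \<phi>"
  obtain R where R: "R > 0" "\<And>x. \<bar>x\<bar> \<ge> R \<Longrightarrow> \<phi> x = 0" using test_function_support[OF t] by blast
  have dR1: "deriv \<phi> x = 0" if "\<bar>x\<bar> \<ge> R + 1" for x
    by (rule deriv_eq_0_outside_support[OF R(2) that])
  have R1: "\<phi> x = 0" if "\<bar>x\<bar> \<ge> R + 1" for x using R that by auto
  have A: "antideriv \<phi> (deriv \<phi>)"
    by (intro antideriv_DERIV test_function_DERIV[OF t] smooth_isCont smooth_deriv test_function_smooth[OF t])
  have i1: "integrable lborel (\<lambda>x. U x * deriv \<phi> x)" and i2: "integrable lborel (\<lambda>x. g x * \<phi> x)"
    by (rule integrable_mult_deriv_test_function[OF lU t], rule integrable_mult_deriv_test_function[OF lg t])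
  have "(LINT x|lborel. g x * \<phi> x) + (LINT x|lborel. U x * deriv \<phi> x) = (LINT x|lborel. g x * \<phi> x + U x * deriv \<phi> x)"
    using i1 i2 by simp
  also have "\<dots> = (LBINT x:{-(R+1)..R+1}. g x * \<phi> x + U x * deriv \<phi> x)"
    by (rule integral_Icc_eq[symmetric]) (simp add: dR1 R1)
  also have "\<dots> = U (R+1) * \<phi> (R+1) - U (-(R+1)) * \<phi> (-(R+1))"
    using R(1) by (intro antideriv_integral[OF antideriv_mult[OF U A]]) auto
  also have "\<dots> = 0" using R by simp
  finally show "(LINT x|lborel. U x * deriv \<phi> x) = - (LINT x|lborel. g x * \<phi> x)" by simp
qed

lemma has_weak_deriv_unique:
  assumes "has_weak_deriv u g" "has_weak_deriv u h"
  shows "AE x in lborel. g x = h x"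
proof -
  have l: "locally_integrable g" "locally_integrable h" using assms by (auto simp: has_weak_deriv_def)
  have "locally_integrable (\<lambda>x. g x - h x)"
    using l by (auto simp: locally_integrable_def)
  then have "AE x in lborel. g x - h x = 0"
  proof (rule AE_eq_0_if_test_integrals_0)
    fix \<theta> assume t: "test_function \<theta>"
    have "(LINT x|lborel. (g x - h x) * \<theta> x) = (LINT x|lborel. g x * \<theta> x) - (LINT x|lborel. h x * \<theta> x)"
      using integrable_mult_deriv_test_function(1)[OF l(1) t] integrable_mult_deriv_test_function(1)[OF l(2) t]
      by (simp add: left_diff_distrib)
    then show "(LINT x|lborel. (g x - h x) * \<theta> x) = 0"
      using assms t by (auto simp: has_weak_deriv_def)
  qed
  then show ?thesis by simp
qed

lemma has_weak_deriv_cong_AE: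
  assumes "has_weak_deriv u g" "AE x in lborel. u x = v x" "locally_integrable v"
  shows "has_weak_deriv v g"
  unfolding has_weak_deriv_def
proof (intro conjI allI impI)
  show "locally_integrable v" "locally_integrable g" using assms by (auto simp: has_weak_deriv_def)
  fix \<phi> assume t: "test_function \<phi>"
  have "(LINT x|lborel. v x * deriv \<phi> x) = (LINT x|lborel. u x * deriv \<phi> x)"
    using assms integrable_mult_deriv_test_function(2)[OF _ t]
    by (intro integral_cong_AE) (auto simp: has_weak_deriv_def)
  then show "(LINT x|lborel. v x * deriv \<phi> x) = - (LINT x|lborel. g x * \<phi> x)"
    using assms(1) t by (simp add: has_weak_deriv_def)
qed

lemma weak_deriv_AE_eq:
  assumes "has_weak_deriv u g"
  shows "AE x in lborel. weak_deriv u x = g x"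
proof (rule has_weak_deriv_unique[OF _ assms])
  show "has_weak_deriv u (weak_deriv u)" unfolding weak_deriv_def by (rule someI[of "has_weak_deriv u", OF assms])
qed

text \<open>An indefinite integral of the weak derivative has the same weak derivative, so the two functions
differ by a constant by the du Bois-Reymond lemma.\<close>

lemma has_weak_deriv_representative:
  assumes u: "has_weak_deriv u g"
  shows "\<exists>U. antideriv U g \<and> (AE x in lborel. u x = U x)"
proof -
  have l: "locally_integrable g" "locally_integrable u" using u by (auto simp: has_weak_deriv_def)
  obtain V where V: "antideriv V g" using antideriv_exists[OF locally_integrable_Icc[OF l(1)]] by blast
  have wV: "has_weak_deriv V g" by (rule antideriv_imp_weak_deriv[OF V])
  then have lV: "locally_integrable V" by (simp add: has_weak_deriv_def)
  have "locally_integrable (\<lambda>x. u x - V x)"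
    using l lV by (auto simp: locally_integrable_def)
  then have "\<exists>c. AE x in lborel. u x - V x = c"
  proof (rule AE_const_if_test_deriv_integrals_0)
    fix \<psi> assume t: "test_function \<psi>"
    have "(LINT x|lborel. (u x - V x) * deriv \<psi> x) = (LINT x|lborel. u x * deriv \<psi> x) - (LINT x|lborel. V x * deriv \<psi> x)"
      using integrable_mult_deriv_test_function(2)[OF l(2) t] integrable_mult_deriv_test_function(2)[OF lV t]
      by (simp add: left_diff_distrib)
    then show "(LINT x|lborel. (u x - V x) * deriv \<psi> x) = 0"
      using u wV t by (auto simp: has_weak_deriv_def)
  qed
  then obtain c where "AE x in lborel. u x - V x = c" by blast
  then have "AE x in lborel. u x = V x + c" by eventually_elim simp
  moreover have "antideriv (\<lambda>x. V x + c) g" using antideriv_add[OF V antideriv_const[of c]] by simp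
  ultimately show ?thesis by blast
qed

section \<open>The Gaussian density\<close>

abbreviation \<phi> :: "real \<Rightarrow> real" where "\<phi> \<equiv> std_normal_density"

lemma phi_pos: "0 < \<phi> x"
  by (rule normal_density_pos) simp

lemma DERIV_phi: "DERIV \<phi> x :> - x * \<phi> x"
proof -
  have "DERIV (\<lambda>x. 1 / sqrt (2 * pi) * exp (- x\<^sup>2 / 2)) x :> 1 / sqrt (2 * pi) * (exp (- x\<^sup>2 / 2) * (- x))"
    by (rule DERIV_cmult) (auto intro!: derivative_eq_intros)
  then show ?thesis by (simp add: std_normal_density_def[abs_def] mult_ac)
qed

lemma DERIV_phi_compose [derivative_intros]:
  "DERIV g x :> g' \<Longrightarrow> DERIV (\<lambda>x. \<phi> (g x)) x :> - g x * \<phi> (g x) * g'"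
  using DERIV_chain2[OF DERIV_phi] .

lemma isCont_phi: "isCont \<phi> x"
  using DERIV_phi by (rule DERIV_isCont)

lemma phi_le_iff: "\<phi> x \<le> \<phi> y \<longleftrightarrow> \<bar>y\<bar> \<le> \<bar>x\<bar>"
  by (simp add: std_normal_density_def abs_le_square_iff divide_le_cancel)

lemma phi_minus [simp]: "\<phi> (- x) = \<phi> x"
  by (simp add: std_normal_density_def)

lemma phi_le_exp: "\<phi> x \<le> exp (- x\<^sup>2 / 2)"
proof -
  have "sqrt (2 * pi) \<ge> sqrt 1" using pi_gt3 by (intro real_sqrt_le_mono) simp
  then have "1 / sqrt (2 * pi) \<le> 1" by simp
  then have "1 / sqrt (2 * pi) * exp (- x\<^sup>2 / 2) \<le> 1 * exp (- x\<^sup>2 / 2)" by (rule mult_right_mono) simp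
  then show ?thesis by (simp add: std_normal_density_def)
qed

lemma phi_le_1: "\<phi> x \<le> 1"
  by (rule order_trans[OF phi_le_exp]) simp

lemma phi_le_inverse:
  assumes "x > 0" shows "\<phi> x \<le> 1 / x"
proof -
  have "x \<le> 1 + x\<^sup>2 / 2" using zero_le_power2[of "x - 1"] by (simp add: power2_eq_square algebra_simps)
  also have "\<dots> \<le> exp (x\<^sup>2 / 2)" by (rule exp_ge_add_one_self)
  finally have "exp (- (x\<^sup>2 / 2)) \<le> 1 / x"
    using assms by (simp add: exp_minus field_simps)
  then show ?thesis using phi_le_exp[of x] by simp
qed

lemma antideriv_imp_DERIV:
  assumes "antideriv U g" "\<And>x. isCont g x"
  shows "DERIV U x :> g x"
proof -
  obtain G where G: "\<And>x. DERIV G x :> g x"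
    using einterval_antiderivative[of "-\<infinity>" "\<infinity>" g] assms(2)
    by (auto simp: has_real_derivative_iff_has_vector_derivative)
  have AG: "antideriv G g" by (rule antideriv_DERIV[OF G assms(2)])
  have "U y - U 0 = G y - G 0" for y
  proof (cases "0 \<le> y")
    case True
    then show ?thesis using antideriv_integral[OF assms(1) True] antideriv_integral[OF AG True] by simp
  next
    case False
    then have "y \<le> 0" by simp
    then show ?thesis using antideriv_integral[OF assms(1), of y 0] antideriv_integral[OF AG, of y 0] by simp
  qed
  then have "U = (\<lambda>y. G y + (U 0 - G 0))" by (auto simp: fun_eq_iff algebra_simps)
  moreover have "DERIV (\<lambda>y. G y + (U 0 - G 0)) x :> g x" by (auto intro!: derivative_eq_intros G)
  ultimately show ?thesis by simp
qed

section \<open>Monotone transport to the Gaussian\<close>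

locale positive_density =
  fixes \<rho> :: "real \<Rightarrow> real"
  assumes pos: "0 < \<rho> x" and cont: "isCont \<rho> x"
    and integrable: "integrable lborel \<rho>" and total: "(LINT x|lborel. \<rho> x) = 1"
begin

definition F :: "real \<Rightarrow> real" where "F = cdf (density lborel (\<lambda>x. ennreal (\<rho> x)))"

lemma measurable_density [measurable]: "\<rho> \<in> borel_measurable borel"
  using integrable by auto

lemma real_distribution: "real_distribution (density lborel (\<lambda>x. ennreal (\<rho> x)))"
proof -
  have "(\<integral>\<^sup>+ x. ennreal (\<rho> x) \<partial>lborel) = 1"
    using nn_integral_eq_integral[OF integrable] pos total by (simp add: less_imp_le)
  then have "prob_space (density lborel (\<lambda>x. ennreal (\<rho> x)))"
    by (intro prob_spaceI) (simp add: emeasure_density)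
  then show ?thesis by (simp add: real_distribution_def real_distribution_axioms_def)
qed

interpretation real_distribution "density lborel (\<lambda>x. ennreal (\<rho> x))"
  by (rule real_distribution)

lemma antideriv_F: "antideriv F \<rho>"
  unfolding antideriv_def
proof (intro allI impI conjI)
  fix a b :: real assume ab: "a \<le> b"
  show I: "set_integrable lborel {a..b} \<rho>" for a b
    using integrable_mult_indicator[OF _ integrable, of "{a..b}"] by (simp add: set_integrable_def)
  show "(LBINT x:{a..b}. \<rho> x) = F b - F a"
  proof (cases "a = b")
    case True
    have "AE x in lborel. x \<noteq> a" by (rule AE_lborel_singleton)
    then have "AE x in lborel. indicator {a..b} x *\<^sub>R \<rho> x = 0" by eventually_elim (simp add: True)
    then have "(LBINT x:{a..b}. \<rho> x) = 0"
      unfolding set_lebesgue_integral_def by (rule integral_eq_zero_AE)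
    then show ?thesis by (simp add: True)
  next
    case False
    then have ab': "a < b" using ab by simp
    have "F b - F a = measure (density lborel (\<lambda>x. ennreal (\<rho> x))) {a<..b}"
      unfolding F_def by (rule cdf_diff_eq[OF ab'])
    also have "\<dots> = enn2real (\<integral>\<^sup>+x. ennreal (indicator {a<..b} x * \<rho> x) \<partial>lborel)"
      unfolding measure_def by (subst emeasure_density) (auto intro!: arg_cong[where f=enn2real] nn_integral_cong simp: indicator_def)
    also have "\<dots> = (LINT x|lborel. indicator {a<..b} x * \<rho> x)"
      using pos by (intro integral_eq_nn_integral[symmetric]) (auto simp: less_imp_le)
    also have "\<dots> = (LBINT x:{a..b}. \<rho> x)"
      unfolding set_lebesgue_integral_def
    proof (rule integral_cong_AE)
      have "AE x in lborel. x \<noteq> a" by (rule AE_lborel_singleton)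
      then show "AE x in lborel. indicator {a<..b} x * \<rho> x = indicator {a..b} x *\<^sub>R \<rho> x"
        by eventually_elim (auto simp: indicator_def)
    qed auto
    finally show ?thesis by simp
  qed
qed

lemma DERIV_F: "DERIV F x :> \<rho> x"
  by (rule antideriv_imp_DERIV[OF antideriv_F cont])

lemma isCont_F: "isCont F x"
  using DERIV_F by (rule DERIV_isCont)

lemma strict_mono_F: "x < y \<Longrightarrow> F x < F y"
  using DERIV_pos_imp_increasing[of x y F] DERIV_F pos by blast

lemma F_less_iff: "F x < F y \<longleftrightarrow> x < y"
  using strict_mono_F[of x y] strict_mono_F[of y x] by (cases x y rule: linorder_cases) auto

lemma inj_F: "inj F"
  using F_less_iff by (metis injI less_irrefl linorder_neqE_linordered_idom)

lemma F_range: "0 < F x" "F x < 1"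
proof -
  have "0 \<le> F (x - 1)" by (simp add: F_def cdf_nonneg)
  also have "\<dots> < F x" by (rule strict_mono_F) simp
  finally show "0 < F x" .
  have "F x < F (x + 1)" by (rule strict_mono_F) simp
  also have "\<dots> \<le> 1" by (simp add: F_def cdf_bounded_prob)
  finally show "F x < 1" .
qed

lemma F_surj:
  assumes "0 < p" "p < 1" shows "\<exists>x. F x = p"
proof -
  have "\<forall>\<^sub>F x in at_top. F x > p"
    using order_tendstoD(1)[OF cdf_lim_at_top_prob assms(2)] by (simp add: F_def)
  then obtain b where b: "F b > p" using eventually_happens'[OF trivial_limit_at_top_linorder] by blast
  have "\<forall>\<^sub>F x in at_bot. F x < p"
    using order_tendstoD(2)[OF cdf_lim_at_bot assms(1)] by (simp add: F_def)
  then obtain a where a: "F a < p" using eventually_happens'[OF trivial_limit_at_bot_linorder] by blast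
  have "a < b" using a b F_less_iff by (metis less_trans)
  then show ?thesis
    using IVT[of F a p b] a b isCont_F by auto
qed

end

interpretation std_normal: positive_density \<phi>
  by unfold_locales (simp_all add: phi_pos isCont_phi)

context positive_density
begin

text \<open>The increasing map that pushes the measure with density \<open>\<rho>\<close> forward to the standard Gaussian
measure: it matches the two distribution functions.\<close>

definition T :: "real \<Rightarrow> real" where "T x = inv std_normal.F (F x)"

lemma F_T: "std_normal.F (T x) = F x"
  using std_normal.F_surj[OF F_range] unfolding T_def by (metis f_inv_into_f rangeI)

lemma DERIV_T: "DERIV T x :> \<rho> x / \<phi> (T x)"
proof -
  have "isCont (inv std_normal.F) (std_normal.F (T x))"
    by (rule isCont_inverse_function[where d=1]) (simp_all add: std_normal.inj_F std_normal.isCont_F)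
  then have c: "isCont (inv std_normal.F) (F x)" by (simp add: F_T)
  have "DERIV (inv std_normal.F) (F x) :> inverse (\<phi> (T x))"
  proof (rule DERIV_inverse_function[of "std_normal.F" _ _ _ 0 1])
    show "DERIV std_normal.F (inv std_normal.F (F x)) :> \<phi> (T x)"
      using std_normal.DERIV_F[of "T x"] by (simp add: T_def)
    show "std_normal.F (inv std_normal.F y) = y" if "0 < y" "y < 1" for y
      using std_normal.F_surj[OF that] by (metis f_inv_into_f rangeI)
  qed (use phi_pos[of "T x"] F_range c in auto)
  from DERIV_chain2[OF this DERIV_F] show ?thesis
    unfolding T_def[abs_def] by (simp add: field_simps)
qed

lemma isCont_T: "isCont T x"
  using DERIV_T by (rule DERIV_isCont)

lemma T_less_iff: "T x < T y \<longleftrightarrow> x < y"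
  using std_normal.F_less_iff[of "T x" "T y"] by (simp add: F_T F_less_iff)

lemma T_le_iff: "T x \<le> T y \<longleftrightarrow> x \<le> y"
  using T_less_iff[of y x] by (simp add: not_less[symmetric])

lemma T_surj: "\<exists>x. T x = t"
proof -
  obtain x where "F x = std_normal.F t" using F_surj[OF std_normal.F_range] by blast
  then have "T x = t" using F_T[of x] std_normal.inj_F by (metis injD)
  then show ?thesis ..
qed

text \<open>By the chain rule, where \<open>T' = \<rho> / \<phi>(T)\<close> cancels the factor \<open>\<phi>(T)\<close>.\<close>

lemma DERIV_phi_T: "DERIV (\<lambda>x. \<phi> (T x)) x :> - T x * \<rho> x"
  using phi_pos[of "T x"] by (auto intro!: derivative_eq_intros DERIV_T)

text \<open>Boundary terms of the later integration by parts vanish along a sequence: \<open>T x * \<rho> x\<close> is minus the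
derivative of the bounded function \<open>\<phi> (T x)\<close>, so it cannot stay above a positive level near
infinity. The bound \<open>1 \<le> T x\<close> makes \<open>\<rho>\<close> itself small at the same points.\<close>

lemma boundary_small_right:
  assumes "\<eta> > 0"
  shows "\<exists>x\<ge>X. T x \<ge> 1 \<and> T x * \<rho> x \<le> \<eta>"
proof (rule ccontr)
  assume no: "\<not> ?thesis"
  obtain x1 where "T x1 = 1" using T_surj by blast
  define x0 where "x0 = max X x1"
  have T1: "T x \<ge> 1" if "x \<ge> x0" for x
    using that T_le_iff[of x1 x] \<open>T x1 = 1\<close> by (simp add: x0_def)
  have gt: "T x * \<rho> x > \<eta>" if "x \<ge> x0" for x
  proof (rule ccontr)
    assume "\<not> \<eta> < T x * \<rho> x"
    with T1[OF that] that have "x \<ge> X \<and> T x \<ge> 1 \<and> T x * \<rho> x \<le> \<eta>" by (simp add: x0_def)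
    with no show False by blast
  qed
  \<comment> \<open>over this distance \<open>\<phi> (T x)\<close> would drop by more than \<open>2\<close>, although it is between \<open>0\<close> and \<open>1\<close>\<close>
  define y where "y = x0 + 2 / \<eta>"
  have "x0 < y" using assms by (simp add: y_def)
  obtain z where z: "x0 < z" "z < y" and eq: "\<phi> (T y) - \<phi> (T x0) = (y - x0) * (- T z * \<rho> z)"
    using MVT2[OF \<open>x0 < y\<close>, of "\<lambda>x. \<phi> (T x)" "\<lambda>x. - T x * \<rho> x"] DERIV_phi_T by blast
  have "(y - x0) * (T z * \<rho> z) > (y - x0) * \<eta>"
    using gt[of z] z \<open>x0 < y\<close> by (intro mult_strict_left_mono) auto
  also have "(y - x0) * \<eta> = 2" using assms by (simp add: y_def)
  finally have "\<phi> (T y) < \<phi> (T x0) - 2" using eq by simp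
  then show False using phi_le_1[of "T x0"] phi_pos[of "T y"] by simp
qed

lemma boundary_small_left:
  assumes "\<eta> > 0"
  shows "\<exists>x\<le>X. T x \<le> -1 \<and> - T x * \<rho> x \<le> \<eta>"
proof (rule ccontr)
  assume no: "\<not> ?thesis"
  obtain x1 where "T x1 = -1" using T_surj by blast
  define x0 where "x0 = min X x1"
  have T1: "T x \<le> -1" if "x \<le> x0" for x
    using that T_le_iff[of x x1] \<open>T x1 = -1\<close> by (simp add: x0_def)
  have gt: "- T x * \<rho> x > \<eta>" if "x \<le> x0" for x
  proof (rule ccontr)
    assume "\<not> \<eta> < - T x * \<rho> x"
    with T1[OF that] that have "x \<le> X \<and> T x \<le> -1 \<and> - T x * \<rho> x \<le> \<eta>" by (simp add: x0_def)
    with no show False by blast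
  qed
  define y where "y = x0 - 2 / \<eta>"
  have "y < x0" using assms by (simp add: y_def)
  obtain z where z: "y < z" "z < x0" and eq: "\<phi> (T x0) - \<phi> (T y) = (x0 - y) * (- T z * \<rho> z)"
    using MVT2[OF \<open>y < x0\<close>, of "\<lambda>x. \<phi> (T x)" "\<lambda>x. - T x * \<rho> x"] DERIV_phi_T by blast
  have "(x0 - y) * (- T z * \<rho> z) > (x0 - y) * \<eta>"
    using gt[of z] z \<open>y < x0\<close> by (intro mult_strict_left_mono) auto
  also have "(x0 - y) * \<eta> = 2" using assms by (simp add: y_def)
  finally have "\<phi> (T x0) > 2 + \<phi> (T y)" using eq by simp
  then show False using phi_le_1[of "T x0"] phi_pos[of "T y"] by simp
qed

end

lemma integrable_indicator_mult:
  fixes g :: "real \<Rightarrow> real"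
  shows "integrable lborel g \<Longrightarrow> A \<in> sets borel \<Longrightarrow> integrable lborel (\<lambda>x. indicator A x * g x)"
  using integrable_mult_indicator[of A lborel g] by simp

text \<open>A two-sided version of the convergence of truncated integrals, with the endpoints free to be chosen
independently.\<close>

lemma integral_Icc_approx:
  fixes E :: "real \<Rightarrow> real"
  assumes E: "integrable lborel E" and "\<eta> > 0"
  shows "\<exists>K. \<forall>a\<le>-K. \<forall>b\<ge>K. \<bar>(LBINT x:{a..b}. E x) - (LINT x|lborel. E x)\<bar> \<le> \<eta>"
proof -
  have "((\<lambda>K. LINT x|lborel. indicator (- {-K..K}) x * \<bar>E x\<bar>) \<longlongrightarrow> (LINT x::real|lborel. 0)) at_top"
  proof (rule integral_dominated_convergence_at_top[where w="\<lambda>x. \<bar>E x\<bar>" and f="\<lambda>x. 0" and s="\<lambda>K x. indicator (- {-K..K}) x * \<bar>E x\<bar>"])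
    show "AE x in lborel. ((\<lambda>K. indicator (- {-K..K}) x * \<bar>E x\<bar>) \<longlongrightarrow> 0) at_top"
    proof (rule AE_I2, rule tendsto_eventually)
      fix x :: real
      have "\<forall>\<^sub>F K in at_top. K \<ge> \<bar>x\<bar>" by (rule eventually_ge_at_top)
      then show "\<forall>\<^sub>F K in at_top. indicator (- {-K..K}) x * \<bar>E x\<bar> = 0"
        by eventually_elim (auto simp: indicator_def)
    qed
    show "\<forall>\<^sub>F K in at_top. AE x in lborel. norm (indicator (- {-K..K}) x * \<bar>E x\<bar>) \<le> \<bar>E x\<bar>"
      by (intro always_eventually allI AE_I2) (auto simp: indicator_def)
  qed (use E in auto)
  then have "\<forall>\<^sub>F K in at_top. (LINT x|lborel. indicator (- {-K..K}) x * \<bar>E x\<bar>) < \<eta>"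
    using assms(2) by (auto intro: order_tendstoD)
  then obtain K where K: "(LINT x|lborel. indicator (- {-K..K}) x * \<bar>E x\<bar>) < \<eta>"
    using eventually_happens'[OF trivial_limit_at_top_linorder] by blast
  have "\<bar>(LBINT x:{a..b}. E x) - (LINT x|lborel. E x)\<bar> \<le> \<eta>" if "a \<le> -K" "b \<ge> K" for a b
  proof -
    note i = integrable_indicator_mult[OF E]
    have "(LBINT x:{a..b}. E x) - (LINT x|lborel. E x) = (LINT x|lborel. indicator {a..b} x * E x - E x)"
      using i[of "{a..b}"] E by (simp add: set_lebesgue_integral_def)
    also have "\<bar>\<dots>\<bar> \<le> (LINT x|lborel. \<bar>indicator {a..b} x * E x - E x\<bar>)"
      by (rule integral_abs_bound)
    also have "\<dots> \<le> (LINT x|lborel. indicator (- {-K..K}) x * \<bar>E x\<bar>)"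
    proof (rule integral_mono)
      show "integrable lborel (\<lambda>x. \<bar>indicator {a..b} x * E x - E x\<bar>)"
        using i[of "{a..b}"] E by simp
      show "integrable lborel (\<lambda>x. indicator (- {-K..K}) x * \<bar>E x\<bar>)"
        using integrable_mult_indicator[OF _ integrable_abs[OF E], of "- {-K..K}"] by simp
      show "\<bar>indicator {a..b} x * E x - E x\<bar> \<le> indicator (- {-K..K}) x * \<bar>E x\<bar>" for x
        using that by (auto simp: indicator_def)
    qed
    finally show ?thesis using K by simp
  qed
  then show ?thesis by blast
qed

lemma set_integrable_of_integrable:
  "integrable lborel E \<Longrightarrow> set_integrable lborel {a..b} (E :: real \<Rightarrow> real)"
  using integrable_mult_indicator[of "{a..b}" lborel E] by (simp add: set_integrable_def)

lemma set_integral_subset_mono: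
  fixes E :: "real \<Rightarrow> real"
  assumes "set_integrable lborel {x1..x2} E" "x1 \<le> y1" "y2 \<le> x2" "\<And>x. 0 \<le> E x"
  shows "(LBINT x:{y1..y2}. E x) \<le> (LBINT x:{x1..x2}. E x)"
proof -
  have "set_integrable lborel {y1..y2} E"
    by (rule set_integrable_subset[OF assms(1)]) (use assms in auto)
  then show ?thesis
    using assms unfolding set_lebesgue_integral_def set_integrable_def
    by (intro integral_mono) (auto simp: indicator_def)
qed

section \<open>The deficit controls a square\<close>

locale regular_gauss_density = 
  fixes f f' :: "real \<Rightarrow> real"
  assumes f_pos: "0 < f x" and f_antideriv: "antideriv f f'"
    and f_integrable: "integrable lborel (\<lambda>x. \<phi> x * f x)"
    and f_total: "(LINT x|lborel. \<phi> x * f x) = 1"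
    and entropy_integrable: "integrable lborel (\<lambda>x. \<phi> x * (f x * ln (f x)))"
    and fisher_integrable: "integrable lborel (\<lambda>x. \<phi> x * ((f' x)\<^sup>2 / f x))"

sublocale regular_gauss_density \<subseteq> positive_density "\<lambda>x. \<phi> x * f x"
  by unfold_locales
     (auto simp: f_pos phi_pos f_integrable f_total intro!: continuous_intros isCont_phi antideriv_isCont[OF f_antideriv])

context regular_gauss_density
begin

abbreviation \<rho> :: "real \<Rightarrow> real" where "\<rho> x \<equiv> \<phi> x * f x"

text \<open>The log-Sobolev deficit of \<open>f\<close>, with the integrals taken against Lebesgue measure.\<close>

definition \<delta> :: real where
  "\<delta> = (LINT x|lborel. \<phi> x * ((f' x)\<^sup>2 / f x)) / 2 - (LINT x|lborel. \<phi> x * (f x * ln (f x)))"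

text \<open>Vanishes identically when \<open>f = 1\<close>, since then \<open>T x = x\<close>; half its mean square with respect to \<open>\<rho>\<close> is
the square completed in the Fisher information, and is bounded by the deficit.\<close>

definition defect :: "real \<Rightarrow> real" where "defect x = f' x / f x + T x - x"

lemma isCont_f: "isCont f x"
  by (rule antideriv_isCont[OF f_antideriv])

lemma phi_ratio: "\<phi> s / \<phi> x = exp (x\<^sup>2 / 2 - s\<^sup>2 / 2)"
  by (simp add: std_normal_density_def exp_minus field_simps flip: exp_add)

lemma log_f: "ln (f x) = ln (\<rho> x / \<phi> (T x)) - (T x)\<^sup>2 / 2 + x\<^sup>2 / 2"
proof -
  have "f x = (\<rho> x / \<phi> (T x)) * (\<phi> (T x) / \<phi> x)"
    using phi_pos[of x] phi_pos[of "T x"] by simp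
  also have "\<phi> (T x) / \<phi> x = exp (x\<^sup>2 / 2 - (T x)\<^sup>2 / 2)"
    by (rule phi_ratio)
  finally have "ln (f x) = ln ((\<rho> x / \<phi> (T x)) * exp (x\<^sup>2 / 2 - (T x)\<^sup>2 / 2))" by simp
  also have "\<dots> = ln (\<rho> x / \<phi> (T x)) + ln (exp (x\<^sup>2 / 2 - (T x)\<^sup>2 / 2))"
    by (rule ln_mult_pos) (use phi_pos[of "T x"] pos[of x] in auto)
  finally show ?thesis by simp
qed

text \<open>The derivative of \<open>(T x - x) * \<rho> x\<close>, the quantity that is integrated by parts.\<close>

definition flux' :: "real \<Rightarrow> real" where
  "flux' x = ((\<rho> x / \<phi> (T x) - 1) * \<phi> x + (T x - x) * (- x * \<phi> x)) * f x + ((T x - x) * \<phi> x) * f' x"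

lemma antideriv_flux: "antideriv (\<lambda>x. ((T x - x) * \<phi> x) * f x) flux'"
  unfolding flux'_def[abs_def]
proof (rule antideriv_mult[OF antideriv_DERIV f_antideriv])
  fix x
  show "DERIV (\<lambda>x. (T x - x) * \<phi> x) x :> (\<rho> x / \<phi> (T x) - 1) * \<phi> x + (T x - x) * (- x * \<phi> x)"
    by (auto intro!: derivative_eq_intros DERIV_T DERIV_phi)
  show "isCont (\<lambda>x. (\<rho> x / \<phi> (T x) - 1) * \<phi> x + (T x - x) * (- x * \<phi> x)) x"
    using phi_pos[of "T x"]
    by (auto intro!: continuous_intros isCont_T isCont_phi isCont_f isCont_o2[OF isCont_T isCont_phi])
qed

lemma defect_square_rho:
  "(defect x)\<^sup>2 * \<rho> x / 2 = \<phi> x * ((f' x)\<^sup>2 / f x) / 2 + flux' x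
     + ((T x - x)\<^sup>2 * \<rho> x / 2 - ((\<rho> x / \<phi> (T x) - 1) * \<phi> x + (T x - x) * (- x * \<phi> x)) * f x)"
  using f_pos[of x] by (simp add: defect_def flux'_def power2_eq_square field_simps)

lemma defect_square_integrable: "set_integrable lborel {y1..y2} (\<lambda>x. (defect x)\<^sup>2 * \<rho> x / 2)"
proof -
  have 1: "set_integrable lborel {y1..y2} (\<lambda>x. \<phi> x * ((f' x)\<^sup>2 / f x) / 2)"
    using set_integrable_of_integrable[OF fisher_integrable] by (rule set_integrable_divide)
  have 2: "set_integrable lborel {y1..y2} flux'"
    by (rule antideriv_integrable[OF antideriv_flux])
  have 3: "set_integrable lborel {y1..y2} (\<lambda>x. (T x - x)\<^sup>2 * \<rho> x / 2 - ((\<rho> x / \<phi> (T x) - 1) * \<phi> x + (T x - x) * (- x * \<phi> x)) * f x)"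
  proof (rule borel_integrable_atLeastAtMost', intro continuous_at_imp_continuous_on ballI)
    fix x
    show "isCont (\<lambda>x. (T x - x)\<^sup>2 * \<rho> x / 2 - ((\<rho> x / \<phi> (T x) - 1) * \<phi> x + (T x - x) * (- x * \<phi> x)) * f x) x"
      using phi_pos[of "T x"]
      by (auto intro!: continuous_intros isCont_T isCont_phi isCont_f isCont_o2[OF isCont_T isCont_phi])
  qed
  show ?thesis unfolding defect_square_rho by (intro set_integral_add(1) 1 2 3)
qed

text \<open>The pointwise form of the log-Sobolev inequality with remainder. By the change of variables
formula \<open>ln f = ln T' - T\<^sup>2 / 2 + x\<^sup>2 / 2\<close>, and \<open>ln T' \<le> T' - 1\<close>; after this estimate the Fisher term, the
entropy term and the derivative of \<open>(T x - x) * \<rho> x\<close> add up to a complete square.\<close>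

lemma defect_square_le: "(defect x)\<^sup>2 * \<rho> x / 2 \<le> (\<phi> x * ((f' x)\<^sup>2 / f x) / 2 - \<phi> x * (f x * ln (f x))) + flux' x"
proof -
  define s t r where "s = T x" and "t = \<rho> x / \<phi> (T x)" and "r = \<rho> x"
  have "t > 0" unfolding t_def using pos[of x] phi_pos[of "T x"] by simp
  then have "ln t \<le> t - 1" by (rule ln_le_minus_one)
  then have "ln (f x) \<le> t - 1 - s\<^sup>2 / 2 + x\<^sup>2 / 2"
    using log_f[of x] unfolding t_def s_def by simp
  then have le: "r * ln (f x) \<le> r * (t - 1 - s\<^sup>2 / 2 + x\<^sup>2 / 2)"
    unfolding r_def by (rule mult_left_mono) (use pos[of x] in simp)
  have "((t - 1) * \<phi> x + (s - x) * (- x * \<phi> x)) * f x = r * (t - 1 - x * (s - x))"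
    by (simp add: r_def algebra_simps)
  moreover have "r * (t - 1 - s\<^sup>2 / 2 + x\<^sup>2 / 2) = r * (t - 1 - x * (s - x)) - (s - x)\<^sup>2 * r / 2"
    by (simp add: power2_eq_square algebra_simps diff_divide_distrib add_divide_distrib)
  moreover have "\<phi> x * (f x * ln (f x)) = r * ln (f x)" by (simp add: r_def)
  moreover have "(defect x)\<^sup>2 * \<rho> x / 2 = \<phi> x * ((f' x)\<^sup>2 / f x) / 2 + flux' x
     + ((s - x)\<^sup>2 * r / 2 - ((t - 1) * \<phi> x + (s - x) * (- x * \<phi> x)) * f x)"
    unfolding s_def t_def r_def by (rule defect_square_rho)
  ultimately show ?thesis using le by linarith
qed

text \<open>Integrate the pointwise inequality over a large interval and let its ends tend to infinity along
points where \<open>T x * \<rho> x\<close> is small. The other part of the boundary term, \<open>- x * \<rho> x\<close>, has the favourable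
sign at both ends.\<close>

lemma defect_square_integral_le: "(LBINT x:{y1..y2}. (defect x)\<^sup>2 * \<rho> x / 2) \<le> \<delta>"
proof (rule field_le_epsilon)
  fix e :: real assume "e > 0"
  define \<eta> where "\<eta> = e / 3"
  have "\<eta> > 0" using \<open>e > 0\<close> by (simp add: \<eta>_def)
  define E where "E x = \<phi> x * ((f' x)\<^sup>2 / f x) / 2 - \<phi> x * (f x * ln (f x))" for x
  have E: "integrable lborel E" unfolding E_def
    by (intro Bochner_Integration.integrable_diff entropy_integrable integrable_divide fisher_integrable)
  have E\<delta>: "(LINT x|lborel. E x) = \<delta>"
    unfolding E_def \<delta>_def integral_divide_zero[symmetric]
    by (intro Bochner_Integration.integral_diff entropy_integrable integrable_divide fisher_integrable)
  obtain K where K: "\<And>a b. a \<le> -K \<Longrightarrow> b \<ge> K \<Longrightarrow> \<bar>(LBINT x:{a..b}. E x) - \<delta>\<bar> \<le> \<eta>"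
    using integral_Icc_approx[OF E \<open>\<eta> > 0\<close>] E\<delta> by metis
  obtain x2 where x2: "x2 \<ge> max (max K y2) 0" "T x2 * \<rho> x2 \<le> \<eta>"
    using boundary_small_right[OF \<open>\<eta> > 0\<close>] by blast
  obtain x1 where x1: "x1 \<le> min (min (-K) y1) 0" "- T x1 * \<rho> x1 \<le> \<eta>"
    using boundary_small_left[OF \<open>\<eta> > 0\<close>] by blast
  have x12: "x1 \<le> x2" using x1 x2 by simp
  have "(LBINT x:{y1..y2}. (defect x)\<^sup>2 * \<rho> x / 2) \<le> (LBINT x:{x1..x2}. (defect x)\<^sup>2 * \<rho> x / 2)"
    by (rule set_integral_subset_mono[OF defect_square_integrable]) (use x1 x2 pos in \<open>auto simp: less_imp_le\<close>)
  also have "\<dots> \<le> (LBINT x:{x1..x2}. E x + flux' x)"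
  proof (rule set_integral_mono[OF defect_square_integrable])
    show "set_integrable lborel {x1..x2} (\<lambda>x. E x + flux' x)"
      by (intro set_integral_add(1) set_integrable_of_integrable[OF E] antideriv_integrable[OF antideriv_flux])
    show "(defect x)\<^sup>2 * \<rho> x / 2 \<le> E x + flux' x" for x unfolding E_def by (rule defect_square_le)
  qed
  also have "\<dots> = (LBINT x:{x1..x2}. E x) + (LBINT x:{x1..x2}. flux' x)"
    by (intro set_integral_add(2) set_integrable_of_integrable[OF E] antideriv_integrable[OF antideriv_flux])
  also have "(LBINT x:{x1..x2}. flux' x) = (T x2 - x2) * \<rho> x2 - (T x1 - x1) * \<rho> x1"
    using antideriv_integral[OF antideriv_flux x12] by (simp add: mult.assoc)
  also have "\<dots> \<le> \<eta> + \<eta>"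
  proof -
    have "x2 * \<rho> x2 \<ge> 0" using x2(1) by (intro mult_nonneg_nonneg) (simp_all add: less_imp_le[OF f_pos] less_imp_le[OF phi_pos])
    moreover have "x1 * \<rho> x1 \<le> 0" using x1(1) by (intro mult_nonpos_nonneg) (simp_all add: less_imp_le[OF f_pos] less_imp_le[OF phi_pos])
    ultimately show ?thesis using x1 x2 by (simp add: left_diff_distrib)
  qed
  also have "(LBINT x:{x1..x2}. E x) \<le> \<delta> + \<eta>"
    using K[of x1 x2] x1 x2 by simp
  finally show "(LBINT x:{y1..y2}. (defect x)\<^sup>2 * \<rho> x / 2) \<le> \<delta> + e"
    by (simp add: \<eta>_def)
qed

lemma deficit_nonneg: "0 \<le> \<delta>"
proof -
  have "0 \<le> (LBINT x:{0..0}. (defect x)\<^sup>2 * \<rho> x / 2)"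
    unfolding set_lebesgue_integral_def
    by (rule Bochner_Integration.integral_nonneg) (use pos in \<open>auto simp: less_imp_le\<close>)
  also have "\<dots> \<le> \<delta>" by (rule defect_square_integral_le)
  finally show ?thesis .
qed

text \<open>The key identity: \<open>\<rho>'\<close> equals \<open>(f' / f - x) * \<rho>\<close> and the derivative of \<open>\<phi>(T)\<close> equals \<open>- T * \<rho>\<close>, so their
difference is the defect times \<open>\<rho>\<close>. A bound on the mean absolute defect thus becomes a uniform bound on
\<open>\<rho> - \<phi>(T)\<close>.\<close>

lemma antideriv_profile_diff: "antideriv (\<lambda>x. \<rho> x - \<phi> (T x)) (\<lambda>x. defect x * \<rho> x)"
proof -
  have 1: "antideriv \<phi> (\<lambda>x. - x * \<phi> x)"
    by (intro antideriv_DERIV DERIV_phi) (auto intro!: continuous_intros isCont_phi)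
  have 2: "antideriv (\<lambda>x. \<phi> (T x)) (\<lambda>x. - T x * \<rho> x)"
    by (intro antideriv_DERIV DERIV_phi_T) (auto intro!: continuous_intros isCont_phi isCont_T isCont_f)
  have "(\<lambda>x. (- x * \<phi> x * f x + \<phi> x * f' x) - (- T x * \<rho> x)) = (\<lambda>x. defect x * \<rho> x)"
    using f_pos by (auto simp: defect_def fun_eq_iff field_simps less_imp_neq[symmetric])
  then show ?thesis
    using antideriv_diff[OF antideriv_mult[OF 1 f_antideriv] 2] by simp
qed

lemma rho_interval_le_1: "(LBINT x:{y1..y2}. \<rho> x) \<le> 1"
proof (cases "y1 \<le> y2")
  case True
  then show ?thesis using antideriv_integral[OF antideriv_F True] F_range[of y1] F_range[of y2] by simp
qed (simp add: set_lebesgue_integral_def)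

text \<open>The inequality of the arithmetic and geometric mean, weighted by \<open>\<epsilon>\<close>, bounds the integral of the
absolute defect by that of its square and the total mass \<open>1\<close>.\<close>

lemma profile_diff_oscillation:
  assumes "\<epsilon> > 0" "2 * \<delta> \<le> \<epsilon>\<^sup>2" and y: "y1 \<le> y2"
  shows "\<bar>(\<rho> y2 - \<phi> (T y2)) - (\<rho> y1 - \<phi> (T y1))\<bar> \<le> \<epsilon>"
proof -
  have ia: "set_integrable lborel {y1..y2} (\<lambda>x. defect x * \<rho> x)"
    by (rule antideriv_integrable[OF antideriv_profile_diff])
  have ir: "set_integrable lborel {y1..y2} (\<lambda>x. (\<epsilon> / 2) * \<rho> x)"
    using antideriv_integrable[OF antideriv_F] by (rule set_integrable_mult_right)
  have ia2: "set_integrable lborel {y1..y2} (\<lambda>x. (1 / \<epsilon>) * ((defect x)\<^sup>2 * \<rho> x / 2))"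
    using defect_square_integrable by (rule set_integrable_mult_right)
  have "\<bar>(\<rho> y2 - \<phi> (T y2)) - (\<rho> y1 - \<phi> (T y1))\<bar> = \<bar>LBINT x:{y1..y2}. defect x * \<rho> x\<bar>"
    using antideriv_integral[OF antideriv_profile_diff y] by simp
  also have "\<dots> \<le> (LBINT x:{y1..y2}. \<bar>defect x * \<rho> x\<bar>)"
    using set_integral_norm_bound[OF ia] by simp
  also have "\<dots> \<le> (LBINT x:{y1..y2}. (1 / \<epsilon>) * ((defect x)\<^sup>2 * \<rho> x / 2) + (\<epsilon> / 2) * \<rho> x)"
  proof (rule set_integral_mono)
    show "set_integrable lborel {y1..y2} (\<lambda>x. \<bar>defect x * \<rho> x\<bar>)"
      using ia by (rule set_integrable_abs)
    show "set_integrable lborel {y1..y2} (\<lambda>x. (1 / \<epsilon>) * ((defect x)\<^sup>2 * \<rho> x / 2) + (\<epsilon> / 2) * \<rho> x)"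
      by (intro set_integral_add(1) ir ia2)
    fix x
    have "2 * \<bar>defect x\<bar> * \<epsilon> \<le> (defect x)\<^sup>2 + \<epsilon>\<^sup>2"
      using sum_squares_bound[of "\<bar>defect x\<bar>" \<epsilon>] by simp
    then have "\<bar>defect x\<bar> \<le> (1 / \<epsilon>) * ((defect x)\<^sup>2 / 2) + \<epsilon> / 2"
      using assms(1) by (simp add: field_simps power2_eq_square)
    then have "\<bar>defect x\<bar> * \<rho> x \<le> ((1 / \<epsilon>) * ((defect x)\<^sup>2 / 2) + \<epsilon> / 2) * \<rho> x"
      by (rule mult_right_mono) (use pos[of x] in simp)
    then show "\<bar>defect x * \<rho> x\<bar> \<le> (1 / \<epsilon>) * ((defect x)\<^sup>2 * \<rho> x / 2) + (\<epsilon> / 2) * \<rho> x"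
      using f_pos[of x] phi_pos[of x] by (simp add: abs_mult algebra_simps)
  qed
  also have "\<dots> = (1 / \<epsilon>) * (LBINT x:{y1..y2}. (defect x)\<^sup>2 * \<rho> x / 2) + (\<epsilon> / 2) * (LBINT x:{y1..y2}. \<rho> x)"
    by (simp only: set_integral_add(2)[OF ia2 ir] set_integral_mult_right)
  also have "\<dots> \<le> (1 / \<epsilon>) * (\<epsilon>\<^sup>2 / 2) + (\<epsilon> / 2) * 1"
    using assms defect_square_integral_le[of y1 y2] rho_interval_le_1[of y1 y2]
    by (intro add_mono mult_left_mono) auto
  also have "\<dots> = \<epsilon>" using assms(1) by (simp add: power2_eq_square)
  finally show ?thesis .
qed

text \<open>Both \<open>\<rho>\<close> and \<open>\<phi>(T)\<close> are arbitrarily small at suitable points far to the right, so the bound on the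
oscillation is a bound on the difference.\<close>

lemma profile_diff_le:
  assumes "\<epsilon> > 0" "2 * \<delta> \<le> \<epsilon>\<^sup>2"
  shows "\<bar>\<rho> x - \<phi> (T x)\<bar> \<le> \<epsilon>"
proof (rule field_le_epsilon)
  fix \<eta> :: real assume \<eta>: "\<eta> > 0"
  \<comment> \<open>to the right of this point \<open>\<phi> (T x) \<le> 1 / T x \<le> \<eta>\<close>\<close>
  obtain x0 where x0: "T x0 = 1 / \<eta>" using T_surj by blast
  obtain y where y: "y \<ge> max x x0" "T y \<ge> 1" "T y * \<rho> y \<le> \<eta>"
    using boundary_small_right[OF \<eta>] by blast
  have "T y \<ge> 1 / \<eta>" using y x0 T_le_iff[of x0 y] by simp
  then have "1 / T y \<le> \<eta>" using \<eta> y(2) by (simp add: field_simps)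
  then have "\<phi> (T y) \<le> \<eta>" using phi_le_inverse[of "T y"] y(2) by simp
  moreover have "1 * \<rho> y \<le> T y * \<rho> y" by (rule mult_right_mono) (use y(2) pos[of y] in auto)
  ultimately have "\<bar>\<rho> y - \<phi> (T y)\<bar> \<le> \<eta>"
    using y(3) pos[of y] phi_pos[of "T y"] by (simp add: abs_le_iff)
  then show "\<bar>\<rho> x - \<phi> (T x)\<bar> \<le> \<epsilon> + \<eta>"
    using profile_diff_oscillation[OF assms, of x y] y(1) by (simp add: abs_le_iff)
qed

end

section \<open>From the deficit to the L1 distance\<close>

text \<open>The sum of the Gaussian distribution function and its density has derivative \<open>(1 - t) * \<phi> t\<close>, which
is nonpositive for \<open>t \<ge> 1\<close>, and tends to \<open>1\<close>.\<close>

lemma std_normal_upper_tail: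
  assumes "R \<ge> 1" shows "1 - std_normal.F R \<le> \<phi> R"
proof (rule ccontr)
  assume "\<not> ?thesis"
  then have lt: "std_normal.F R + \<phi> R < 1" by simp
  define p where "p = (std_normal.F R + \<phi> R + 1) / 2"
  have p: "std_normal.F R + \<phi> R < p" "0 < p" "p < 1"
    using lt std_normal.F_range[of R] phi_pos[of R] by (auto simp: p_def)
  then obtain y where y: "std_normal.F y = p" using std_normal.F_surj by blast
  have "R < y" using p(1) y phi_pos[of R] std_normal.F_less_iff[of R y] by simp
  then have "std_normal.F y + \<phi> y \<le> std_normal.F R + \<phi> R"
  proof (intro DERIV_nonpos_imp_nonincreasing[where f="\<lambda>t. std_normal.F t + \<phi> t"] exI conjI)
    fix t assume "R \<le> t"
    show "DERIV (\<lambda>t. std_normal.F t + \<phi> t) t :> \<phi> t + - t * \<phi> t"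
      by (intro DERIV_add std_normal.DERIV_F DERIV_phi)
    have "\<phi> t * 1 \<le> \<phi> t * t" using assms \<open>R \<le> t\<close> phi_pos[of t] by (intro mult_left_mono) auto
    then show "\<phi> t + - t * \<phi> t \<le> 0" by (simp add: mult.commute)
  qed simp
  then show False using y p(1) phi_pos[of y] by simp
qed

lemma std_normal_lower_tail:
  assumes "R \<ge> 1" shows "std_normal.F (- R) \<le> \<phi> R"
proof (rule ccontr)
  assume "\<not> ?thesis"
  then have lt: "0 < std_normal.F (- R) - \<phi> R" by simp
  define p where "p = (std_normal.F (- R) - \<phi> R) / 2"
  have p: "p < std_normal.F (- R) - \<phi> R" "0 < p" "p < 1"
    using lt std_normal.F_range[of "-R"] phi_pos[of R] by (auto simp: p_def)
  then obtain y where y: "std_normal.F y = p" using std_normal.F_surj by blast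
  have "y < - R" using p(1) y phi_pos[of R] std_normal.F_less_iff[of y "-R"] by simp
  then have "std_normal.F (- R) - \<phi> (- R) \<le> std_normal.F y - \<phi> y"
  proof (intro DERIV_nonpos_imp_nonincreasing[where f="\<lambda>t. std_normal.F t - \<phi> t"] exI conjI)
    fix t assume "t \<le> - R"
    show "DERIV (\<lambda>t. std_normal.F t - \<phi> t) t :> \<phi> t - - t * \<phi> t"
      by (intro DERIV_diff std_normal.DERIV_F DERIV_phi)
    have "\<phi> t * 1 \<le> \<phi> t * (- t)" using assms \<open>t \<le> - R\<close> phi_pos[of t] by (intro mult_left_mono) auto
    then show "\<phi> t - - t * \<phi> t \<le> 0" by (simp add: mult.commute)
  qed simp
  then show False using y p(1) phi_pos[of y] by simp
qed

lemma phi_level: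
  assumes "0 < \<kappa>" "\<kappa> \<le> \<phi> 1"
  shows "\<exists>R\<ge>1. \<phi> R = \<kappa>"
proof -
  have "\<kappa> \<le> 1" using assms phi_le_1[of 1] by simp
  then have "1 \<le> 1 / \<kappa>" using assms by simp
  moreover have "\<phi> (1 / \<kappa>) \<le> \<kappa>" using phi_le_inverse[of "1 / \<kappa>"] assms by simp
  ultimately show ?thesis
    using IVT2[of \<phi> "1 / \<kappa>" \<kappa> 1] assms isCont_phi by blast
qed

text \<open>Polynomial factors are absorbed by the Gaussian, also when it is evaluated at a point at bounded
distance; the quadratic Taylor bound for the exponential is enough. The constant is not optimal.\<close>

lemma gaussian_weight_bound:
  assumes "\<bar>s - x\<bar> \<le> 3"
  shows "(1 + \<bar>x\<bar>) * (1 + x\<^sup>2) * (\<bar>s\<bar> * \<phi> s) \<le> 200"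
proof -
  define t where "t = \<bar>s\<bar>"
  have t0: "t \<ge> 0" by (simp add: t_def)
  have x: "\<bar>x\<bar> \<le> t + 3" using assms by (simp add: t_def)
  have "x\<^sup>2 \<le> (t + 3)\<^sup>2" using power_mono[OF x, of 2] by simp
  then have "(1 + \<bar>x\<bar>) * (1 + x\<^sup>2) \<le> (4 + t) * (1 + (t + 3)\<^sup>2)"
    using x t0 by (intro mult_mono) auto
  then have "(1 + \<bar>x\<bar>) * (1 + x\<^sup>2) * t \<le> (4 + t) * (1 + (t + 3)\<^sup>2) * t"
    using t0 by (rule mult_right_mono)
  also have "\<dots> \<le> 200 * (1 + t\<^sup>2 / 2 + (t\<^sup>2 / 2)\<^sup>2 / 2)"
  proof -
    have "0 \<le> 5 * (t * (t - 1))\<^sup>2 + 20 * (t - 1)\<^sup>2 + 41 * t\<^sup>2 + 19 * (t\<^sup>2)\<^sup>2"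
      by (intro add_nonneg_nonneg mult_nonneg_nonneg) simp_all
    then show ?thesis by (simp add: power2_eq_square algebra_simps)
  qed
  also have "\<dots> \<le> 200 * exp (t\<^sup>2 / 2)"
    by (intro mult_left_mono exp_lower_Taylor_quadratic) auto
  finally have le: "(1 + \<bar>x\<bar>) * (1 + x\<^sup>2) * t \<le> 200 * exp (t\<^sup>2 / 2)" .
  have "(1 + \<bar>x\<bar>) * (1 + x\<^sup>2) * (\<bar>s\<bar> * \<phi> s) = ((1 + \<bar>x\<bar>) * (1 + x\<^sup>2) * t) * \<phi> s"
    by (simp add: t_def)
  also have "\<dots> \<le> (200 * exp (t\<^sup>2 / 2)) * exp (- s\<^sup>2 / 2)"
    by (rule mult_mono[OF le phi_le_exp]) (use phi_pos[of s] in auto)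
  also have "\<dots> = 200" by (simp add: t_def flip: exp_add)
  finally show ?thesis .
qed

text \<open>The point is that the bound is integrable in \<open>x\<close> although the displacement \<open>t - x\<close> is allowed to grow
linearly.\<close>

lemma phi_diff_bound:
  assumes "\<bar>t - x\<bar> \<le> 3" and d: "\<bar>t - x\<bar> \<le> c * (1 + \<bar>x\<bar>)"
  shows "\<bar>\<phi> t - \<phi> x\<bar> \<le> 200 * c / (1 + x\<^sup>2)"
proof -
  have "\<exists>s. \<bar>s - x\<bar> \<le> 3 \<and> \<bar>\<phi> t - \<phi> x\<bar> = \<bar>t - x\<bar> * (\<bar>s\<bar> * \<phi> s)"
  proof (cases t x rule: linorder_cases)
    case less
    obtain z where "t < z" "z < x" "\<phi> x - \<phi> t = (x - t) * (- z * \<phi> z)"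
      using MVT2[OF less, of \<phi> "\<lambda>z. - z * \<phi> z", OF DERIV_phi] by blast
    then have "\<bar>z - x\<bar> \<le> 3" "\<bar>\<phi> t - \<phi> x\<bar> = \<bar>t - x\<bar> * (\<bar>z\<bar> * \<phi> z)"
      using assms(1) phi_pos[of z] abs_minus_commute[of "\<phi> t"] abs_minus_commute[of t]
      by (auto simp: abs_mult)
    then show ?thesis by blast
  next
    case greater
    obtain z where "x < z" "z < t" "\<phi> t - \<phi> x = (t - x) * (- z * \<phi> z)"
      using MVT2[OF greater, of \<phi> "\<lambda>z. - z * \<phi> z", OF DERIV_phi] by blast
    then have "\<bar>z - x\<bar> \<le> 3" "\<bar>\<phi> t - \<phi> x\<bar> = \<bar>t - x\<bar> * (\<bar>z\<bar> * \<phi> z)"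
      using assms(1) phi_pos[of z] by (auto simp: abs_mult)
    then show ?thesis by blast
  qed (auto intro: exI[of _ x])
  then obtain s where s: "\<bar>s - x\<bar> \<le> 3" and eq: "\<bar>\<phi> t - \<phi> x\<bar> = \<bar>t - x\<bar> * (\<bar>s\<bar> * \<phi> s)" by blast
  have "0 \<le> c * (1 + \<bar>x\<bar>)" using d by linarith
  moreover have "c * (1 + \<bar>x\<bar>) < 0" if "c < 0" using that by (intro mult_neg_pos) auto
  ultimately have c: "0 \<le> c" by (meson not_le)
  have "\<bar>\<phi> t - \<phi> x\<bar> \<le> (c * (1 + \<bar>x\<bar>)) * (\<bar>s\<bar> * \<phi> s)"
    unfolding eq by (rule mult_right_mono[OF d]) (use phi_pos[of s] in simp)
  then have "\<bar>\<phi> t - \<phi> x\<bar> * (1 + x\<^sup>2) \<le> (c * (1 + \<bar>x\<bar>)) * (\<bar>s\<bar> * \<phi> s) * (1 + x\<^sup>2)"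
    by (rule mult_right_mono) simp
  also have "\<dots> = c * ((1 + \<bar>x\<bar>) * (1 + x\<^sup>2) * (\<bar>s\<bar> * \<phi> s))" by (simp add: mult_ac)
  also have "\<dots> \<le> c * 200" by (intro mult_left_mono gaussian_weight_bound s c)
  finally show ?thesis by (simp add: field_simps add_pos_nonneg)
qed

text \<open>The parameter \<open>\<epsilon>\<close> stands for the square root of twice the deficit, or any larger number, and \<open>m\<close> is
the median of the measure with density \<open>\<rho>\<close>, the point that \<open>T\<close> sends to the Gaussian median \<open>0\<close>.\<close>

locale small_deficit = regular_gauss_density +
  fixes M \<epsilon> m :: real
  assumes moment_integrable: "integrable lborel (\<lambda>x. x\<^sup>2 * (\<phi> x * f x))"
    and moment_le: "(LINT x|lborel. x\<^sup>2 * (\<phi> x * f x)) \<le> M"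
    and mean_integrable: "integrable lborel (\<lambda>x. x * (\<phi> x * f x))"
    and mean_0: "(LINT x|lborel. x * (\<phi> x * f x)) = 0"
    and \<epsilon>_pos: "0 < \<epsilon>" and deficit_le: "2 * \<delta> \<le> \<epsilon>\<^sup>2"
    and \<epsilon>_le: "sqrt \<epsilon> \<le> \<phi> 1" "sqrt \<epsilon> \<le> 1 / 8"
    and T_m: "T m = 0"
begin

lemma profile: "\<bar>\<rho> x - \<phi> (T x)\<bar> \<le> \<epsilon>"
  by (rule profile_diff_le[OF \<epsilon>_pos deficit_le])

lemma sqrt_sq: "sqrt \<epsilon> * sqrt \<epsilon> = \<epsilon>"
  using \<epsilon>_pos by simp

lemma \<epsilon>_small: "2 * \<epsilon> \<le> sqrt \<epsilon>" "\<epsilon> \<le> 1 / 8"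
proof -
  have "sqrt \<epsilon> * sqrt \<epsilon> \<le> (1 / 8) * sqrt \<epsilon>" using \<epsilon>_le \<epsilon>_pos by (intro mult_right_mono) auto
  then have *: "\<epsilon> \<le> (1 / 8) * sqrt \<epsilon>" by (simp add: sqrt_sq)
  then show "\<epsilon> \<le> 1 / 8" using \<epsilon>_le by simp
  show "2 * \<epsilon> \<le> sqrt \<epsilon>" using * \<epsilon>_pos by simp
qed

text \<open>Dividing the uniform bound on \<open>\<rho> - \<phi>(T)\<close> by \<open>\<phi>(T)\<close> gives a bound on \<open>1 - T'\<close>, useful where \<open>\<phi>(T)\<close> is
large compared with \<open>\<epsilon>\<close>.\<close>

lemma slope:
  assumes "2 * \<epsilon> \<le> \<phi> (T z)"
  shows "1 / 2 \<le> \<rho> z / \<phi> (T z)" "\<bar>1 - \<rho> z / \<phi> (T z)\<bar> \<le> \<epsilon> / \<phi> (T z)"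
proof -
  have p: "\<phi> (T z) > 0" by (rule phi_pos)
  have "\<phi> (T z) - \<epsilon> \<le> \<rho> z" using profile[of z] by linarith
  then have "\<phi> (T z) / 2 \<le> \<rho> z" using assms by linarith
  then show "1 / 2 \<le> \<rho> z / \<phi> (T z)" using p by (simp add: field_simps)
  have "\<bar>1 - \<rho> z / \<phi> (T z)\<bar> = \<bar>(\<phi> (T z) - \<rho> z) / \<phi> (T z)\<bar>"
    using p by (simp add: diff_divide_distrib)
  also have "\<dots> = \<bar>\<rho> z - \<phi> (T z)\<bar> / \<phi> (T z)" using p by (simp add: abs_minus_commute)
  also have "\<dots> \<le> \<epsilon> / \<phi> (T z)" using p profile[of z] by (intro divide_right_mono) auto
  finally show "\<bar>1 - \<rho> z / \<phi> (T z)\<bar> \<le> \<epsilon> / \<phi> (T z)" .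
qed

text \<open>Integrating \<open>T'\<close> from the median. Between \<open>m\<close> and \<open>x\<close> the values of \<open>T\<close> are at most \<open>\<bar>T x\<bar>\<close> in
modulus, so the bound on \<open>T'\<close> at \<open>x\<close> holds on the whole way.\<close>

lemma displacement:
  assumes x: "2 * \<epsilon> \<le> \<phi> (T x)"
  shows "\<bar>x - m\<bar> \<le> 2 * \<bar>T x\<bar>" "\<bar>x - T x - m\<bar> \<le> 2 * \<epsilon> * \<bar>T x\<bar> / \<phi> (T x)"
proof -
  have "\<exists>z. \<bar>T z\<bar> \<le> \<bar>T x\<bar> \<and> T x = (x - m) * (\<rho> z / \<phi> (T z))"
  proof (cases m x rule: linorder_cases)
    case less
    obtain z where z: "m < z" "z < x" "T x - T m = (x - m) * (\<rho> z / \<phi> (T z))"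
      using MVT2[OF less, of T "\<lambda>z. \<rho> z / \<phi> (T z)", OF DERIV_T] by blast
    then have "0 < T z" "T z < T x" using T_less_iff[of m z] T_less_iff[of z x] T_m by auto
    then have "\<bar>T z\<bar> \<le> \<bar>T x\<bar>" by simp
    moreover have "T x = (x - m) * (\<rho> z / \<phi> (T z))" using z(3) T_m by simp
    ultimately show ?thesis by blast
  next
    case greater
    obtain z where z: "x < z" "z < m" "T m - T x = (m - x) * (\<rho> z / \<phi> (T z))"
      using MVT2[OF greater, of T "\<lambda>z. \<rho> z / \<phi> (T z)", OF DERIV_T] by blast
    then have "T z < 0" "T x < T z" using T_less_iff[of z m] T_less_iff[of x z] T_m by auto
    moreover have "T x = - ((m - x) * (\<rho> z / \<phi> (T z)))" using z(3) T_m by linarith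
    then have "T x = (x - m) * (\<rho> z / \<phi> (T z))" by (simp only: mult_minus_left[symmetric] minus_diff_eq)
    moreover from calculation have "\<bar>T z\<bar> \<le> \<bar>T x\<bar>" by linarith
    ultimately show ?thesis by blast
  qed (use T_m in \<open>auto intro: exI[of _ x]\<close>)
  then obtain z where z: "\<bar>T z\<bar> \<le> \<bar>T x\<bar>" and Tx: "T x = (x - m) * (\<rho> z / \<phi> (T z))" by blast
  have zx: "\<phi> (T x) \<le> \<phi> (T z)" using z by (simp add: phi_le_iff)
  with x have z2: "2 * \<epsilon> \<le> \<phi> (T z)" by simp
  have "\<bar>x - m\<bar> * (1 / 2) \<le> \<bar>x - m\<bar> * (\<rho> z / \<phi> (T z))"
    by (intro mult_left_mono slope(1)[OF z2]) simp
  also have "\<dots> = \<bar>T x\<bar>"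
    unfolding Tx abs_mult using pos[of z] phi_pos[of "T z"] f_pos[of z] phi_pos[of z] by (simp add: abs_mult)
  finally show xm: "\<bar>x - m\<bar> \<le> 2 * \<bar>T x\<bar>" by simp
  have "x - T x - m = (x - m) * (1 - \<rho> z / \<phi> (T z))"
    using Tx by (simp add: right_diff_distrib)
  then have "\<bar>x - T x - m\<bar> = \<bar>x - m\<bar> * \<bar>1 - \<rho> z / \<phi> (T z)\<bar>" by (simp only: abs_mult)
  also have "\<dots> \<le> (2 * \<bar>T x\<bar>) * (\<epsilon> / \<phi> (T z))"
    by (intro mult_mono xm slope(2)[OF z2]) auto
  also have "\<dots> \<le> (2 * \<bar>T x\<bar>) * (\<epsilon> / \<phi> (T x))"
    using zx phi_pos \<epsilon>_pos by (intro mult_left_mono divide_left_mono) auto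
  finally show "\<bar>x - T x - m\<bar> \<le> 2 * \<epsilon> * \<bar>T x\<bar> / \<phi> (T x)" by (simp add: mult_ac)
qed

lemma central_interval:
  assumes R: "R \<ge> 1"
  shows "\<exists>l r. T l = - R \<and> T r = R \<and> l \<le> r \<and> (\<forall>x\<in>{l..r}. \<bar>T x\<bar> \<le> R) \<and>
    (LINT x|lborel. indicator (- {l..r}) x * \<rho> x) \<le> 2 * \<phi> R"
proof -
  obtain l where l: "T l = - R" using T_surj by blast
  obtain r where r: "T r = R" using T_surj by blast
  have lr: "l \<le> r" using T_le_iff[of l r] l r R by simp
  have abs: "\<bar>T x\<bar> \<le> R" if "x \<in> {l..r}" for x
    using that T_le_iff[of l x] T_le_iff[of x r] l r by auto
  note i = integrable_indicator_mult[OF integrable]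
  have "(LINT x|lborel. indicator (- {l..r}) x * \<rho> x) = (LINT x|lborel. \<rho> x - indicator {l..r} x * \<rho> x)"
    by (intro Bochner_Integration.integral_cong) (auto simp: indicator_def)
  also have "\<dots> = 1 - (LBINT x:{l..r}. \<rho> x)"
    using integrable i[of "{l..r}"] total by (simp add: set_lebesgue_integral_def)
  also have "\<dots> = 1 - (F r - F l)" using antideriv_integral[OF antideriv_F lr] by simp
  also have "\<dots> = (1 - std_normal.F R) + std_normal.F (- R)" using F_T[of r] F_T[of l] l r by simp
  also have "\<dots> \<le> 2 * \<phi> R" using std_normal_upper_tail[OF R] std_normal_lower_tail[OF R] by simp
  finally have "(LINT x|lborel. indicator (- {l..r}) x * \<rho> x) \<le> 2 * \<phi> R" .
  with l r lr abs show ?thesis by blast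
qed

lemma antideriv_T: "antideriv T (\<lambda>x. \<rho> x / \<phi> (T x))"
proof (rule antideriv_DERIV[OF DERIV_T])
  show "isCont (\<lambda>x. \<rho> x / \<phi> (T x)) x" for x
    using phi_pos[of "T x"]
    by (auto intro!: continuous_intros isCont_phi isCont_f isCont_o2[OF isCont_T isCont_phi])
qed

text \<open>Centering fixes the translation. Let \<open>R\<close> be the level with \<open>\<phi> R = 2 * \<epsilon>\<close>. Where \<open>\<bar>T\<bar> \<le> R\<close>, the integral
of \<open>(x - m) * \<rho>\<close> equals that of \<open>(x - T - m) * \<rho>\<close>, as \<open>T\<close> has mean zero there by symmetry; the
displacement bound and \<open>\<rho> / \<phi>(T) = T'\<close> make it at most \<open>4 * \<epsilon> * R\<^sup>2\<close>, and \<open>R\<^sup>2 \<le> 2 / sqrt \<epsilon>\<close>. The rest of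
the line has mass \<open>O(\<epsilon>)\<close>, so by the second moment its first moment is \<open>O(sqrt \<epsilon>)\<close>.\<close>

lemma median_le: "\<bar>m\<bar> \<le> 2 * (M + 9) * sqrt \<epsilon>"
proof -
  have "2 * \<epsilon> \<le> \<phi> 1" using \<epsilon>_small(1) \<epsilon>_le(1) by simp
  then obtain R where R: "R \<ge> 1" "\<phi> R = 2 * \<epsilon>" using phi_level[of "2 * \<epsilon>"] \<epsilon>_pos by auto
  obtain l r where l: "T l = - R" and r: "T r = R" and lr: "l \<le> r"
    and A: "\<And>x. x \<in> {l..r} \<Longrightarrow> \<bar>T x\<bar> \<le> R"
    and tail: "(LINT x|lborel. indicator (- {l..r}) x * \<rho> x) \<le> 2 * \<phi> R"
    using central_interval[OF R(1)] by blast
  have R2: "\<epsilon> * R\<^sup>2 \<le> 2 * sqrt \<epsilon>"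
  proof -
    have "1 + R\<^sup>2 / 2 + (R\<^sup>2 / 2)\<^sup>2 / 2 \<le> exp (R\<^sup>2 / 2)" by (rule exp_lower_Taylor_quadratic) simp
    moreover have "(R\<^sup>2)\<^sup>2 / 8 = (R\<^sup>2 / 2)\<^sup>2 / 2" by (simp add: power_divide)
    ultimately have "(R\<^sup>2)\<^sup>2 / 8 \<le> exp (R\<^sup>2 / 2)" using zero_le_power2[of R] by linarith
    then have "(R\<^sup>2)\<^sup>2 / 8 * (2 * \<epsilon>) \<le> exp (R\<^sup>2 / 2) * exp (- R\<^sup>2 / 2)"
      using phi_le_exp[of R] R \<epsilon>_pos by (intro mult_mono) auto
    also have "\<dots> = 1" by (simp flip: exp_add)
    finally have "\<epsilon> * (R\<^sup>2)\<^sup>2 \<le> 4" by simp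
    then have "\<epsilon> * (\<epsilon> * (R\<^sup>2)\<^sup>2) \<le> \<epsilon> * 4" by (rule mult_left_mono) (use \<epsilon>_pos in simp)
    moreover have "(\<epsilon> * R\<^sup>2)\<^sup>2 = \<epsilon> * (\<epsilon> * (R\<^sup>2)\<^sup>2)" by (simp add: power2_eq_square)
    moreover have "(2 * sqrt \<epsilon>)\<^sup>2 = \<epsilon> * 4" using \<epsilon>_pos by (simp add: power_mult_distrib)
    ultimately have "(\<epsilon> * R\<^sup>2)\<^sup>2 \<le> (2 * sqrt \<epsilon>)\<^sup>2" by simp
    then show ?thesis by (rule power2_le_imp_le) (use \<epsilon>_pos in simp)
  qed
  note iA = integrable_indicator_mult
  have ixm: "integrable lborel (\<lambda>x. (x - m) * \<rho> x)"
    using mean_integrable f_integrable by (simp add: left_diff_distrib)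
  have "- m = (LINT x|lborel. (x - m) * \<rho> x)"
    using mean_integrable f_integrable mean_0 f_total by (simp add: left_diff_distrib)
  also have "\<dots> = (LINT x|lborel. indicator {l..r} x * ((x - m) * \<rho> x) + indicator (- {l..r}) x * ((x - m) * \<rho> x))"
    by (intro Bochner_Integration.integral_cong) (auto simp: indicator_def)
  also have "\<dots> = (LBINT x:{l..r}. (x - m) * \<rho> x) + (LINT x|lborel. indicator (- {l..r}) x * ((x - m) * \<rho> x))"
    using iA[OF ixm, of "{l..r}"] iA[OF ixm, of "- {l..r}"] by (simp add: set_lebesgue_integral_def)
  finally have m_eq: "- m = (LBINT x:{l..r}. (x - m) * \<rho> x) + (LINT x|lborel. indicator (- {l..r}) x * ((x - m) * \<rho> x))" .
  have inner: "\<bar>LBINT x:{l..r}. (x - m) * \<rho> x\<bar> \<le> 8 * sqrt \<epsilon>"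
  proof -
    have 1: "antideriv (\<lambda>x. - \<phi> (T x)) (\<lambda>x. T x * \<rho> x)"
    proof (rule antideriv_DERIV)
      show "DERIV (\<lambda>x. - \<phi> (T x)) x :> T x * \<rho> x" for x
        using DERIV_minus[OF DERIV_phi_T[of x]] by simp
      show "isCont (\<lambda>x. T x * \<rho> x) x" for x
        by (auto intro!: continuous_intros isCont_T isCont_phi isCont_f)
    qed
    have s1: "set_integrable lborel {l..r} (\<lambda>x. T x * \<rho> x)" by (rule antideriv_integrable[OF 1])
    have s2: "set_integrable lborel {l..r} (\<lambda>x. (x - T x - m) * \<rho> x)"
      by (rule borel_integrable_atLeastAtMost')
         (auto intro!: continuous_at_imp_continuous_on continuous_intros isCont_T isCont_phi isCont_f)
    have s3: "set_integrable lborel {l..r} (\<lambda>x. (2 * \<epsilon> * R) * (\<rho> x / \<phi> (T x)))"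
      using antideriv_integrable[OF antideriv_T] by (rule set_integrable_mult_right)
    have "(LBINT x:{l..r}. (x - m) * \<rho> x) = (LBINT x:{l..r}. T x * \<rho> x + (x - T x - m) * \<rho> x)"
      by (simp add: algebra_simps)
    also have "\<dots> = (LBINT x:{l..r}. T x * \<rho> x) + (LBINT x:{l..r}. (x - T x - m) * \<rho> x)"
      by (rule set_integral_add(2)[OF s1 s2])
    also have "(LBINT x:{l..r}. T x * \<rho> x) = 0"
      using antideriv_integral[OF 1 lr] l r by simp
    finally have eq: "(LBINT x:{l..r}. (x - m) * \<rho> x) = (LBINT x:{l..r}. (x - T x - m) * \<rho> x)" by simp
    have "\<bar>LBINT x:{l..r}. (x - T x - m) * \<rho> x\<bar> \<le> (LBINT x:{l..r}. \<bar>(x - T x - m) * \<rho> x\<bar>)"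
      using set_integral_norm_bound[OF s2] by simp
    also have "\<dots> \<le> (LBINT x:{l..r}. (2 * \<epsilon> * R) * (\<rho> x / \<phi> (T x)))"
    proof (rule set_integral_mono[OF set_integrable_abs[OF s2] s3])
      fix x assume x: "x \<in> {l..r}"
      have "\<phi> R \<le> \<phi> (T x)" using A[OF x] R(1) by (simp add: phi_le_iff)
      then have "\<bar>x - T x - m\<bar> \<le> 2 * \<epsilon> * \<bar>T x\<bar> / \<phi> (T x)"
        using R(2) by (intro displacement(2)) simp
      also have "\<dots> \<le> 2 * \<epsilon> * R / \<phi> (T x)"
        using A[OF x] \<epsilon>_pos phi_pos[of "T x"] by (intro divide_right_mono mult_left_mono) auto
      finally have "\<bar>x - T x - m\<bar> * \<rho> x \<le> 2 * \<epsilon> * R / \<phi> (T x) * \<rho> x"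
        by (rule mult_right_mono) (use pos[of x] in simp)
      then show "\<bar>(x - T x - m) * \<rho> x\<bar> \<le> (2 * \<epsilon> * R) * (\<rho> x / \<phi> (T x))"
        using less_imp_le[OF pos[of x]] by (simp only: abs_mult[of _ "\<rho> x"] abs_of_nonneg times_divide_eq_left times_divide_eq_right)
    qed
    also have "\<dots> = (2 * \<epsilon> * R) * (T r - T l)"
      unfolding set_integral_mult_right antideriv_integral[OF antideriv_T lr] ..
    also have "\<dots> = 4 * (\<epsilon> * R\<^sup>2)" using l r by (simp add: power2_eq_square)
    also have "\<dots> \<le> 8 * sqrt \<epsilon>" using R2 by simp
    finally show ?thesis unfolding eq .
  qed
  have outer: "\<bar>LINT x|lborel. indicator (- {l..r}) x * ((x - m) * \<rho> x)\<bar> \<le> sqrt \<epsilon> * M + (1 / (4 * sqrt \<epsilon>) + \<bar>m\<bar>) * (4 * \<epsilon>)"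
  proof -
    have "\<bar>LINT x|lborel. indicator (- {l..r}) x * ((x - m) * \<rho> x)\<bar> \<le> (LINT x|lborel. \<bar>indicator (- {l..r}) x * ((x - m) * \<rho> x)\<bar>)"
      by (rule integral_abs_bound)
    also have "\<dots> \<le> (LINT x|lborel. sqrt \<epsilon> * (x\<^sup>2 * \<rho> x) + (1 / (4 * sqrt \<epsilon>) + \<bar>m\<bar>) * (indicator (- {l..r}) x * \<rho> x))"
    proof (rule integral_mono)
      show "integrable lborel (\<lambda>x. \<bar>indicator (- {l..r}) x * ((x - m) * \<rho> x)\<bar>)"
        by (rule integrable_abs[OF iA[OF ixm]]) simp
      show "integrable lborel (\<lambda>x. sqrt \<epsilon> * (x\<^sup>2 * \<rho> x) + (1 / (4 * sqrt \<epsilon>) + \<bar>m\<bar>) * (indicator (- {l..r}) x * \<rho> x))"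
        by (intro Bochner_Integration.integrable_add integrable_mult_right moment_integrable iA f_integrable) simp
      fix x
      show "\<bar>indicator (- {l..r}) x * ((x - m) * \<rho> x)\<bar> \<le> sqrt \<epsilon> * (x\<^sup>2 * \<rho> x) + (1 / (4 * sqrt \<epsilon>) + \<bar>m\<bar>) * (indicator (- {l..r}) x * \<rho> x)"
      proof (cases "x \<in> {l..r}")
        case True
        then show ?thesis using \<epsilon>_pos less_imp_le[OF pos[of x]] by simp
      next
        case False
        \<comment> \<open>the weight \<open>sqrt \<epsilon>\<close> balances the second moment against the mass \<open>O(\<epsilon>)\<close> of the tail\<close>
        have "\<bar>x\<bar> \<le> sqrt \<epsilon> * x\<^sup>2 + 1 / (4 * sqrt \<epsilon>)"
        proof -
          define s where "s = sqrt \<epsilon>"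
          have "s > 0" using \<epsilon>_pos by (simp add: s_def)
          have "0 \<le> (2 * s * \<bar>x\<bar> - 1)\<^sup>2" by simp
          then have "4 * s * \<bar>x\<bar> \<le> 4 * s\<^sup>2 * x\<^sup>2 + 1"
            by (simp add: power2_diff power_mult_distrib)
          then show ?thesis unfolding s_def[symmetric] using \<open>s > 0\<close>
            by (simp add: field_simps power2_eq_square)
        qed
        then have "\<bar>x - m\<bar> \<le> sqrt \<epsilon> * x\<^sup>2 + (1 / (4 * sqrt \<epsilon>) + \<bar>m\<bar>)" by linarith
        then have "\<bar>x - m\<bar> * \<rho> x \<le> (sqrt \<epsilon> * x\<^sup>2 + (1 / (4 * sqrt \<epsilon>) + \<bar>m\<bar>)) * \<rho> x"
          by (rule mult_right_mono) (use pos[of x] in simp)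
        moreover have "\<bar>indicator (- {l..r}) x * ((x - m) * \<rho> x)\<bar> = \<bar>x - m\<bar> * \<rho> x"
          using False f_pos[of x] phi_pos[of x] by (simp add: abs_mult)
        moreover have "indicator (- {l..r}) x = (1::real)" using False by simp
        ultimately show ?thesis by (simp add: distrib_right mult.assoc)
      qed
    qed
    also have "\<dots> = sqrt \<epsilon> * (LINT x|lborel. x\<^sup>2 * \<rho> x) + (1 / (4 * sqrt \<epsilon>) + \<bar>m\<bar>) * (LINT x|lborel. indicator (- {l..r}) x * \<rho> x)"
      using moment_integrable iA[OF f_integrable, of "- {l..r}"] by simp
    also have "\<dots> \<le> sqrt \<epsilon> * M + (1 / (4 * sqrt \<epsilon>) + \<bar>m\<bar>) * (4 * \<epsilon>)"
      using moment_le tail R(2) \<epsilon>_pos by (intro add_mono mult_left_mono) auto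
    finally show ?thesis .
  qed
  have "1 / (4 * sqrt \<epsilon>) * (4 * \<epsilon>) = sqrt \<epsilon>"
    using \<epsilon>_pos real_div_sqrt[of \<epsilon>] by simp
  moreover have "\<bar>m\<bar> * (4 * \<epsilon>) \<le> \<bar>m\<bar> * (1 / 2)"
    using \<epsilon>_small(2) by (intro mult_left_mono) auto
  ultimately have "\<bar>m\<bar> \<le> 8 * sqrt \<epsilon> + (sqrt \<epsilon> * M + sqrt \<epsilon> + \<bar>m\<bar> * (1 / 2))"
    using m_eq inner outer unfolding distrib_right by linarith
  then show ?thesis by (simp add: algebra_simps)
qed

text \<open>The positive part of \<open>\<rho> - \<phi>\<close> carries half of the L1 distance, because both densities have mass \<open>1\<close>.
Cut at the level \<open>\<phi> R = sqrt \<epsilon>\<close>, higher than for the median: outside, \<open>\<rho>\<close> has mass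
\<open>O(sqrt \<epsilon>)\<close>; inside, \<open>T x - x\<close> is \<open>O(sqrt \<epsilon> * (1 + \<bar>x\<bar>))\<close>, so \<open>\<phi>(T)\<close> is close to \<open>\<phi>\<close> in L1, and the
uniform error \<open>\<epsilon>\<close> is integrated over an interval of length at most \<open>4 * R\<close>, where \<open>sqrt \<epsilon> * R \<le> 1\<close>.\<close>

lemma L1_le:
  assumes m1: "2 * (M + 9) * sqrt \<epsilon> \<le> 1"
  shows "(LINT x|lborel. \<bar>\<rho> x - \<phi> x\<bar>) \<le> (12 + 400 * pi * (2 * (M + 9) + 8)) * sqrt \<epsilon>"
proof -
  define q where "q = sqrt \<epsilon>"
  have q: "0 < q" using \<epsilon>_pos by (simp add: q_def)
  have qq: "q * q = \<epsilon>" using \<epsilon>_pos by (simp add: q_def)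
  define m0 where "m0 = 2 * (M + 9)"
  have m: "\<bar>m\<bar> \<le> m0 * q" "\<bar>m\<bar> \<le> 1" using median_le m1 by (simp_all add: m0_def q_def)
  have m0: "0 \<le> m0" using m(1) q by (metis abs_ge_zero order_trans zero_le_mult_iff not_less)
  obtain R where R: "R \<ge> 1" "\<phi> R = q" using phi_level[of q] q \<epsilon>_le(1) by (auto simp: q_def)
  have qR: "q * R \<le> 1" using phi_le_inverse[of R] R by (simp add: field_simps)
  obtain l r where l: "T l = - R" and r: "T r = R" and lr: "l \<le> r"
    and A: "\<And>x. x \<in> {l..r} \<Longrightarrow> \<bar>T x\<bar> \<le> R"
    and tail: "(LINT x|lborel. indicator (- {l..r}) x * \<rho> x) \<le> 2 * \<phi> R"
    using central_interval[OF R(1)] by blast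
  have eR: "2 * \<epsilon> \<le> \<phi> R" using \<epsilon>_small(1) R(2) by (simp add: q_def)
  define c where "c = q * (m0 + 8)"
  have c: "0 \<le> c" using q m0 by (simp add: c_def)
  have near: "\<bar>\<rho> x - \<phi> x\<bar> \<le> \<epsilon> + 200 * c * (1 / (1 + x\<^sup>2))" if x: "x \<in> {l..r}" for x
  proof -
    have phiT: "q \<le> \<phi> (T x)" using A[OF x] R by (simp add: phi_le_iff flip: R(2))
    then have "\<bar>x - T x - m\<bar> \<le> 2 * \<epsilon> * \<bar>T x\<bar> / \<phi> (T x)"
      using eR R(2) by (intro displacement(2)) simp
    also have "\<dots> \<le> 2 * \<epsilon> * \<bar>T x\<bar> / q"
      using phiT q \<epsilon>_pos by (intro divide_left_mono) auto
    also have "\<dots> = 2 * q * \<bar>T x\<bar>" using q by (simp flip: qq)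
    finally have d: "\<bar>T x - x\<bar> \<le> \<bar>m\<bar> + 2 * q * \<bar>T x\<bar>" by linarith
    have "q * \<bar>T x\<bar> \<le> q * R" using A[OF x] q by (intro mult_left_mono) auto
    then have d3: "\<bar>T x - x\<bar> \<le> 3" using d m(2) qR by linarith
    have "q * \<bar>T x\<bar> \<le> q * (\<bar>x\<bar> + 3)" using d3 q by (intro mult_left_mono) auto
    then have "\<bar>T x - x\<bar> \<le> m0 * q + 2 * (q * (\<bar>x\<bar> + 3))" using d m(1) by linarith
    also have "\<dots> \<le> c * (1 + \<bar>x\<bar>)"
    proof -
      have "0 \<le> m0 * q * \<bar>x\<bar>" "0 \<le> q * \<bar>x\<bar>" using m0 q by auto
      then show ?thesis using q by (simp add: c_def algebra_simps)
    qed
    finally have "\<bar>\<phi> (T x) - \<phi> x\<bar> \<le> 200 * c / (1 + x\<^sup>2)" by (rule phi_diff_bound[OF d3])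
    then show ?thesis using profile[of x] by simp
  qed
  have AT: "antideriv arctan (\<lambda>x. inverse (1 + x\<^sup>2))"
    by (rule antideriv_DERIV[OF DERIV_arctan]) (auto intro!: continuous_intros simp: sum_power2_eq_zero_iff add_nonneg_eq_0_iff)
  note iA = integrable_indicator_mult
  have AX: "antideriv (\<lambda>x. \<epsilon> * x + (200 * c) * arctan x) (\<lambda>x. \<epsilon> * 1 + (200 * c) * inverse (1 + x\<^sup>2))"
    by (intro antideriv_add antideriv_cmult AT antideriv_DERIV DERIV_ident) simp
  define h where "h x = \<epsilon> * 1 + (200 * c) * inverse (1 + x\<^sup>2)" for x :: real
  have ih: "integrable lborel (\<lambda>x. indicator {l..r} x * h x)"
    using antideriv_integrable[OF AX, of l r] by (simp add: set_integrable_def h_def)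
  have i\<phi>: "integrable lborel \<phi>" by simp
  \<comment> \<open>\<open>\<bar>y\<bar> = 2 * max y 0 - y\<close>, and the last summand integrates to zero\<close>
  have "(LINT x|lborel. \<bar>\<rho> x - \<phi> x\<bar>) \<le>
      (LINT x|lborel. 2 * (indicator (- {l..r}) x * \<rho> x) + 2 * (indicator {l..r} x * h x) - (\<rho> x - \<phi> x))"
  proof (rule integral_mono)
    show "integrable lborel (\<lambda>x. \<bar>\<rho> x - \<phi> x\<bar>)"
      by (intro integrable_abs Bochner_Integration.integrable_diff f_integrable i\<phi>)
    show "integrable lborel (\<lambda>x. 2 * (indicator (- {l..r}) x * \<rho> x) + 2 * (indicator {l..r} x * h x) - (\<rho> x - \<phi> x))"
      by (intro Bochner_Integration.integrable_diff Bochner_Integration.integrable_add integrable_mult_right iA ih f_integrable i\<phi>) simp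
    show "\<bar>\<rho> x - \<phi> x\<bar> \<le> 2 * (indicator (- {l..r}) x * \<rho> x) + 2 * (indicator {l..r} x * h x) - (\<rho> x - \<phi> x)" for x
    proof (cases "x \<in> {l..r}")
      case True
      then have "\<bar>\<rho> x - \<phi> x\<bar> \<le> h x" using near[OF True] by (simp add: h_def inverse_eq_divide)
      moreover have "indicator {l..r} x = (1::real)" "indicator (- {l..r}) x = (0::real)" using True by simp_all
      ultimately show ?thesis by simp
    next
      case False
      then have "indicator {l..r} x = (0::real)" "indicator (- {l..r}) x = (1::real)" by simp_all
      moreover have "\<bar>\<rho> x - \<phi> x\<bar> \<le> \<rho> x + \<phi> x" using pos[of x] phi_pos[of x] by linarith
      ultimately show ?thesis by (simp add: mult.commute)
    qed
  qed
  also have "\<dots> = 2 * (LINT x|lborel. indicator (- {l..r}) x * \<rho> x) + 2 * (LBINT x:{l..r}. h x) - ((LINT x|lborel. \<rho> x) - (LINT x|lborel. \<phi> x))"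
    using iA[OF f_integrable, of "- {l..r}"] ih f_integrable i\<phi> by (simp add: set_lebesgue_integral_def)
  also have "(LBINT x:{l..r}. h x) = \<epsilon> * (r - l) + 200 * c * (arctan r - arctan l)"
    using antideriv_integral[OF AX lr] unfolding h_def by (simp add: algebra_simps)
  also have "(LINT x|lborel. \<rho> x) - (LINT x|lborel. \<phi> x) = 0" using f_total by simp
  finally have E: "(LINT x|lborel. \<bar>\<rho> x - \<phi> x\<bar>) \<le>
      2 * (LINT x|lborel. indicator (- {l..r}) x * \<rho> x) + 2 * (\<epsilon> * (r - l) + 200 * c * (arctan r - arctan l))" by simp
  have "\<bar>l - m\<bar> \<le> 2 * R" "\<bar>r - m\<bar> \<le> 2 * R"
    using displacement(1)[of l] displacement(1)[of r] l r eR R(1) by auto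
  then have "r - l \<le> 4 * R" by linarith
  then have "\<epsilon> * (r - l) \<le> \<epsilon> * (4 * R)" using \<epsilon>_pos by (intro mult_left_mono) auto
  also have "\<dots> = 4 * q * (q * R)" by (simp flip: qq)
  also have "\<dots> \<le> 4 * q * 1" using qR q by (intro mult_left_mono) auto
  finally have e1: "\<epsilon> * (r - l) \<le> 4 * q" by simp
  have "arctan r - arctan l \<le> pi" using arctan_ubound[of r] arctan_lbound[of l] by simp
  then have e2: "200 * c * (arctan r - arctan l) \<le> 200 * c * pi" using c by (intro mult_left_mono) auto
  note E
  also have "2 * (LINT x|lborel. indicator (- {l..r}) x * \<rho> x) + 2 * (\<epsilon> * (r - l) + 200 * c * (arctan r - arctan l))
      \<le> 2 * (2 * q) + 2 * (4 * q + 200 * c * pi)"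
    by (intro add_mono mult_left_mono[of _ _ 2] tail[unfolded R(2)] e1 e2) simp_all
  also have "\<dots> = (12 + 400 * pi * (m0 + 8)) * q" by (simp add: c_def algebra_simps)
  finally show ?thesis by (simp add: m0_def q_def)
qed

end

section \<open>Reduction to positive densities\<close>

text \<open>The second summand takes care of large deficits, for which the trivial bound \<open>2\<close> on the L1 distance
is used.\<close>

definition L1_const :: "real \<Rightarrow> real" where
  "L1_const M = (12 + 400 * pi * (2 * (M + 9) + 8)) + 2 / min (\<phi> 1) (min (1 / 8) (1 / (2 * (M + 9))))"

lemma L1_const_pos: "M \<ge> 1 \<Longrightarrow> 0 < L1_const M"
  unfolding L1_const_def using phi_pos[of 1] by (intro add_pos_pos divide_pos_pos) (auto intro!: add_pos_pos mult_pos_pos)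

lemma (in regular_gauss_density) L1_stability:
  assumes moment_integrable: "integrable lborel (\<lambda>x. x\<^sup>2 * \<rho> x)"
    and moment_le: "(LINT x|lborel. x\<^sup>2 * \<rho> x) \<le> M" and M: "M \<ge> 1"
    and mean_integrable: "integrable lborel (\<lambda>x. x * \<rho> x)"
    and mean_0: "(LINT x|lborel. x * \<rho> x) = 0"
    and \<epsilon>: "0 < \<epsilon>" "2 * \<delta> \<le> \<epsilon>\<^sup>2"
  shows "(LINT x|lborel. \<bar>\<rho> x - \<phi> x\<bar>) \<le> L1_const M * sqrt \<epsilon>"
proof -
  define s0 where "s0 = min (\<phi> 1) (min (1 / 8) (1 / (2 * (M + 9))))"
  have s0: "0 < s0" using phi_pos[of 1] M by (simp add: s0_def)
  define K where "K = 12 + 400 * pi * (2 * (M + 9) + 8)"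
  have K: "0 \<le> K" using M by (simp add: K_def)
  have C: "L1_const M = K + 2 / s0" by (simp add: L1_const_def K_def s0_def)
  show ?thesis
  proof (cases "sqrt \<epsilon> \<le> s0")
    case True
    obtain m where m: "T m = 0" using T_surj by blast
    have s: "sqrt \<epsilon> \<le> \<phi> 1" "sqrt \<epsilon> \<le> 1 / 8" "sqrt \<epsilon> \<le> 1 / (2 * (M + 9))"
      using True by (simp_all add: s0_def)
    interpret small_deficit f f' M \<epsilon> m
      by unfold_locales (use assms s m in auto)
    have "2 * (M + 9) * sqrt \<epsilon> \<le> 1" using s(3) M by (simp add: field_simps)
    then have "(LINT x|lborel. \<bar>\<rho> x - \<phi> x\<bar>) \<le> K * sqrt \<epsilon>"
      unfolding K_def by (rule L1_le)
    also have "\<dots> \<le> L1_const M * sqrt \<epsilon>"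
      unfolding C using s0 \<epsilon> by (intro mult_right_mono) auto
    finally show ?thesis .
  next
    case False
    have "(LINT x|lborel. \<bar>\<rho> x - \<phi> x\<bar>) \<le> (LINT x|lborel. \<rho> x + \<phi> x)"
    proof (rule integral_mono)
      show "integrable lborel (\<lambda>x. \<bar>\<rho> x - \<phi> x\<bar>)" "integrable lborel (\<lambda>x. \<rho> x + \<phi> x)"
        using f_integrable by auto
      show "\<bar>\<rho> x - \<phi> x\<bar> \<le> \<rho> x + \<phi> x" for x
        using pos[of x] phi_pos[of x] by linarith
    qed
    also have "\<dots> = 2" using f_integrable f_total by simp
    also have "\<dots> \<le> 2 / s0 * sqrt \<epsilon>" using False s0 by (simp add: field_simps)
    also have "\<dots> \<le> L1_const M * sqrt \<epsilon>"
      unfolding C using K \<epsilon> by (intro mult_right_mono) auto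
    finally show ?thesis .
  qed
qed

lemma le_if_le_add_small:
  fixes c :: real
  assumes "0 < c" "\<And>\<eta>. 0 < \<eta> \<Longrightarrow> x \<le> c * (y + \<eta>)"
  shows "x \<le> c * y"
proof (rule field_le_epsilon)
  fix e :: real assume "0 < e"
  then have "x \<le> c * (y + e / c)" using assms by (intro assms(2)) simp
  then show "x \<le> c * y + e" using assms(1) by (simp add: distrib_left)
qed

lemma neg_mult_ln_le:
  fixes t :: real
  assumes "0 \<le> t" shows "- (t * ln t) \<le> 1 - t"
proof (cases "t = 0")
  case False
  have "ln (1 / t) \<le> 1 / t - 1" using False assms by (intro ln_le_minus_one) simp
  then have "t * ln (1 / t) \<le> t * (1 / t - 1)" using assms by (intro mult_left_mono) auto
  then show ?thesis using False assms by (simp add: ln_div right_diff_distrib)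
qed simp

text \<open>Here \<open>U\<^sup>2\<close> is the density and may vanish, so it is mixed with the Gaussian: the density
\<open>(1 - \<tau>) * U\<^sup>2 + \<tau>\<close> is positive, keeps the moment bounds, and has L1 distance \<open>(1 - \<tau>)\<close> times the original
one. Its Fisher information is at most \<open>(1 - \<tau>)\<close> times the original, and its entropy is bounded below by
monotonicity of the logarithm, so its deficit is at most \<open>(1 - \<tau>) * D + \<tau> + 2 * sqrt \<tau>\<close>. Let \<open>\<tau>\<close> tend
to \<open>0\<close>.\<close>

lemma L1_stability_square:
  fixes U g :: "real \<Rightarrow> real"
  assumes U: "antideriv U g"
    and U_int: "integrable lborel (\<lambda>x. \<phi> x * (U x)\<^sup>2)" and U_total: "(LINT x|lborel. \<phi> x * (U x)\<^sup>2) = 1"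
    and g_int: "integrable lborel (\<lambda>x. \<phi> x * (g x)\<^sup>2)"
    and ent_int: "integrable lborel (\<lambda>x. \<phi> x * ((U x)\<^sup>2 * ln ((U x)\<^sup>2)))"
    and mom_int: "integrable lborel (\<lambda>x. x\<^sup>2 * (\<phi> x * (U x)\<^sup>2))"
    and mom_le: "(LINT x|lborel. x\<^sup>2 * (\<phi> x * (U x)\<^sup>2)) \<le> M" and M: "M \<ge> 1"
    and mean_int: "integrable lborel (\<lambda>x. x * (\<phi> x * (U x)\<^sup>2))"
    and mean_0: "(LINT x|lborel. x * (\<phi> x * (U x)\<^sup>2)) = 0"
    and D: "D = (LINT x|lborel. \<phi> x * ((2 * U x * g x)\<^sup>2 / (U x)\<^sup>2)) / 2
        - (LINT x|lborel. \<phi> x * ((U x)\<^sup>2 * ln ((U x)\<^sup>2)))"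
  shows "0 \<le> D" "(LINT x|lborel. \<phi> x * \<bar>(U x)\<^sup>2 - 1\<bar>) \<le> L1_const M * sqrt (sqrt (2 * D))"
proof -
  have [measurable]: "g \<in> borel_measurable borel" by (rule antideriv_measurable[OF U])
  have [measurable]: "U \<in> borel_measurable borel"
    by (intro borel_measurable_continuous_onI continuous_at_imp_continuous_on ballI antideriv_isCont[OF U])
  define J where "J x = (2 * U x * g x)\<^sup>2 / (U x)\<^sup>2" for x
  have J_nonneg: "0 \<le> J x" for x by (simp add: J_def)
  have [measurable]: "J \<in> borel_measurable borel" unfolding J_def by measurable
  have J_int: "integrable lborel (\<lambda>x. \<phi> x * J x)"
  proof (rule Bochner_Integration.integrable_bound)
    show "integrable lborel (\<lambda>x. 4 * (\<phi> x * (g x)\<^sup>2))" using g_int by simp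
    have "J x \<le> 4 * (g x)\<^sup>2" for x
      by (cases "U x = 0") (simp_all add: J_def power_mult_distrib)
    then have "\<phi> x * J x \<le> \<phi> x * (4 * (g x)\<^sup>2)" for x
      by (intro mult_left_mono) auto
    then show "AE x in lborel. norm (\<phi> x * J x) \<le> norm (4 * (\<phi> x * (g x)\<^sup>2))"
      using J_nonneg by (intro AE_I2) (simp add: abs_mult mult_ac)
  qed measurable
  define H where "H = (LINT x|lborel. \<phi> x * ((U x)\<^sup>2 * ln ((U x)\<^sup>2)))"
  define I where "I = (LINT x|lborel. \<phi> x * J x)"
  have D': "D = I / 2 - H" by (simp add: D I_def J_def H_def)
  define u where "u \<tau> x = (1 - \<tau>) * (U x * U x) + \<tau>" for \<tau> x
  define u' where "u' \<tau> x = (1 - \<tau>) * (g x * U x + U x * g x)" for \<tau> x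
  have L: "regular_gauss_density (u \<tau>) (u' \<tau>) \<and> regular_gauss_density.\<delta> (u \<tau>) (u' \<tau>) \<le> (1 - \<tau>) * D + \<tau> + 2 * sqrt \<tau>"
    if \<tau>: "0 < \<tau>" "\<tau> < 1" for \<tau>
  proof -
    have u_ge: "u \<tau> x \<ge> \<tau>" for x using \<tau> by (simp add: u_def)
    then have u_pos: "u \<tau> x > 0" for x using \<tau>(1) order_less_le_trans by blast
    have [measurable]: "u \<tau> \<in> borel_measurable borel" "u' \<tau> \<in> borel_measurable borel"
      unfolding u_def u'_def by measurable
    have AD: "antideriv (u \<tau>) (u' \<tau>)"
      using antideriv_add[OF antideriv_cmult[OF antideriv_mult[OF U U], of "1 - \<tau>"] antideriv_const[of \<tau>]]
      by (simp add: u_def[abs_def] u'_def[abs_def])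
    have \<phi>u: "\<phi> x * u \<tau> x = (1 - \<tau>) * (\<phi> x * (U x)\<^sup>2) + \<tau> * \<phi> x" for x
      by (simp add: u_def power2_eq_square algebra_simps)
    have int: "integrable lborel (\<lambda>x. \<phi> x * u \<tau> x)"
      unfolding \<phi>u using U_int by simp
    have tot: "(LINT x|lborel. \<phi> x * u \<tau> x) = 1"
      unfolding \<phi>u using U_int U_total by simp
    have ent: "integrable lborel (\<lambda>x. \<phi> x * (u \<tau> x * ln (u \<tau> x)))"
    proof (rule Bochner_Integration.integrable_bound)
      show "integrable lborel (\<lambda>x. \<bar>\<phi> x * ((U x)\<^sup>2 * ln ((U x)\<^sup>2))\<bar> + \<phi> x)"
        using ent_int by simp
      have "\<bar>u \<tau> x * ln (u \<tau> x)\<bar> \<le> \<bar>(U x)\<^sup>2 * ln ((U x)\<^sup>2)\<bar> + 1" for x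
      proof (cases "u \<tau> x \<le> 1")
        case True
        have "- (u \<tau> x * ln (u \<tau> x)) \<le> 1" using neg_mult_ln_le[of "u \<tau> x"] u_pos[of x] by simp
        moreover have "u \<tau> x * ln (u \<tau> x) \<le> 0"
          using u_pos[of x] True by (simp add: mult_nonneg_nonpos)
        ultimately show ?thesis using abs_ge_zero[of "(U x)\<^sup>2 * ln ((U x)\<^sup>2)"] by linarith
      next
        case False
        have "(1 - \<tau>) * ((U x)\<^sup>2 - 1) = u \<tau> x - 1" by (simp add: u_def power2_eq_square algebra_simps)
        then have "0 < (1 - \<tau>) * ((U x)\<^sup>2 - 1)" using False by simp
        then have U1: "1 < (U x)\<^sup>2" using \<tau> by (simp add: zero_less_mult_iff)
        have "\<tau> * 1 \<le> \<tau> * (U x)\<^sup>2" using U1 \<tau> by (intro mult_left_mono) auto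
        then have "u \<tau> x \<le> (U x)\<^sup>2" by (simp add: u_def power2_eq_square algebra_simps)
        moreover from this have "ln (u \<tau> x) \<le> ln ((U x)\<^sup>2)" by (rule ln_mono[OF _ u_pos])
        ultimately have "u \<tau> x * ln (u \<tau> x) \<le> (U x)\<^sup>2 * ln ((U x)\<^sup>2)"
          using False by (intro mult_mono) auto
        moreover have "0 \<le> u \<tau> x * ln (u \<tau> x)" using False by simp
        ultimately show ?thesis by linarith
      qed
      then have "\<phi> x * \<bar>u \<tau> x * ln (u \<tau> x)\<bar> \<le> \<phi> x * (\<bar>(U x)\<^sup>2 * ln ((U x)\<^sup>2)\<bar> + 1)" for x
        by (intro mult_left_mono) auto
      then show "AE x in lborel. norm (\<phi> x * (u \<tau> x * ln (u \<tau> x))) \<le> norm (\<bar>\<phi> x * ((U x)\<^sup>2 * ln ((U x)\<^sup>2))\<bar> + \<phi> x)"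
        by (intro AE_I2) (simp add: abs_mult distrib_left)
    qed measurable
    \<comment> \<open>drop the summand \<open>\<tau>\<close> in the denominator\<close>
    have fle: "(u' \<tau> x)\<^sup>2 / u \<tau> x \<le> (1 - \<tau>) * J x" for x
    proof (cases "U x = 0")
      case True
      then show ?thesis by (simp add: u'_def J_def)
    next
      case False
      have "(u' \<tau> x)\<^sup>2 / u \<tau> x \<le> (u' \<tau> x)\<^sup>2 / ((1 - \<tau>) * (U x)\<^sup>2)"
        using \<tau> False u_pos[of x]
        by (intro divide_left_mono mult_pos_pos zero_less_power2[THEN iffD2]) (simp_all add: u_def power2_eq_square)
      also have "\<dots> = (1 - \<tau>) * J x"
        using \<tau> False by (simp add: u'_def J_def power2_eq_square field_simps)
      finally show ?thesis .
    qed
    have fish: "integrable lborel (\<lambda>x. \<phi> x * ((u' \<tau> x)\<^sup>2 / u \<tau> x))"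
    proof (rule Bochner_Integration.integrable_bound)
      show "integrable lborel (\<lambda>x. (1 - \<tau>) * (\<phi> x * J x))" using J_int by simp
      have "\<phi> x * ((u' \<tau> x)\<^sup>2 / u \<tau> x) \<le> \<phi> x * ((1 - \<tau>) * J x)" for x
        by (intro mult_left_mono fle) simp
      then show "AE x in lborel. norm (\<phi> x * ((u' \<tau> x)\<^sup>2 / u \<tau> x)) \<le> norm ((1 - \<tau>) * (\<phi> x * J x))"
        using \<tau> J_nonneg less_imp_le[OF u_pos] by (intro AE_I2) (simp add: abs_mult mult_ac)
    qed measurable
    interpret LS: regular_gauss_density "u \<tau>" "u' \<tau>"
      by unfold_locales (fact u_pos AD int tot ent fish)+
    have F: "(LINT x|lborel. \<phi> x * ((u' \<tau> x)\<^sup>2 / u \<tau> x)) \<le> (1 - \<tau>) * I"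
    proof -
      have "(LINT x|lborel. \<phi> x * ((u' \<tau> x)\<^sup>2 / u \<tau> x)) \<le> (LINT x|lborel. (1 - \<tau>) * (\<phi> x * J x))"
      proof (rule integral_mono[OF fish])
        show "integrable lborel (\<lambda>x. (1 - \<tau>) * (\<phi> x * J x))" using J_int by simp
        have "\<phi> x * ((u' \<tau> x)\<^sup>2 / u \<tau> x) \<le> \<phi> x * ((1 - \<tau>) * J x)" for x
          by (intro mult_left_mono fle) simp
        then show "\<phi> x * ((u' \<tau> x)\<^sup>2 / u \<tau> x) \<le> (1 - \<tau>) * (\<phi> x * J x)" for x by (simp add: mult_ac)
      qed
      then show ?thesis by (simp add: I_def)
    qed
    have tln: "- (\<tau> * ln \<tau>) \<le> 2 * sqrt \<tau>"
    proof -
      have "ln (1 / sqrt \<tau>) \<le> 1 / sqrt \<tau> - 1" using \<tau> by (intro ln_le_minus_one) simp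
      then have "- ln \<tau> \<le> 2 * (1 / sqrt \<tau>)" using \<tau> by (simp add: ln_div ln_sqrt)
      then have "\<tau> * (- ln \<tau>) \<le> \<tau> * (2 * (1 / sqrt \<tau>))" using \<tau> by (intro mult_left_mono) auto
      also have "\<dots> = 2 * (\<tau> / sqrt \<tau>)" by simp
      also have "\<dots> = 2 * sqrt \<tau>" using \<tau> by (simp only: real_div_sqrt)
      finally show ?thesis by simp
    qed
    have tln1: "- ((1 - \<tau>) * ln (1 - \<tau>)) \<le> \<tau>" using neg_mult_ln_le[of "1 - \<tau>"] \<tau> by simp
    \<comment> \<open>both \<open>u \<tau> \<ge> \<tau>\<close> and \<open>u \<tau> \<ge> (1 - \<tau>) * U\<^sup>2\<close> are inserted into the logarithm\<close>
    have Hle: "(1 - \<tau>) * H + (1 - \<tau>) * ln (1 - \<tau>) + \<tau> * ln \<tau> \<le> (LINT x|lborel. \<phi> x * (u \<tau> x * ln (u \<tau> x)))"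
    proof -
      have pt: "(1 - \<tau>) * ((U x)\<^sup>2 * ln ((U x)\<^sup>2)) + ((1 - \<tau>) * ln (1 - \<tau>)) * (U x)\<^sup>2 + \<tau> * ln \<tau> \<le> u \<tau> x * ln (u \<tau> x)" for x
      proof -
        have "(1 - \<tau>) * (U x)\<^sup>2 * (ln (1 - \<tau>) + ln ((U x)\<^sup>2)) \<le> (1 - \<tau>) * (U x)\<^sup>2 * ln (u \<tau> x)"
        proof (cases "U x = 0")
          case False
          have "ln (1 - \<tau>) + ln ((U x)\<^sup>2) = ln ((1 - \<tau>) * (U x)\<^sup>2)"
            using False \<tau> by (intro ln_mult_pos[symmetric]) auto
          also have "\<dots> \<le> ln (u \<tau> x)"
            using False \<tau>
            by (intro ln_mono mult_pos_pos zero_less_power2[THEN iffD2]) (simp_all add: u_def power2_eq_square)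
          finally show ?thesis using \<tau> by (intro mult_left_mono) auto
        qed simp
        moreover have "\<tau> * ln \<tau> \<le> \<tau> * ln (u \<tau> x)"
          using u_ge[of x] u_pos[of x] \<tau> by (intro mult_left_mono) auto
        ultimately show ?thesis by (simp add: u_def power2_eq_square algebra_simps)
      qed
      let ?l = "\<lambda>x. (1 - \<tau>) * (\<phi> x * ((U x)\<^sup>2 * ln ((U x)\<^sup>2))) + ((1 - \<tau>) * ln (1 - \<tau>)) * (\<phi> x * (U x)\<^sup>2) + \<tau> * ln \<tau> * \<phi> x"
      have "(LINT x|lborel. ?l x) = (1 - \<tau>) * H + (1 - \<tau>) * ln (1 - \<tau>) + \<tau> * ln \<tau>"
        using ent_int U_int U_total by (simp add: H_def)
      moreover have "(LINT x|lborel. ?l x) \<le> (LINT x|lborel. \<phi> x * (u \<tau> x * ln (u \<tau> x)))"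
      proof (rule integral_mono[OF _ ent])
        show "integrable lborel ?l" using ent_int U_int by simp
        fix x
        have "?l x = \<phi> x * ((1 - \<tau>) * ((U x)\<^sup>2 * ln ((U x)\<^sup>2)) + ((1 - \<tau>) * ln (1 - \<tau>)) * (U x)\<^sup>2 + \<tau> * ln \<tau>)"
          by (simp add: algebra_simps)
        also have "\<dots> \<le> \<phi> x * (u \<tau> x * ln (u \<tau> x))" by (intro mult_left_mono pt) simp
        finally show "?l x \<le> \<phi> x * (u \<tau> x * ln (u \<tau> x))" .
      qed
      ultimately show ?thesis by simp
    qed
    have "LS.\<delta> \<le> (1 - \<tau>) * D + \<tau> + 2 * sqrt \<tau>"
    proof -
      have "(1 - \<tau>) * (I / 2 - H) = (1 - \<tau>) * I / 2 - (1 - \<tau>) * H" by (simp add: right_diff_distrib)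
      then show ?thesis using F Hle tln tln1 unfolding LS.\<delta>_def D' by linarith
    qed
    then show ?thesis using LS.regular_gauss_density_axioms by blast
  qed
  have lim: "((\<lambda>\<tau>. (1 - \<tau>) * D + \<tau> + 2 * sqrt \<tau>) \<longlongrightarrow> D) (at_right 0)"
  proof -
    have "((\<lambda>\<tau>. (1 - \<tau>) * D + \<tau> + 2 * sqrt \<tau>) \<longlongrightarrow> (1 - 0) * D + 0 + 2 * sqrt 0) (at_right 0)"
      by (intro tendsto_intros)
    then show ?thesis by simp
  qed
  have ev: "\<forall>\<^sub>F \<tau> in at_right 0. 0 < \<tau> \<and> \<tau> < (1::real)"
    using eventually_at_right_less[of 0] eventually_at_right_real[of 0 1] by (auto elim: eventually_elim2)
  show D0: "0 \<le> D"
  proof (rule tendsto_lowerbound[OF lim])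
    show "\<forall>\<^sub>F \<tau> in at_right 0. 0 \<le> (1 - \<tau>) * D + \<tau> + 2 * sqrt \<tau>"
      using ev
    proof eventually_elim
      case (elim \<tau>)
      have "regular_gauss_density (u \<tau>) (u' \<tau>)" "regular_gauss_density.\<delta> (u \<tau>) (u' \<tau>) \<le> (1 - \<tau>) * D + \<tau> + 2 * sqrt \<tau>"
        using L elim by auto
      then show ?case using regular_gauss_density.deficit_nonneg order_trans by blast
    qed
  qed simp
  define A where "A = (LINT x|lborel. \<phi> x * \<bar>(U x)\<^sup>2 - 1\<bar>)"
  have bound: "A \<le> L1_const M * sqrt \<epsilon>" if \<epsilon>: "0 < \<epsilon>" "2 * D < \<epsilon>\<^sup>2" for \<epsilon>
  proof (rule tendsto_upperbound)
    show "((\<lambda>\<tau>. (1 - \<tau>) * A) \<longlongrightarrow> A) (at_right 0)"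
      by (rule tendsto_eq_intros refl | simp)+
    have "\<forall>\<^sub>F \<tau> in at_right 0. (1 - \<tau>) * D + \<tau> + 2 * sqrt \<tau> < \<epsilon>\<^sup>2 / 2"
      by (rule order_tendstoD(2)[OF lim]) (use \<epsilon> in simp)
    with ev show "\<forall>\<^sub>F \<tau> in at_right 0. (1 - \<tau>) * A \<le> L1_const M * sqrt \<epsilon>"
    proof eventually_elim
      case (elim \<tau>)
      then interpret LS: regular_gauss_density "u \<tau>" "u' \<tau>" using L by blast
      have d: "2 * LS.\<delta> \<le> \<epsilon>\<^sup>2" using L[of \<tau>] elim by auto
      have \<phi>u: "\<phi> x * u \<tau> x = (1 - \<tau>) * (\<phi> x * (U x)\<^sup>2) + \<tau> * \<phi> x" for x
        by (simp add: u_def power2_eq_square algebra_simps)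
      have m2: "integrable lborel (\<lambda>x. \<phi> x * x ^ 2)" "(LINT x|lborel. \<phi> x * x ^ 2) = 1"
        using integrable_std_normal_moment[of 2] integral_std_normal_moment_even[of 1] by simp_all
      have m1: "integrable lborel (\<lambda>x. \<phi> x * x)" "(LINT x|lborel. \<phi> x * x) = 0"
        using integrable_std_normal_moment[of 1] integral_std_normal_moment_odd[of 0] by simp_all
      have e2: "x\<^sup>2 * (\<phi> x * u \<tau> x) = (1 - \<tau>) * (x\<^sup>2 * (\<phi> x * (U x)\<^sup>2)) + \<tau> * (\<phi> x * x\<^sup>2)" for x
        unfolding \<phi>u by (simp add: algebra_simps)
      have e1: "x * (\<phi> x * u \<tau> x) = (1 - \<tau>) * (x * (\<phi> x * (U x)\<^sup>2)) + \<tau> * (\<phi> x * x)" for x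
        unfolding \<phi>u by (simp add: algebra_simps)
      have "(LINT x|lborel. \<bar>\<phi> x * u \<tau> x - \<phi> x\<bar>) \<le> L1_const M * sqrt \<epsilon>"
      proof (rule LS.L1_stability[OF _ _ M _ _ \<epsilon>(1) d])
        show "integrable lborel (\<lambda>x. x\<^sup>2 * (\<phi> x * u \<tau> x))" unfolding e2 using mom_int m2 by simp
        have "(LINT x|lborel. x\<^sup>2 * (\<phi> x * u \<tau> x)) = (1 - \<tau>) * (LINT x|lborel. x\<^sup>2 * (\<phi> x * (U x)\<^sup>2)) + \<tau> * 1"
          unfolding e2 using mom_int m2 by simp
        also have "\<dots> \<le> (1 - \<tau>) * M + \<tau> * M"
          using elim mom_le M by (intro add_mono mult_left_mono) auto
        finally show "(LINT x|lborel. x\<^sup>2 * (\<phi> x * u \<tau> x)) \<le> M" by (simp add: algebra_simps)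
        show "integrable lborel (\<lambda>x. x * (\<phi> x * u \<tau> x))" unfolding e1 using mean_int m1 by simp
        show "(LINT x|lborel. x * (\<phi> x * u \<tau> x)) = 0" unfolding e1 using mean_int m1 mean_0 by simp
      qed
      also have "(LINT x|lborel. \<bar>\<phi> x * u \<tau> x - \<phi> x\<bar>) = (LINT x|lborel. (1 - \<tau>) * (\<phi> x * \<bar>(U x)\<^sup>2 - 1\<bar>))"
      proof (rule Bochner_Integration.integral_cong[OF refl])
        fix x
        have "\<phi> x * u \<tau> x - \<phi> x = (1 - \<tau>) * (\<phi> x * ((U x)\<^sup>2 - 1))"
          unfolding \<phi>u by (simp add: algebra_simps)
        then show "\<bar>\<phi> x * u \<tau> x - \<phi> x\<bar> = (1 - \<tau>) * (\<phi> x * \<bar>(U x)\<^sup>2 - 1\<bar>)"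
          using elim by (simp add: abs_mult)
      qed
      finally show ?case by (simp add: A_def)
    qed
  qed simp
  have "A\<^sup>2 \<le> (L1_const M)\<^sup>2 * sqrt (2 * D)"
  proof (rule le_if_le_add_small)
    show "0 < (L1_const M)\<^sup>2" using L1_const_pos[OF M] by simp
    fix \<eta> :: real assume \<eta>: "0 < \<eta>"
    have s: "0 \<le> sqrt (2 * D)" using D0 by simp
    have "2 * D = (sqrt (2 * D))\<^sup>2" using D0 by simp
    also have "\<dots> < (sqrt (2 * D) + \<eta>)\<^sup>2" using s \<eta> by (intro power_strict_mono) auto
    finally have "A \<le> L1_const M * sqrt (sqrt (2 * D) + \<eta>)"
      by (intro bound add_nonneg_pos s \<eta>)
    moreover have "0 \<le> A" unfolding A_def by (intro Bochner_Integration.integral_nonneg) simp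
    ultimately have "A\<^sup>2 \<le> (L1_const M * sqrt (sqrt (2 * D) + \<eta>))\<^sup>2" by (intro power_mono)
    then show "A\<^sup>2 \<le> (L1_const M)\<^sup>2 * (sqrt (2 * D) + \<eta>)"
      using s \<eta> by (simp add: power_mult_distrib)
  qed
  also have "\<dots> = (L1_const M * sqrt (sqrt (2 * D)))\<^sup>2"
    using D0 by (simp add: power_mult_distrib)
  finally show "(LINT x|lborel. \<phi> x * \<bar>(U x)\<^sup>2 - 1\<bar>) \<le> L1_const M * sqrt (sqrt (2 * D))"
    unfolding A_def by (rule power2_le_imp_le) (use L1_const_pos[OF M] D0 in auto)
qed

section \<open>Densities with respect to the Gaussian measure\<close>

lemma AE_gauss_iff: "(AE x in gauss. P x) \<longleftrightarrow> (AE x in lborel. P x)"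
  unfolding gauss_def by (subst AE_density) (auto simp: phi_pos)

lemma measurable_gauss_iff: "u \<in> borel_measurable gauss \<longleftrightarrow> u \<in> borel_measurable borel"
  by (simp add: gauss_def)

lemma integrable_gauss_iff:
  fixes u :: "real \<Rightarrow> real"
  assumes [measurable]: "u \<in> borel_measurable borel"
  shows "integrable gauss u \<longleftrightarrow> integrable lborel (\<lambda>x. \<phi> x * u x)"
  unfolding gauss_def by (subst integrable_density) auto

lemma integral_gauss:
  fixes u :: "real \<Rightarrow> real"
  assumes [measurable]: "u \<in> borel_measurable borel"
  shows "(LINT x|gauss. u x) = (LINT x|lborel. \<phi> x * u x)"
  unfolding gauss_def by (subst integral_density) auto

lemma gauss_AE_eq_transfer:
  fixes u v :: "real \<Rightarrow> real"
  assumes [measurable]: "u \<in> borel_measurable borel" "v \<in> borel_measurable borel"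
    and eq: "AE x in lborel. u x = v x"
  shows "integrable gauss u \<longleftrightarrow> integrable lborel (\<lambda>x. \<phi> x * v x)"
    "(LINT x|gauss. u x) = (LINT x|lborel. \<phi> x * v x)"
proof -
  have e: "AE x in lborel. \<phi> x * u x = \<phi> x * v x" using eq by eventually_elim simp
  show "integrable gauss u \<longleftrightarrow> integrable lborel (\<lambda>x. \<phi> x * v x)"
    unfolding integrable_gauss_iff[OF assms(1)] by (rule integrable_cong_AE) (use e in auto)
  show "(LINT x|gauss. u x) = (LINT x|lborel. \<phi> x * v x)"
    unfolding integral_gauss[OF assms(1)] by (rule integral_cong_AE) (use e in auto)
qed

lemma integrable_if_nn_integral_le:
  fixes u :: "'a \<Rightarrow> real"
  assumes "u \<in> borel_measurable M" "AE x in M. 0 \<le> u x" "(\<integral>\<^sup>+x. ennreal (u x) \<partial>M) \<le> ennreal B" "0 \<le> B"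
  shows "integrable M u" "(LINT x|M. u x) \<le> B"
proof -
  show I: "integrable M u"
    using assms by (intro integrableI_nonneg) (auto simp: le_less_trans)
  show "(LINT x|M. u x) \<le> B"
    using assms nn_integral_eq_integral[OF I assms(2)] by simp
qed

text \<open>The function \<open>f\<close> is almost everywhere the square of the absolutely continuous representative \<open>U\<close> of
its square root. The Leibniz rule identifies the weak derivative of \<open>f\<close> as \<open>2 * U * U'\<close>, so the Fisher
information and the entropy are those of \<open>U\<^sup>2\<close>.\<close>

lemma L1_stability_gauss:
  assumes dens: "gauss_prob_density f"
    and cent: "centered (density gauss (\<lambda>x. ennreal (f x)))"
    and W: "in_W12_gauss (\<lambda>x. sqrt (f x))"
    and mom: "(\<integral>\<^sup>+x. ennreal (\<bar>x\<bar>\<^sup>2 * f x) \<partial>gauss) \<le> ennreal M" and M: "M \<ge> 1"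
    and ent: "integrable gauss (\<lambda>x. f x * ln (f x))"
  shows "0 \<le> deficit f" "integrable gauss f"
    "(LINT x|gauss. \<bar>f x - 1\<bar>) \<le> L1_const M * sqrt (sqrt (2 * deficit f))"
proof -
  have [measurable]: "f \<in> borel_measurable borel" using dens by (simp add: gauss_prob_density_def)
  have f0: "AE x in gauss. 0 \<le> f x" using dens by (simp add: gauss_prob_density_def)
  obtain g where g: "has_weak_deriv (\<lambda>x. sqrt (f x)) g" "in_Lp gauss 2 g"
    using W by (auto simp: in_W12_gauss_def)
  have [measurable]: "g \<in> borel_measurable borel" using g(2) by (simp add: in_Lp_def measurable_gauss_iff)
  obtain U where U: "antideriv U g" and sU: "AE x in lborel. sqrt (f x) = U x"
    using has_weak_deriv_representative[OF g(1)] by blast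
  have [measurable]: "U \<in> borel_measurable borel"
    by (intro borel_measurable_continuous_onI continuous_at_imp_continuous_on ballI antideriv_isCont[OF U])
  have fU: "AE x in lborel. f x = (U x)\<^sup>2"
    using sU f0[unfolded AE_gauss_iff] by eventually_elim (metis real_sqrt_pow2)
  have "has_weak_deriv (\<lambda>x. U x * U x) (\<lambda>x. g x * U x + U x * g x)"
    by (rule antideriv_imp_weak_deriv[OF antideriv_mult[OF U U]])
  moreover have "AE x in lborel. U x * U x = f x" using fU by eventually_elim (simp add: power2_eq_square)
  moreover have "locally_integrable f"
  proof (rule locally_integrableI)
    fix a b :: real
    have "set_integrable lborel {a..b} (\<lambda>x. U x * U x)"
      by (intro locally_integrable_Icc continuous_locally_integrable continuous_intros antideriv_isCont[OF U])
    moreover have "AE x\<in>{a..b} in lborel. U x * U x = f x"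
      using \<open>AE x in lborel. U x * U x = f x\<close> by eventually_elim simp
    ultimately show "set_integrable lborel {a..b} f"
      by (subst set_integrable_cong_AE[where g="\<lambda>x. U x * U x"]) (auto elim: eventually_mono)
  qed
  ultimately have "has_weak_deriv f (\<lambda>x. g x * U x + U x * g x)" by (rule has_weak_deriv_cong_AE)
  then have "AE x in lborel. weak_deriv f x = g x * U x + U x * g x" by (rule weak_deriv_AE_eq)
  then have fish: "AE x in lborel. (weak_deriv f x)\<^sup>2 / f x = (2 * U x * g x)\<^sup>2 / (U x)\<^sup>2"
    using fU by eventually_elim (simp add: algebra_simps)
  have wm [measurable]: "weak_deriv f \<in> borel_measurable borel"
  proof -
    have "has_weak_deriv f (weak_deriv f)"
      using \<open>has_weak_deriv f _\<close> unfolding weak_deriv_def by (rule someI[of "has_weak_deriv f"])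
    then show ?thesis
      using borel_measurable_if_integrable_Icc locally_integrable_Icc unfolding has_weak_deriv_def by blast
  qed
  have "(\<integral>\<^sup>+x. ennreal (f x) \<partial>gauss) = 1"
    using dens prob_space.emeasure_space_1[of "density gauss (\<lambda>x. ennreal (f x))"]
    by (simp add: gauss_prob_density_def emeasure_density gauss_def)
  then have tot: "integrable gauss f" "(LINT x|gauss. f x) = 1"
  proof -
    assume 1: "(\<integral>\<^sup>+x. ennreal (f x) \<partial>gauss) = 1"
    show "integrable gauss f"
      using f0 1 by (intro integrableI_nonneg) (auto simp: measurable_gauss_iff)
    from nn_integral_eq_integral[OF this f0] 1 show "(LINT x|gauss. f x) = 1"
      using integral_nonneg_AE[OF f0] by simp
  qed
  then show "integrable gauss f" by simp
  have M0: "0 \<le> M" using M by simp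
  have "(\<lambda>x. x\<^sup>2 * f x) \<in> borel_measurable gauss" by (simp add: measurable_gauss_iff)
  moreover have "AE x in gauss. 0 \<le> x\<^sup>2 * f x" using f0 by eventually_elim simp
  moreover have "(\<integral>\<^sup>+x. ennreal (x\<^sup>2 * f x) \<partial>gauss) \<le> ennreal M" using mom by simp
  ultimately have mom': "integrable gauss (\<lambda>x. x\<^sup>2 * f x)" "(LINT x|gauss. x\<^sup>2 * f x) \<le> M"
    by (rule integrable_if_nn_integral_le[OF _ _ _ M0])+
  have cen': "integrable gauss (\<lambda>x. f x * x)" "(LINT x|gauss. f x * x) = 0"
    using cent f0 unfolding centered_def
    by (simp_all add: integrable_density integral_density measurable_gauss_iff)
  have e2: "AE x in lborel. x\<^sup>2 * f x = x\<^sup>2 * (U x)\<^sup>2" using fU by eventually_elim simp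
  have e1: "AE x in lborel. f x * x = (U x)\<^sup>2 * x" using fU by eventually_elim simp
  have eH: "AE x in lborel. f x * ln (f x) = (U x)\<^sup>2 * ln ((U x)\<^sup>2)" using fU by eventually_elim simp
  have eA: "AE x in lborel. \<bar>f x - 1\<bar> = \<bar>(U x)\<^sup>2 - 1\<bar>" using fU by eventually_elim simp
  have D: "deficit f = (LINT x|lborel. \<phi> x * ((2 * U x * g x)\<^sup>2 / (U x)\<^sup>2)) / 2
        - (LINT x|lborel. \<phi> x * ((U x)\<^sup>2 * ln ((U x)\<^sup>2)))"
    unfolding deficit_def fisher_information_def relative_entropy_def
    by (subst gauss_AE_eq_transfer(2)[OF _ _ fish], measurable, subst gauss_AE_eq_transfer(2)[OF _ _ eH]) simp_all
  have g2: "integrable lborel (\<lambda>x. \<phi> x * (g x)\<^sup>2)"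
    using g(2) by (simp add: in_Lp_def integrable_gauss_iff powr_numeral)
  note * = L1_stability_square[OF U _ _ g2 _ _ _ M _ _ D]
  have a1: "integrable lborel (\<lambda>x. \<phi> x * (U x)\<^sup>2)" "(LINT x|lborel. \<phi> x * (U x)\<^sup>2) = 1"
    using tot gauss_AE_eq_transfer[OF _ _ fU] by simp_all
  have a2: "integrable lborel (\<lambda>x. \<phi> x * ((U x)\<^sup>2 * ln ((U x)\<^sup>2)))"
    using ent gauss_AE_eq_transfer(1)[OF _ _ eH] by simp
  have a3: "integrable lborel (\<lambda>x. x\<^sup>2 * (\<phi> x * (U x)\<^sup>2))" "(LINT x|lborel. x\<^sup>2 * (\<phi> x * (U x)\<^sup>2)) \<le> M"
    using mom' gauss_AE_eq_transfer[OF _ _ e2] by (simp_all add: mult_ac)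
  have a4: "integrable lborel (\<lambda>x. x * (\<phi> x * (U x)\<^sup>2))" "(LINT x|lborel. x * (\<phi> x * (U x)\<^sup>2)) = 0"
    using cen' gauss_AE_eq_transfer[OF _ _ e1] by (simp_all add: mult_ac)
  show "0 \<le> deficit f" by (rule *(1)[OF a1 a2 a3 a4])
  show "(LINT x|gauss. \<bar>f x - 1\<bar>) \<le> L1_const M * sqrt (sqrt (2 * deficit f))"
    using *(2)[OF a1 a2 a3 a4] gauss_AE_eq_transfer(2)[OF _ _ eA] by simp
qed

text \<open>For large \<open>t\<close> the logarithm is dominated by the power \<open>q\<close>, and \<open>t * ln t\<close> is bounded near \<open>0\<close>.\<close>

lemma entropy_integrable_if_powr_integrable:
  fixes f :: "real \<Rightarrow> real"
  assumes q: "q > 0" and [measurable]: "f \<in> borel_measurable M" and fin: "finite_measure M"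
    and int: "integrable M (\<lambda>x. \<bar>f x\<bar> powr (1 + q))" and f0: "AE x in M. 0 \<le> f x"
  shows "integrable M (\<lambda>x. f x * ln (f x))"
proof (rule Bochner_Integration.integrable_bound)
  interpret finite_measure M by fact
  show "integrable M (\<lambda>x. 1 + \<bar>f x\<bar> powr (1 + q) / q)" using int by simp
  have "\<bar>t * ln t\<bar> \<le> 1 + t powr (1 + q) / q" if "0 \<le> t" for t :: real
  proof (cases "t \<le> 1")
    case True
    have "- (t * ln t) \<le> 1" using neg_mult_ln_le[OF that] that by simp
    moreover have "t * ln t \<le> 0"
      using that True by (cases "t = 0") (simp_all add: mult_nonneg_nonpos)
    moreover have "0 \<le> t powr (1 + q) / q" using q by simp
    ultimately show ?thesis by linarith
  next
    case False
    have "ln t \<le> t powr q / q" using False q by (intro ln_powr_bound) auto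
    then have "t * ln t \<le> t * (t powr q / q)" using that by (intro mult_left_mono) auto
    also have "\<dots> = t powr (1 + q) / q" using False by (simp add: powr_add)
    finally have "t * ln t \<le> t powr (1 + q) / q" .
    moreover have "0 \<le> t * ln t" using False by simp
    ultimately show ?thesis by simp
  qed
  then show "AE x in M. norm (f x * ln (f x)) \<le> norm (1 + \<bar>f x\<bar> powr (1 + q) / q)"
    using f0 q by (auto elim!: eventually_mono simp: abs_of_nonneg add_nonneg_nonneg)
qed measurable

text \<open>The Cauchy-Schwarz inequality for \<open>\<bar>h\<bar> powr p\<close> as the product of \<open>\<bar>h\<bar> powr (1 / 2)\<close> and
\<open>\<bar>h\<bar> powr (p - 1 / 2)\<close>, in the form of the weighted arithmetic-geometric mean inequality with weight
\<open>r\<close> slightly larger than \<open>s\<close>, which covers \<open>s = 0\<close> as well.\<close>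

lemma Lp_interpolation:
  fixes h :: "'a \<Rightarrow> real"
  assumes p: "p > 1" and [measurable]: "h \<in> borel_measurable M"
    and i1: "integrable M (\<lambda>x. \<bar>h x\<bar>)" and i2: "integrable M (\<lambda>x. \<bar>h x\<bar> powr (2 * p - 1))"
    and A: "(LINT x|M. \<bar>h x\<bar>) \<le> A * s\<^sup>2" and Q: "(LINT x|M. \<bar>h x\<bar> powr (2 * p - 1)) \<le> Q" and AQ: "0 < A + Q" and s: "0 \<le> s"
    and A0: "0 \<le> A"
  shows "integrable M (\<lambda>x. \<bar>h x\<bar> powr p)" "(LINT x|M. \<bar>h x\<bar> powr p) \<le> (A + Q) / 2 * s"
proof -
  have young: "t powr p \<le> (1 / (2 * r)) * t + (r / 2) * t powr (2 * p - 1)" if "0 \<le> t" "0 < r" for t r :: real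
  proof -
    define b where "b = t powr (p - 1)"
    have 1: "t powr p = t * b"
      unfolding b_def using that p by (cases "t = 0") (simp_all add: powr_mult_base)
    have "t powr (2 * p - 1) = t * (t powr (2 * p - 2))"
      using that p by (cases "t = 0") (simp_all add: powr_mult_base)
    also have "t powr (2 * p - 2) = b\<^sup>2"
      unfolding b_def power2_eq_square by (simp flip: powr_add)
    finally have 2: "t powr (2 * p - 1) = t * b\<^sup>2" .
    have "0 \<le> (r * b - 1)\<^sup>2" by simp
    then have "b \<le> 1 / (2 * r) + r / 2 * b\<^sup>2" using that(2) by (simp add: field_simps power2_eq_square)
    then have "t * b \<le> t * (1 / (2 * r) + r / 2 * b\<^sup>2)" using that(1) by (rule mult_left_mono)
    then show ?thesis unfolding 1 2 by (simp add: algebra_simps)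
  qed
  show I: "integrable M (\<lambda>x. \<bar>h x\<bar> powr p)"
  proof (rule Bochner_Integration.integrable_bound)
    show "integrable M (\<lambda>x. (1 / (2 * 1)) * \<bar>h x\<bar> + (1 / 2) * \<bar>h x\<bar> powr (2 * p - 1))"
      using i1 i2 by (intro Bochner_Integration.integrable_add integrable_mult_right)
    show "AE x in M. norm (\<bar>h x\<bar> powr p) \<le> norm ((1 / (2 * 1)) * \<bar>h x\<bar> + (1 / 2) * \<bar>h x\<bar> powr (2 * p - 1))"
      using young[of _ 1] by (intro AE_I2) (smt (verit) abs_ge_zero powr_ge_zero real_norm_def)
  qed measurable
  show "(LINT x|M. \<bar>h x\<bar> powr p) \<le> (A + Q) / 2 * s"
  proof (rule le_if_le_add_small)
    show "0 < (A + Q) / 2" using AQ by simp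
    fix \<eta> :: real assume \<eta>: "0 < \<eta>"
    define r where "r = s + \<eta>"
    have r: "0 < r" "s \<le> r" using s \<eta> by (simp_all add: r_def)
    have "(LINT x|M. \<bar>h x\<bar> powr p) \<le> (LINT x|M. (1 / (2 * r)) * \<bar>h x\<bar> + (r / 2) * \<bar>h x\<bar> powr (2 * p - 1))"
      using i1 i2 young r by (intro integral_mono I) auto
    also have "\<dots> = (1 / (2 * r)) * (LINT x|M. \<bar>h x\<bar>) + (r / 2) * (LINT x|M. \<bar>h x\<bar> powr (2 * p - 1))"
      using i1 i2 by simp
    also have "\<dots> \<le> (1 / (2 * r)) * (A * r\<^sup>2) + (r / 2) * Q"
    proof (intro add_mono mult_left_mono Q)
      have "A * s\<^sup>2 \<le> A * r\<^sup>2" using r s A0 by (intro mult_left_mono power_mono) auto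
      with A show "(LINT x|M. \<bar>h x\<bar>) \<le> A * r\<^sup>2" by simp
    qed (use r in auto)
    also have "\<dots> = (A + Q) / 2 * r" using r by (simp add: power2_eq_square field_simps)
    finally show "(LINT x|M. \<bar>h x\<bar> powr p) \<le> (A + Q) / 2 * (s + \<eta>)" by (simp add: r_def)
  qed
qed

lemma prob_space_gauss: "prob_space gauss"
  unfolding gauss_def by (rule prob_space_normal_density) simp

theorem corollary1p2:
  fixes M p N :: real
  assumes "M \<ge> 1" and "p > 1" and "N > 0"
  shows "\<exists>C>0. \<forall>f :: real \<Rightarrow> real.
    gauss_prob_density f \<longrightarrow>
    centered (density gauss (\<lambda>x. ennreal (f x))) \<longrightarrow>
    in_W12_gauss (\<lambda>x. sqrt (f x)) \<longrightarrow>
    (\<integral>\<^sup>+x. ennreal (\<bar>x\<bar>\<^sup>2 * f x) \<partial>gauss) \<le> ennreal M \<longrightarrow>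
    (\<integral>\<^sup>+x. ennreal (\<bar>f x\<bar> powr (2 * p - 1)) \<partial>gauss) \<le> ennreal N \<longrightarrow>
    in_Lp gauss p (\<lambda>x. f x - 1) \<and>
    Lp_norm gauss p (\<lambda>x. f x - 1) \<le> C * deficit f powr (1 / (8 * p))"
proof -
  interpret prob_space gauss by (rule prob_space_gauss)
  define A where "A = L1_const M"
  have A: "0 < A" unfolding A_def by (rule L1_const_pos[OF assms(1)])
  define Q where "Q = 2 powr (2 * p - 1) * (N + 1)"
  have Q: "0 < Q" using assms by (simp add: Q_def)
  define B where "B = (A + Q) / 2 * 2 powr (1 / 8)"
  have B: "0 < B" using A Q by (simp add: B_def)
  show ?thesis
  proof (intro exI[of _ "B powr (1 / p)"] conjI allI impI)
    show "0 < B powr (1 / p)" using B by simp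
    fix f :: "real \<Rightarrow> real"
    assume f: "gauss_prob_density f" "centered (density gauss (\<lambda>x. ennreal (f x)))"
      "in_W12_gauss (\<lambda>x. sqrt (f x))" "(\<integral>\<^sup>+x. ennreal (\<bar>x\<bar>\<^sup>2 * f x) \<partial>gauss) \<le> ennreal M"
      "(\<integral>\<^sup>+x. ennreal (\<bar>f x\<bar> powr (2 * p - 1)) \<partial>gauss) \<le> ennreal N"
    have fm [measurable]: "f \<in> borel_measurable gauss"
      using f(1) by (simp add: gauss_prob_density_def measurable_gauss_iff)
    have f0: "AE x in gauss. 0 \<le> f x" using f(1) by (simp add: gauss_prob_density_def)
    have pw: "integrable gauss (\<lambda>x. \<bar>f x\<bar> powr (2 * p - 1))" "(LINT x|gauss. \<bar>f x\<bar> powr (2 * p - 1)) \<le> N"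
      using assms(3) by (auto intro!: integrable_if_nn_integral_le[OF _ _ f(5)])
    have ent: "integrable gauss (\<lambda>x. f x * ln (f x))"
      by (rule entropy_integrable_if_powr_integrable[of "2 * p - 2"])
         (use assms pw(1) f0 in \<open>simp_all add: finite_measure_axioms\<close>)
    note L1 = L1_stability_gauss[OF f(1-4) assms(1) ent]
    define d where "d = deficit f"
    have d: "0 \<le> d" using L1(1) by (simp add: d_def)
    have i1: "integrable gauss (\<lambda>x. \<bar>f x - 1\<bar>)" using L1(2) by simp
    have pt: "\<bar>f x - 1\<bar> powr (2 * p - 1) \<le> 2 powr (2 * p - 1) * (\<bar>f x\<bar> powr (2 * p - 1) + 1)" for x
    proof -
      have "\<bar>f x - 1\<bar> \<le> 2 * max \<bar>f x\<bar> 1" by linarith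
      then have "\<bar>f x - 1\<bar> powr (2 * p - 1) \<le> (2 * max \<bar>f x\<bar> 1) powr (2 * p - 1)"
        using assms by (intro powr_mono2) auto
      also have "\<dots> = 2 powr (2 * p - 1) * max \<bar>f x\<bar> 1 powr (2 * p - 1)" by (simp add: powr_mult)
      also have "\<dots> \<le> 2 powr (2 * p - 1) * (\<bar>f x\<bar> powr (2 * p - 1) + 1)"
        by (intro mult_left_mono) (auto simp: max_def)
      finally show ?thesis .
    qed
    have ib: "integrable gauss (\<lambda>x. 2 powr (2 * p - 1) * (\<bar>f x\<bar> powr (2 * p - 1) + 1))"
      using pw(1) by simp
    have i2: "integrable gauss (\<lambda>x. \<bar>f x - 1\<bar> powr (2 * p - 1))"
      by (rule Bochner_Integration.integrable_bound[OF ib]) (use pt in \<open>auto intro!: AE_I2\<close>)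
    have "(LINT x|gauss. \<bar>f x - 1\<bar> powr (2 * p - 1)) \<le> (LINT x|gauss. 2 powr (2 * p - 1) * (\<bar>f x\<bar> powr (2 * p - 1) + 1))"
      by (rule integral_mono[OF i2 ib pt])
    also have "\<dots> = 2 powr (2 * p - 1) * ((LINT x|gauss. \<bar>f x\<bar> powr (2 * p - 1)) + 1)"
      using pw(1) prob_space by simp
    also have "\<dots> \<le> Q" unfolding Q_def using pw(2) by (intro mult_left_mono) auto
    finally have Qle: "(LINT x|gauss. \<bar>f x - 1\<bar> powr (2 * p - 1)) \<le> Q" .
    \<comment> \<open>up to a constant, the L1 bound is \<open>(2 * d) powr (1 / 4)\<close>, and interpolation takes its square root\<close>
    define s where "s = (2 * d) powr (1 / 8)"
    have s2: "s\<^sup>2 = sqrt (sqrt (2 * d))"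
      using d by (simp add: s_def power2_eq_square powr_powr flip: powr_add powr_half_sqrt)
    have A1: "(LINT x|gauss. \<bar>f x - 1\<bar>) \<le> A * s\<^sup>2"
      using L1(3) unfolding s2 A_def d_def .
    have fm1: "(\<lambda>x. f x - 1) \<in> borel_measurable gauss" by measurable
    have AQ: "0 < A + Q" "0 \<le> s" "0 \<le> A" using A Q by (simp_all add: s_def)
    note Lp = Lp_interpolation[OF assms(2) fm1 i1 i2 A1 Qle AQ]
    show "in_Lp gauss p (\<lambda>x. f x - 1)" using Lp(1) fm1 by (simp add: in_Lp_def)
    have "Lp_norm gauss p (\<lambda>x. f x - 1) \<le> ((A + Q) / 2 * s) powr (1 / p)"
      unfolding Lp_norm_def using assms(2) Lp(2)
      by (intro powr_mono2 Bochner_Integration.integral_nonneg) auto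
    also have "(A + Q) / 2 * s = B * d powr (1 / 8)"
      unfolding s_def B_def using d by (simp add: powr_mult)
    also have "\<dots> powr (1 / p) = B powr (1 / p) * d powr (1 / (8 * p))"
      using B by (simp add: powr_mult powr_powr)
    finally show "Lp_norm gauss p (\<lambda>x. f x - 1) \<le> B powr (1 / p) * deficit f powr (1 / (8 * p))"
      by (simp add: d_def)
  qed
qed

end
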